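(* Let $\beta,r,R\in\mathbb{R}$ with $\beta\ge1$ and $0<r\le R$. Then there is a positive constant $C$ (depending only on $\beta,r,R$) such that, with $\epsilon(k,m):=C\sqrt{k\log m/m}$, the following holds for every $m\ge2$ and every $k\ge1$. Consider the extended stochastic ball model (ESBM) in $\mathbb{R}^m$ with $k$ balls $B^m_{r_i}(c_i)$, probability measures $\mu_i$ and multipliers $\beta_i$, $i\in[k]$, as defined in the context. For every $i\in[k]$, assume that the probability space $(\mu_i,B^m_{r_i}(c_i))$ satisfies (a1), (a2), (a3), and that $r_i\in[r,R]$ and $\beta_i\le\beta$. If for every $i\ne j$ we have \[ d(c_i,c_j)>(1+\beta)R+\max\{r_i,r_j\}+\epsilon(k,m), \] then (LP) achieves exact recovery with high probability.
   Context: Notation: $d$ is the Euclidean distance, $B^m_r(c)$ the closed ball of radius $r>0$ and center $c$ in $\mathbb{R}^m$, $[k]=\{1,\dots,k\}$. ESBM: for every $i\in[k]$, $(\mu_i,B^m_{r_i}(c_i))$ is a probability space (i.e. $\mu_i$ is a Borel probability measure on the ball) and $\beta_i\ge1$ is fixed. For each $i\in[k]$ one draws $n_i:=\beta_i n$ i.i.d. random vectors $x^{(i)}_\ell$, $\ell\in[n_i]$, according to $\mu_i$ (draws from different balls being independent; $n$ is understood to be such that all $\beta_i n$ are integers). Assumptions: (a1) $\mu_i$ is invariant under rotations centered in $c_i$; (a2) every open subset of $B^m_{r_i}(c_i)$ containing $c_i$ has positive probability measure; (a3) every subset of $B^m_{r_i}(c_i)$ with zero Lebesgue measure has zero probability measure.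 With $P$ the set of all sampled points, (LP) is \[ \min \sum_{p,q\in P} d(p,q)z_{pq}\ \text{ s.t. }\ \sum_{p\in P}z_{pq}=1\ \forall q\in P;\ z_{pq}\le y_p\ \forall p,q\in P;\ \sum_{p\in P}y_p=k;\ y_p,z_{pq}\ge0\ \forall p,q\in P, \] and (IP) is the same program with $y_p,z_{pq}\in\{0,1\}$. (LP) achieves exact recovery if it has a unique optimal solution, this solution is also feasible (thus optimal) to (IP), and it assigns each point to the ball from which it is drawn (exactly one point drawn from each ball has $y_p=1$, and $z_{pq}=1$ only if $p,q$ are drawn from the same ball). An event $A_n$ depending on the parameter $n$ happens with high probability if for every $\delta\in(0,1)$ there exists $N>0$ such that $\mathbb{P}(A_n)>1-\delta$ whenever $n>N$. *)

theory Defs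
  imports "HOL-Probability.Probability" "Jordan_Normal_Form.Determinant"
begin

text \<open>
  The dimension \<open>m\<close> has to be quantified inside formulas (after a constant that must not depend on
  it), so $\mathbb{R}^m$ is represented by the functions \<open>nat \<Rightarrow> real\<close> that are extensional on
  \<open>{..<m}\<close>. This is the common carrier of \<^const>\<open>PiM\<close> and \<^const>\<open>product_topology\<close>, which provide
  the Borel and Lebesgue measures and the Euclidean topology.
\<close>

abbreviation Rn :: "nat \<Rightarrow> (nat \<Rightarrow> real) set" where
  "Rn m \<equiv> {..<m} \<rightarrow>\<^sub>E UNIV"

abbreviation Rn_topology :: "nat \<Rightarrow> (nat \<Rightarrow> real) topology" where
  "Rn_topology m \<equiv> product_topology (\<lambda>_. euclidean) {..<m}"

abbreviation Rn_borel :: "nat \<Rightarrow> (nat \<Rightarrow> real) measure" where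
  "Rn_borel m \<equiv> PiM {..<m} (\<lambda>_. borel)"

abbreviation Rn_lborel :: "nat \<Rightarrow> (nat \<Rightarrow> real) measure" where
  "Rn_lborel m \<equiv> PiM {..<m} (\<lambda>_. lborel)"

definition Rn_dist :: "nat \<Rightarrow> (nat \<Rightarrow> real) \<Rightarrow> (nat \<Rightarrow> real) \<Rightarrow> real" where
  "Rn_dist m x y = L2_set (\<lambda>i. x i - y i) {..<m}"

definition Rn_cball :: "nat \<Rightarrow> (nat \<Rightarrow> real) \<Rightarrow> real \<Rightarrow> (nat \<Rightarrow> real) set" where
  "Rn_cball m c r = {x \<in> Rn m. Rn_dist m c x \<le> r}"

definition rotation_mat :: "nat \<Rightarrow> real mat \<Rightarrow> bool" where
  "rotation_mat m Q \<longleftrightarrow>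
     Q \<in> carrier_mat m m \<and> Q * transpose_mat Q = 1\<^sub>m m \<and> Determinant.det Q = 1"

definition rotate_about :: "nat \<Rightarrow> (nat \<Rightarrow> real) \<Rightarrow> real mat \<Rightarrow> (nat \<Rightarrow> real) \<Rightarrow> (nat \<Rightarrow> real)" where
  "rotate_about m c Q x = (\<lambda>i\<in>{..<m}. c i + (\<Sum>j<m. Q $$ (i, j) * (x j - c j)))"


definition rotation_invariant :: "nat \<Rightarrow> (nat \<Rightarrow> real) \<Rightarrow> (nat \<Rightarrow> real) measure \<Rightarrow> bool" where
  "rotation_invariant m c \<mu> \<longleftrightarrow>
     (\<forall>Q. rotation_mat m Q \<longrightarrow> distr \<mu> \<mu> (rotate_about m c Q) = \<mu>)"

definition positive_near_center ::
    "nat \<Rightarrow> (nat \<Rightarrow> real) \<Rightarrow> real \<Rightarrow> (nat \<Rightarrow> real) measure \<Rightarrow> bool" where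
  "positive_near_center m c r \<mu> \<longleftrightarrow>
     (\<forall>A. openin (subtopology (Rn_topology m) (Rn_cball m c r)) A \<and> c \<in> A \<longrightarrow> 0 < emeasure \<mu> A)"

definition lebesgue_null_imp_null ::
    "nat \<Rightarrow> (nat \<Rightarrow> real) \<Rightarrow> real \<Rightarrow> (nat \<Rightarrow> real) measure \<Rightarrow> bool" where
  "lebesgue_null_imp_null m c r \<mu> \<longleftrightarrow>
     (\<forall>A. A \<subseteq> Rn_cball m c r \<and> A \<in> null_sets (Rn_lborel m) \<longrightarrow> emeasure \<mu> A = 0)"


text \<open>
  Parameters of the extended stochastic ball model: centers \<open>c\<close>, radii \<open>\<rho>\<close>, probability
  measures \<open>\<mu>\<close> and multipliers \<open>b\<close>, all indexed by \<open>{1..k}\<close>.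
\<close>

definition esbm :: "nat \<Rightarrow> nat \<Rightarrow> (nat \<Rightarrow> nat \<Rightarrow> real) \<Rightarrow> (nat \<Rightarrow> real) \<Rightarrow>
    (nat \<Rightarrow> (nat \<Rightarrow> real) measure) \<Rightarrow> (nat \<Rightarrow> real) \<Rightarrow> bool" where
  "esbm m k c \<rho> \<mu> b \<longleftrightarrow>
     (\<forall>i\<in>{1..k}. c i \<in> Rn m \<and> 0 < \<rho> i \<and> 1 \<le> b i \<and> prob_space (\<mu> i) \<and>
        sets (\<mu> i) = sets (restrict_space (Rn_borel m) (Rn_cball m (c i) (\<rho> i))))"

definition admissible_size :: "nat \<Rightarrow> (nat \<Rightarrow> real) \<Rightarrow> nat \<Rightarrow> bool" where
  "admissible_size k b n \<longleftrightarrow> (\<forall>i\<in>{1..k}. b i * real n \<in> \<nat>)"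

text \<open>For admissible \<open>n\<close> the floor is exact.\<close>

definition sample_size :: "(nat \<Rightarrow> real) \<Rightarrow> nat \<Rightarrow> nat \<Rightarrow> nat" where
  "sample_size b n i = nat \<lfloor>b i * real n\<rfloor>"

text \<open>The joint law of the independent draws; \<open>\<omega> (i, l)\<close> is the \<open>l\<close>-th draw from the \<open>i\<close>-th ball.\<close>

definition esbm_sample ::
    "nat \<Rightarrow> (nat \<Rightarrow> (nat \<Rightarrow> real) measure) \<Rightarrow> (nat \<Rightarrow> real) \<Rightarrow> nat \<Rightarrow> (nat \<times> nat \<Rightarrow> nat \<Rightarrow> real) measure" where
  "esbm_sample k \<mu> b n = PiM (SIGMA i:{1..k}. {1..sample_size b n i}) (\<lambda>(i, l). \<mu> i)"

definition drawn_points ::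
    "(nat \<Rightarrow> real) \<Rightarrow> nat \<Rightarrow> (nat \<times> nat \<Rightarrow> nat \<Rightarrow> real) \<Rightarrow> nat \<Rightarrow> (nat \<Rightarrow> real) set" where
  "drawn_points b n \<omega> i = (\<lambda>l. \<omega> (i, l)) ` {1..sample_size b n i}"


definition lp_feasible :: "nat \<Rightarrow> 'a set \<Rightarrow> ('a \<Rightarrow> real) \<Rightarrow> ('a \<Rightarrow> 'a \<Rightarrow> real) \<Rightarrow> bool" where
  "lp_feasible k P y z \<longleftrightarrow>
     (\<forall>q\<in>P. (\<Sum>p\<in>P. z p q) = 1) \<and>
     (\<forall>p\<in>P. \<forall>q\<in>P. z p q \<le> y p) \<and>
     (\<Sum>p\<in>P. y p) = real k \<and>
     (\<forall>p\<in>P. 0 \<le> y p) \<and> (\<forall>p\<in>P. \<forall>q\<in>P. 0 \<le> z p q)"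

definition ip_feasible :: "nat \<Rightarrow> 'a set \<Rightarrow> ('a \<Rightarrow> real) \<Rightarrow> ('a \<Rightarrow> 'a \<Rightarrow> real) \<Rightarrow> bool" where
  "ip_feasible k P y z \<longleftrightarrow>
     lp_feasible k P y z \<and> (\<forall>p\<in>P. y p \<in> {0, 1}) \<and> (\<forall>p\<in>P. \<forall>q\<in>P. z p q \<in> {0, 1})"

definition lp_cost :: "('a \<Rightarrow> 'a \<Rightarrow> real) \<Rightarrow> 'a set \<Rightarrow> ('a \<Rightarrow> 'a \<Rightarrow> real) \<Rightarrow> real" where
  "lp_cost d P z = (\<Sum>p\<in>P. \<Sum>q\<in>P. d p q * z p q)"

definition lp_optimal ::
    "('a \<Rightarrow> 'a \<Rightarrow> real) \<Rightarrow> nat \<Rightarrow> 'a set \<Rightarrow> ('a \<Rightarrow> real) \<Rightarrow> ('a \<Rightarrow> 'a \<Rightarrow> real) \<Rightarrow> bool" where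
  "lp_optimal d k P y z \<longleftrightarrow>
     lp_feasible k P y z \<and> (\<forall>y' z'. lp_feasible k P y' z' \<longrightarrow> lp_cost d P z \<le> lp_cost d P z')"

text \<open>
  \<open>D i\<close> is the set of points drawn from the \<open>i\<close>-th ball. The values of \<open>y\<close> and \<open>z\<close> outside
  \<open>P\<close> are irrelevant, so uniqueness means agreement on \<open>P\<close>.
\<close>

definition exact_recovery :: "('a \<Rightarrow> 'a \<Rightarrow> real) \<Rightarrow> nat \<Rightarrow> (nat \<Rightarrow> 'a set) \<Rightarrow> bool" where
  "exact_recovery d k D \<longleftrightarrow> (let P = (\<Union>i\<in>{1..k}. D i) in
     \<exists>y z. lp_optimal d k P y z \<and>
       (\<forall>y' z'. lp_optimal d k P y' z' \<longrightarrow>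
          (\<forall>p\<in>P. y' p = y p) \<and> (\<forall>p\<in>P. \<forall>q\<in>P. z' p q = z p q)) \<and>
       ip_feasible k P y z \<and>
       (\<forall>i\<in>{1..k}. \<exists>!p. p \<in> D i \<and> y p = 1) \<and>
       (\<forall>p\<in>P. \<forall>q\<in>P. z p q = 1 \<longrightarrow> (\<exists>i\<in>{1..k}. p \<in> D i \<and> q \<in> D i)))"


text \<open>
  The parameter \<open>n\<close> ranges over the values satisfying \<open>adm\<close>. Since \<^const>\<open>measure\<close> is \<open>0\<close> on
  non-measurable sets, the definition also asserts that the events in question are measurable.
\<close>

definition with_high_probability ::
    "(nat \<Rightarrow> bool) \<Rightarrow> (nat \<Rightarrow> 'a measure) \<Rightarrow> (nat \<Rightarrow> 'a \<Rightarrow> bool) \<Rightarrow> bool" where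
  "with_high_probability adm M A \<longleftrightarrow>
     (\<forall>\<delta>::real. 0 < \<delta> \<and> \<delta> < 1 \<longrightarrow>
        (\<exists>N>0. \<forall>n>N. adm n \<longrightarrow> measure (M n) {\<omega> \<in> space (M n). A n \<omega>} > 1 - \<delta>))"

end

theory Submission
  imports Defs
begin

text \<open>
  Give every point of the \<open>i\<close>-th ball the dual value $\alpha_i = (W + M_i) / n_i$, where $M_i$ is
  the cost of the best sampled median of that ball. By complementary slackness exact recovery follows
  as soon as every point \<open>p\<close> collects a contribution $\sum_q (\alpha_q - d(p,q))_+ < W$ unless it is
  one of the medians. If the gap $\epsilon(k,m)$ is at least $(\beta+2)R$, the choice
  $W = 2 \beta R n$ makes foreign points contribute nothing and leaves own points untruncated, so that
  only the almost sure uniqueness of the medians is needed. Otherwise $k/m$ is small; with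
  $W = \beta R n$ a point at distance \<open>s\<close> from its center loses at least $s^2/(16R)$ per sample
  in its own ball, because the projection of a rotation-invariant vector to a fixed direction has mean
  zero and second moment $1/m$ of the squared norm, while Chebyshev-type bounds from the same second
  moment show that foreign balls give back at most $s^2/(32R)$. A uniform law of large numbers
  transfers this to the sample, and in a small neighbourhood of the center all contributions are exact.
\<close>

section \<open>Dual certificates for the k-median relaxation\<close>

text \<open>With W = \<beta> R n and 1 \<le> b_i \<le> \<beta>, the limiting dual value of ball i is
  squeezed between R + e_i and (1 + \<beta>) R, where e_i > 0 is the mean distance to the center.
  The lower end leaves room above every radius, so a point close to its center sees its own ball
  untruncated. The upper end is the threshold in the separation assumption, so such a point sees
  nothing of the other balls. The obstacle is a point further out, at distance s from its center:
  the margin left to ball j is only max(r_i, r_j) + eps - s, and foreign contributions, of order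
  (k/m) / margin, must be paid from the loss s^2/(16 R) in the own ball. Up to s = r/2 the margin is
  of order r, but s may be as small as eps/2; beyond that the margin may drop to eps, but s is of
  order r. The first comparison asks for eps^2 of order k/m, which is the form of the gap. Limits
  cannot decide between draws near the center, hence the exact comparison there. Since high
  probability also asserts measurability, the linear program is moved from the random points to the
  indices of the draws.\<close>

text \<open>The dual multipliers are \<open>a q\<close> for the assignment constraint of
  \<open>q\<close>, \<open>max 0 (a q - d p q)\<close> for \<open>z p q \<le> y p\<close>, and
  \<open>W\<close> for the number of medians. The conditions \<open>own\<close> and
  \<open>own_nonneg\<close> make them tight for the intended clustering; the strict inequalities
  \<open>off\<close> and \<open>less\<close> exclude every other optimum.\<close>

lemma lp_certificate:
  fixes d :: "'a \<Rightarrow> 'a \<Rightarrow> real" and a :: "'a \<Rightarrow> real" and W :: real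
  assumes fin: "\<And>i. i \<in> {1..k} \<Longrightarrow> finite (D i)"
    and disj: "disjoint_family_on D {1..k}"
    and med: "\<And>i. i \<in> {1..k} \<Longrightarrow> med i \<in> D i"
    and own: "\<And>i. i \<in> {1..k} \<Longrightarrow> (\<Sum>q\<in>D i. a q - d (med i) q) = W"
    and own_nonneg: "\<And>i q. i \<in> {1..k} \<Longrightarrow> q \<in> D i \<Longrightarrow> d (med i) q \<le> a q"
    and off: "\<And>i j q. i \<in> {1..k} \<Longrightarrow> j \<in> {1..k} \<Longrightarrow> i \<noteq> j \<Longrightarrow> q \<in> D j \<Longrightarrow> a q < d (med i) q"
    and less: "\<And>i p. i \<in> {1..k} \<Longrightarrow> p \<in> D i \<Longrightarrow> p \<noteq> med i \<Longrightarrow>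
      (\<Sum>j\<in>{1..k}. \<Sum>q\<in>D j. max 0 (a q - d p q)) < W"
  shows "exact_recovery d k D"
proof -
  define K where "K = {1..k}"
  have finK: "finite K" and cardK: "card K = k" unfolding K_def by auto
  note fin = fin[folded K_def] and disj = disj[folded K_def] and med = med[folded K_def]
    and own = own[folded K_def] and own_nonneg = own_nonneg[folded K_def]
    and off = off[folded K_def] and less = less[folded K_def]
  define P where "P = (\<Union>i\<in>K. D i)"
  define F where "F p = (\<Sum>q\<in>P. max 0 (a q - d p q))" for p
  define y0 :: "'a \<Rightarrow> real" where "y0 p = (if p \<in> med ` K then 1 else 0)" for p
  define z0 :: "'a \<Rightarrow> 'a \<Rightarrow> real" where
    "z0 p q = (if \<exists>i\<in>K. p = med i \<and> q \<in> D i then 1 else 0)" for p q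
  have finP: "finite P" unfolding P_def using fin finK by auto
  have uniq: "i = j" if "i \<in> K" "j \<in> K" "q \<in> D i" "q \<in> D j" for i j q
    using disj that unfolding disjoint_family_on_def by blast
  have sumP: "(\<Sum>q\<in>P. f q) = (\<Sum>j\<in>K. \<Sum>q\<in>D j. f q)" for f :: "'a \<Rightarrow> real"
    unfolding P_def using fin finK uniq by (intro sum.UNION_disjoint) auto
  have medP: "med i \<in> P" if "i \<in> K" for i using med[OF that] that unfolding P_def by blast
  have inj: "inj_on med K"
    by (rule inj_onI) (metis uniq med)
  have F_med: "F (med i) = W" if i: "i \<in> K" for i
  proof -
    have "(\<Sum>q\<in>D j. max 0 (a q - d (med i) q)) = (if j = i then W else 0)" if j: "j \<in> K" for j
    proof (cases "j = i")
      case True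
      have "(\<Sum>q\<in>D i. max 0 (a q - d (med i) q)) = (\<Sum>q\<in>D i. a q - d (med i) q)"
        using own_nonneg[OF i] by (intro sum.cong) auto
      then show ?thesis using True own[OF i] by simp
    next
      case False
      then show ?thesis using off[OF i j] by (intro trans[OF sum.neutral]) force+
    qed
    then show ?thesis unfolding F_def sumP using i finK by simp
  qed
  have F_less: "F p < W" if "p \<in> P" "p \<notin> med ` K" for p
    using that less unfolding F_def sumP unfolding P_def by blast
  have F_le: "F p \<le> W" if "p \<in> P" for p
    using F_less[OF that] F_med by fastforce
  have feas0: "lp_feasible k P y0 z0"
  proof -
    have "(\<Sum>p\<in>P. z0 p q) = 1" if qP: "q \<in> P" for q
    proof -
      obtain i where i: "i \<in> K" "q \<in> D i" using qP unfolding P_def by auto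
      have "z0 p q = (if p = med i then 1 else 0)" for p
        unfolding z0_def using i uniq by metis
      then show ?thesis using finP medP[OF i(1)] by simp
    qed
    moreover have "(\<Sum>p\<in>P. y0 p) = real k"
    proof -
      have "P \<inter> med ` K = med ` K" using medP by auto
      then show ?thesis unfolding y0_def using finP inj cardK
        by (simp add: sum.If_cases card_image Collect_mem_eq)
    qed
    ultimately show ?thesis unfolding lp_feasible_def y0_def z0_def by auto
  qed
  \<comment> \<open>The duality gap is a sum of terms that are nonnegative by \<open>t1\<close> and
    \<open>t2\<close>; at an optimum each of them vanishes.\<close>
  have slack: "lp_cost d P z - ((\<Sum>q\<in>P. a q) - real k * W) =
      (\<Sum>p\<in>P. y p * (W - F p)) + (\<Sum>p\<in>P. \<Sum>q\<in>P. y p * max 0 (a q - d p q) - (a q - d p q) * z p q)"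
    if "lp_feasible k P y z" for y z
  proof -
    have 1: "(\<Sum>p\<in>P. z p q) = 1" if "q \<in> P" for q using that \<open>lp_feasible k P y z\<close>
      unfolding lp_feasible_def by auto
    have 2: "(\<Sum>p\<in>P. y p) = real k" using \<open>lp_feasible k P y z\<close> unfolding lp_feasible_def by auto
    have "(\<Sum>p\<in>P. \<Sum>q\<in>P. a q * z p q) = (\<Sum>q\<in>P. a q * (\<Sum>p\<in>P. z p q))"
      by (subst sum.swap) (simp add: sum_distrib_left)
    also have "\<dots> = (\<Sum>q\<in>P. a q)" using 1 by simp
    finally have 3: "(\<Sum>p\<in>P. \<Sum>q\<in>P. a q * z p q) = (\<Sum>q\<in>P. a q)" .
    have 4: "(\<Sum>p\<in>P. y p * W) = real k * W" using 2 by (simp flip: sum_distrib_right)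
    have 5: "(\<Sum>p\<in>P. y p * F p) = (\<Sum>p\<in>P. \<Sum>q\<in>P. y p * max 0 (a q - d p q))"
      by (simp add: F_def sum_distrib_left)
    have 6: "(\<Sum>p\<in>P. \<Sum>q\<in>P. y p * max 0 (a q - d p q) - (a q - d p q) * z p q) =
        (\<Sum>p\<in>P. \<Sum>q\<in>P. y p * max 0 (a q - d p q)) - (\<Sum>p\<in>P. \<Sum>q\<in>P. a q * z p q) + lp_cost d P z"
      unfolding lp_cost_def left_diff_distrib sum_subtractf by simp
    have 7: "(\<Sum>p\<in>P. y p * (W - F p)) = (\<Sum>p\<in>P. y p * W) - (\<Sum>p\<in>P. y p * F p)"
      unfolding right_diff_distrib sum_subtractf by simp
    show ?thesis unfolding 6 7 3 4 5 by simp
  qed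
  have t1: "0 \<le> y p * (W - F p)" if "lp_feasible k P y z" "p \<in> P" for y z p
    using that F_le unfolding lp_feasible_def by (intro mult_nonneg_nonneg) auto
  have t2: "0 \<le> y p * max 0 (a q - d p q) - (a q - d p q) * z p q"
    if f: "lp_feasible k P y z" and pq: "p \<in> P" "q \<in> P" for y z p q
  proof -
    have *: "0 \<le> z p q" "z p q \<le> y p" using f pq unfolding lp_feasible_def by auto
    show ?thesis
    proof (cases "0 \<le> a q - d p q")
      case True
      then show ?thesis using mult_left_mono[OF *(2) True] by (simp add: max_def mult.commute)
    next
      case False
      then show ?thesis using * by (simp add: max_def mult_nonpos_nonneg)
    qed
  qed
  have lower: "(\<Sum>q\<in>P. a q) - real k * W \<le> lp_cost d P z" if "lp_feasible k P y z" for y z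
  proof -
    have "0 \<le> (\<Sum>p\<in>P. y p * (W - F p))" by (intro sum_nonneg t1[OF that])
    moreover have "0 \<le> (\<Sum>p\<in>P. \<Sum>q\<in>P. y p * max 0 (a q - d p q) - (a q - d p q) * z p q)"
      by (intro sum_nonneg t2[OF that])
    ultimately show ?thesis using slack[OF that] by linarith
  qed
  have z0y0: "y0 p * max 0 (a q - d p q) - (a q - d p q) * z0 p q = 0" if pq: "p \<in> P" "q \<in> P" for p q
  proof (cases "p \<in> med ` K")
    case False
    then show ?thesis unfolding y0_def z0_def by auto
  next
    case True
    then obtain i where i: "i \<in> K" "p = med i" by auto
    obtain j where j: "j \<in> K" "q \<in> D j" using pq unfolding P_def by auto
    show ?thesis
    proof (cases "i = j")
      case True
      then have "z0 p q = 1" "y0 p = 1" "d p q \<le> a q" using i j own_nonneg unfolding z0_def y0_def by auto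
      then show ?thesis by simp
    next
      case False
      then have "z0 p q = 0" using i j uniq inj med unfolding z0_def by (metis (full_types))
      moreover have "a q < d p q" using off[OF i(1) j(1) False j(2)] i by simp
      ultimately show ?thesis by simp
    qed
  qed
  have y0F: "y0 p * (W - F p) = 0" for p
    using F_med unfolding y0_def by auto
  have cost0: "lp_cost d P z0 = (\<Sum>q\<in>P. a q) - real k * W"
    using slack[OF feas0] z0y0 y0F by simp
  have opt0: "lp_optimal d k P y0 z0"
    unfolding lp_optimal_def using feas0 lower cost0 by auto
  have uniq_opt: "(\<forall>p\<in>P. y p = y0 p) \<and> (\<forall>p\<in>P. \<forall>q\<in>P. z p q = z0 p q)"
    if opt: "lp_optimal d k P y z" for y z
  proof -
    have f: "lp_feasible k P y z" using opt unfolding lp_optimal_def by auto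
    have c: "lp_cost d P z = (\<Sum>q\<in>P. a q) - real k * W"
      using opt opt0 cost0 unfolding lp_optimal_def by (metis antisym)
    have s2: "0 \<le> (\<Sum>q\<in>P. y p * max 0 (a q - d p q) - (a q - d p q) * z p q)" if "p \<in> P" for p
      using t2[OF f that] by (intro sum_nonneg) auto
    have s: "(\<Sum>p\<in>P. y p * (W - F p)) = 0"
        "(\<Sum>p\<in>P. \<Sum>q\<in>P. y p * max 0 (a q - d p q) - (a q - d p q) * z p q) = 0"
      using slack[OF f] c sum_nonneg[of P "\<lambda>p. y p * (W - F p)", OF t1[OF f]]
        sum_nonneg[of P "\<lambda>p. \<Sum>q\<in>P. y p * max 0 (a q - d p q) - (a q - d p q) * z p q", OF s2]
      by linarith+
    have e1: "y p * (W - F p) = 0" if "p \<in> P" for p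
      using s(1) sum_nonneg_eq_0_iff[OF finP, of "\<lambda>p. y p * (W - F p)"] t1[OF f] that by blast
    have e2: "y p * max 0 (a q - d p q) - (a q - d p q) * z p q = 0" if "p \<in> P" "q \<in> P" for p q
    proof -
      have "(\<Sum>q\<in>P. y p * max 0 (a q - d p q) - (a q - d p q) * z p q) = 0"
        using s(2) sum_nonneg_eq_0_iff[OF finP, of "\<lambda>p. \<Sum>q\<in>P. y p * max 0 (a q - d p q) - (a q - d p q) * z p q"] s2 that by blast
      then show ?thesis using sum_nonneg_eq_0_iff[OF finP, of "\<lambda>q. y p * max 0 (a q - d p q) - (a q - d p q) * z p q"] t2[OF f] that by blast
    qed
    have feas: "\<And>q. q \<in> P \<Longrightarrow> (\<Sum>p\<in>P. z p q) = 1" "\<And>p q. p \<in> P \<Longrightarrow> q \<in> P \<Longrightarrow> z p q \<le> y p"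
        "(\<Sum>p\<in>P. y p) = real k" "\<And>p q. p \<in> P \<Longrightarrow> q \<in> P \<Longrightarrow> 0 \<le> z p q"
      using f unfolding lp_feasible_def by auto
    have ynot: "y p = 0" if "p \<in> P" "p \<notin> med ` K" for p
      using e1[OF that(1)] F_less[OF that] by simp
    have znot: "z p q = 0" if pq: "p \<in> P" "q \<in> P" "z0 p q = 0" for p q
    proof (cases "p \<in> med ` K")
      case False
      then show ?thesis using ynot[OF that(1)] feas(2,4)[OF that(1,2)] by simp
    next
      case True
      then obtain i where i: "i \<in> K" "p = med i" by auto
      obtain j where j: "j \<in> K" "q \<in> D j" using pq unfolding P_def by auto
      have "i \<noteq> j" using pq i j unfolding z0_def by (auto split: if_splits)
      then have "a q < d p q" using off i j by blast
      then show ?thesis using e2[OF that(1,2)] by simp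
    qed
    have zis: "z p q = z0 p q" if "p \<in> P" "q \<in> P" for p q
    proof (cases "z0 p q = 0")
      case True
      then show ?thesis using znot that by simp
    next
      case False
      then obtain i where i: "i \<in> K" "p = med i" "q \<in> D i" unfolding z0_def by (auto split: if_splits)
      have "z p' q = 0" if "p' \<in> P - {p}" for p'
        using znot[of p' q] that \<open>q \<in> P\<close> i uniq unfolding z0_def by (metis DiffE insertI1)
      then have "(\<Sum>p'\<in>P. z p' q) = z p q"
        using finP \<open>p \<in> P\<close> by (simp add: sum.remove)
      then show ?thesis using feas(1)[OF that(2)] False unfolding z0_def by (auto split: if_splits)
    qed
    \<comment> \<open>A median serves itself, so its \<open>y\<close> is at least 1; the total
      \<open>k\<close> then leaves no excess.\<close>
    have y1: "1 \<le> y (med i)" if "i \<in> K" for i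
    proof -
      have "z (med i) (med i) = 1" using zis[OF medP medP, OF that that] that med unfolding z0_def by auto
      then show ?thesis using feas(2)[OF medP medP, OF that that] by simp
    qed
    have "(\<Sum>p\<in>P. y p) = (\<Sum>p\<in>med ` K. y p)"
      using finP medP ynot by (intro sum.mono_neutral_right) auto
    then have "(\<Sum>i\<in>K. y (med i) - 1) = 0"
      using feas(3) cardK by (simp add: sum.reindex[OF inj] sum_subtractf comp_def)
    then have "\<forall>i\<in>K. y (med i) - 1 = 0"
      using sum_nonneg_eq_0_iff[OF finK, of "\<lambda>i. y (med i) - 1"] y1 by simp
    then have "y p = y0 p" if "p \<in> P" for p
      using ynot[OF that] unfolding y0_def by auto
    then show ?thesis using zis by blast
  qed
  have "ip_feasible k P y0 z0"
    unfolding ip_feasible_def using feas0 by (auto simp: y0_def z0_def)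
  moreover have "\<exists>!p. p \<in> D i \<and> y0 p = 1" if "i \<in> K" for i
    using that med uniq unfolding y0_def by (intro ex1I[of _ "med i"]) (auto split: if_splits)
  moreover have "\<forall>p\<in>P. \<forall>q\<in>P. z0 p q = 1 \<longrightarrow> (\<exists>i\<in>K. p \<in> D i \<and> q \<in> D i)"
    using med unfolding z0_def by auto
  ultimately show ?thesis
    unfolding exact_recovery_def Let_def K_def[symmetric] P_def[symmetric] using opt0 uniq_opt by blast
qed

section \<open>Measurability of exact recovery\<close>

lemma lp_feasible_reindex:
  assumes "inj_on f P"
  shows "lp_feasible k (f ` P) y z \<longleftrightarrow> lp_feasible k P (\<lambda>a. y (f a)) (\<lambda>a b. z (f a) (f b))"
  unfolding lp_feasible_def using assms by (simp add: sum.reindex comp_def)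

lemma lp_feasible_cong:
  assumes "\<And>p. p \<in> P \<Longrightarrow> y p = y' p" "\<And>p q. p \<in> P \<Longrightarrow> q \<in> P \<Longrightarrow> z p q = z' p q"
  shows "lp_feasible k P y z \<longleftrightarrow> lp_feasible k P y' z'"
  unfolding lp_feasible_def using assms by (simp cong: sum.cong)

lemma lp_cost_reindex:
  assumes "inj_on f P" "\<And>a b. a \<in> P \<Longrightarrow> b \<in> P \<Longrightarrow> d' a b = d (f a) (f b)"
  shows "lp_cost d (f ` P) z = lp_cost d' P (\<lambda>a b. z (f a) (f b))"
  unfolding lp_cost_def using assms by (simp add: sum.reindex comp_def)

lemma lp_cost_cong:
  assumes "\<And>p q. p \<in> P \<Longrightarrow> q \<in> P \<Longrightarrow> z p q = z' p q"
  shows "lp_cost d P z = lp_cost d P z'"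
  unfolding lp_cost_def using assms by simp

text \<open>Solutions on the image are composed with \<open>f\<close>, solutions on the index set
  with its inverse \<open>g\<close>; feasibility and cost agree. This replaces the random point set
  by a set of indices that does not depend on the sample.\<close>

lemma exact_recovery_reindex:
  assumes inj: "inj_on f (\<Union>i\<in>{1..k}. A i)"
    and d: "\<And>a b. a \<in> (\<Union>i\<in>{1..k}. A i) \<Longrightarrow> b \<in> (\<Union>i\<in>{1..k}. A i) \<Longrightarrow> d' a b = d (f a) (f b)"
    and rec: "exact_recovery d k (\<lambda>i. f ` A i)"
  shows "exact_recovery d' k A"
proof -
  define P where "P = (\<Union>i\<in>{1..k}. A i)"
  note inj = inj[folded P_def] and d = d[folded P_def]
  have fP: "(\<Union>i\<in>{1..k}. f ` A i) = f ` P" unfolding P_def by auto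
  define g where "g = the_inv_into P f"
  have g: "g (f a) = a" if "a \<in> P" for a unfolding g_def using inj that by (rule the_inv_into_f_f)
  obtain y z where opt: "lp_optimal d k (f ` P) y z"
    and uni: "\<forall>y' z'. lp_optimal d k (f ` P) y' z' \<longrightarrow>
          (\<forall>p\<in>f ` P. y' p = y p) \<and> (\<forall>p\<in>f ` P. \<forall>q\<in>f ` P. z' p q = z p q)"
    and ip: "ip_feasible k (f ` P) y z"
    and one: "\<forall>i\<in>{1..k}. \<exists>!p. p \<in> f ` A i \<and> y p = 1"
    and cl: "\<forall>p\<in>f ` P. \<forall>q\<in>f ` P. z p q = 1 \<longrightarrow> (\<exists>i\<in>{1..k}. p \<in> f ` A i \<and> q \<in> f ` A i)"
    using rec[unfolded exact_recovery_def Let_def fP] by (elim exE conjE) (rule that)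
  note uni = uni[rule_format] and one = one[rule_format] and cl = cl[rule_format]
  define y0 where "y0 = (\<lambda>a. y (f a))"
  define z0 where "z0 = (\<lambda>a b. z (f a) (f b))"
  have lift: "lp_feasible k (f ` P) (\<lambda>p. y' (g p)) (\<lambda>p q. z' (g p) (g q)) \<longleftrightarrow> lp_feasible k P y' z'" for y' z'
    unfolding lp_feasible_reindex[OF inj] by (rule lp_feasible_cong) (simp_all add: g)
  have liftc: "lp_cost d (f ` P) (\<lambda>p q. z' (g p) (g q)) = lp_cost d' P z'" for z'
    by (subst lp_cost_reindex[where d' = d', OF inj d], assumption+, rule lp_cost_cong) (simp_all add: g)
  have cost0: "lp_cost d (f ` P) z = lp_cost d' P z0"
    unfolding z0_def by (rule lp_cost_reindex[where d = d and d' = d', OF inj d])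
  have opt0: "lp_optimal d' k P y0 z0"
    unfolding lp_optimal_def
  proof (intro conjI allI impI)
    show "lp_feasible k P y0 z0"
      using opt unfolding lp_optimal_def y0_def z0_def lp_feasible_reindex[OF inj] by blast
    fix y' z' assume "lp_feasible k P y' z'"
    then show "lp_cost d' P z0 \<le> lp_cost d' P z'"
      using opt lift liftc cost0 unfolding lp_optimal_def by metis
  qed
  have uni0: "(\<forall>p\<in>P. y' p = y0 p) \<and> (\<forall>p\<in>P. \<forall>q\<in>P. z' p q = z0 p q)"
    if o: "lp_optimal d' k P y' z'" for y' z'
  proof -
    have "lp_cost d (f ` P) z = lp_cost d' P z'"
      using o opt0 cost0 unfolding lp_optimal_def by (metis order_antisym)
    then have "lp_optimal d k (f ` P) (\<lambda>p. y' (g p)) (\<lambda>p q. z' (g p) (g q))"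
      using o opt lift liftc unfolding lp_optimal_def by metis
    from uni[OF this] show ?thesis unfolding y0_def z0_def by (auto simp: g)
  qed
  have "ip_feasible k P y0 z0"
    using ip unfolding ip_feasible_def lp_feasible_reindex[OF inj] y0_def z0_def by auto
  moreover have "\<exists>!p. p \<in> A i \<and> y0 p = 1" if i: "i \<in> {1..k}" for i
  proof -
    have AP: "A i \<subseteq> P" using i unfolding P_def by blast
    obtain p where p: "p \<in> f ` A i" "y p = 1" and u: "\<And>q. q \<in> f ` A i \<Longrightarrow> y q = 1 \<Longrightarrow> q = p"
      using one[OF i] by blast
    from p obtain a where a: "a \<in> A i" "p = f a" by blast
    show ?thesis
    proof (rule ex1I[of _ a])
      show "a \<in> A i \<and> y0 a = 1" using a p unfolding y0_def by auto
      fix b assume "b \<in> A i \<and> y0 b = 1"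
      then show "b = a" using u[of "f b"] a AP inj_onD[OF inj, of b a] unfolding y0_def by blast
    qed
  qed
  moreover have "\<exists>i\<in>{1..k}. p \<in> A i \<and> q \<in> A i"
    if pq: "p \<in> P" "q \<in> P" "z0 p q = 1" for p q
  proof -
    obtain i where i: "i \<in> {1..k}" "f p \<in> f ` A i" "f q \<in> f ` A i"
      using cl[of "f p" "f q"] pq unfolding z0_def by blast
    moreover have "A i \<subseteq> P" using i unfolding P_def by blast
    ultimately show ?thesis using inj_on_image_mem_iff[OF inj] pq by blast
  qed
  ultimately show ?thesis
    unfolding exact_recovery_def Let_def P_def[symmetric] using opt0 uni0 by blast
qed

text \<open>Distances are read only inside the point set, which is seen by reindexing along the
  identity.\<close>

lemma exact_recovery_cong:
  assumes A: "\<And>i. i \<in> {1..k} \<Longrightarrow> A i = B i"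
    and d: "\<And>p q. p \<in> (\<Union>i\<in>{1..k}. A i) \<Longrightarrow> q \<in> (\<Union>i\<in>{1..k}. A i) \<Longrightarrow> d p q = d' p q"
  shows "exact_recovery d k A \<longleftrightarrow> exact_recovery d' k B"
proof -
  define K where "K = {1..k}"
  have "exact_recovery d k A \<longleftrightarrow> exact_recovery d' k A"
  proof
    assume "exact_recovery d k A"
    then have "exact_recovery d k (\<lambda>i. (\<lambda>x. x) ` A i)" by simp
    then show "exact_recovery d' k A"
      by (rule exact_recovery_reindex[rotated 2]) (use d in \<open>auto simp only: inj_on_id2\<close>)
  next
    assume "exact_recovery d' k A"
    then have "exact_recovery d' k (\<lambda>i. (\<lambda>x. x) ` A i)" by simp
    then show "exact_recovery d k A"
      by (rule exact_recovery_reindex[rotated 2]) (use d in \<open>auto simp only: inj_on_id2\<close>)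
  qed
  also have "\<dots> \<longleftrightarrow> exact_recovery d' k B"
    unfolding exact_recovery_def Let_def K_def[symmetric] using A[folded K_def] by (simp cong: SUP_cong)
  finally show ?thesis .
qed

text \<open>The converse of \<open>exact_recovery_reindex\<close> is the same transfer along the
  inverse of \<open>f\<close>.\<close>

lemma exact_recovery_image_iff:
  assumes inj: "inj_on f (\<Union>i\<in>{1..k}. A i)"
  shows "exact_recovery d k (\<lambda>i. f ` A i) \<longleftrightarrow> exact_recovery (\<lambda>a b. d (f a) (f b)) k A"
proof
  assume "exact_recovery d k (\<lambda>i. f ` A i)"
  then show "exact_recovery (\<lambda>a b. d (f a) (f b)) k A"
    by (rule exact_recovery_reindex[OF inj, rotated]) simp
next
  define P where "P = (\<Union>i\<in>{1..k}. A i)"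
  define g where "g = the_inv_into P f"
  have g: "g (f a) = a" if "a \<in> P" for a
    unfolding g_def using inj that unfolding P_def by (rule the_inv_into_f_f)
  have fP: "(\<Union>i\<in>{1..k}. f ` A i) = f ` P" unfolding P_def by auto
  have gA: "g ` f ` A i = A i" if "i \<in> {1..k}" for i
  proof -
    have "A i \<subseteq> P" using that unfolding P_def by blast
    then show ?thesis using g by force
  qed
  have gi: "inj_on g (\<Union>i\<in>{1..k}. f ` A i)" unfolding fP by (rule inj_on_inverseI[of _ f]) (auto simp: g)
  assume "exact_recovery (\<lambda>a b. d (f a) (f b)) k A"
  then have "exact_recovery (\<lambda>a b. d (f a) (f b)) k (\<lambda>i. g ` f ` A i)"
    using exact_recovery_cong[where A = "\<lambda>i. g ` f ` A i" and B = A and k = k, OF gA] by blast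
  then show "exact_recovery d k (\<lambda>i. f ` A i)"
    by (rule exact_recovery_reindex[OF gi, rotated]) (auto simp only: fP g image_iff)
qed

section \<open>Borel sets of distance functions\<close>

text \<open>Tychonoff's theorem in the function type itself, used for a box that contains the
  candidate solutions.\<close>

lemma compact_PiE_UNIV:
  fixes S :: "'a \<Rightarrow> 'b::topological_space set"
  assumes "\<And>a. compact (S a)"
  shows "compact {f. \<forall>a. f a \<in> S a}"
proof -
  have "compactin (product_topology (\<lambda>_. euclidean) UNIV) (PiE UNIV S)"
    using assms by (simp add: compactin_PiE)
  then show ?thesis
    by (simp add: euclidean_product_topology PiE_UNIV_domain Pi_def)
qed

text \<open>By compactness of the feasible region a unique optimum is separated from the rest of
  that region by a gap, which turns the quantifier over feasible solutions into countably many
  closed conditions on the distances.\<close>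

lemma borel_unique_optimum:
  fixes P :: "'a set"
  assumes finP: "finite P"
  shows "{D :: 'a \<times> 'a \<Rightarrow> real. \<forall>y z. lp_feasible k P y z \<longrightarrow>
      (\<forall>p\<in>P. y p = y0 p) \<and> (\<forall>p\<in>P. \<forall>q\<in>P. z p q = z0 p q) \<or>
      lp_cost (\<lambda>p q. D (p, q)) P z0 < lp_cost (\<lambda>p q. D (p, q)) P z} \<in> sets borel" (is "?E \<in> _")
proof -
  define c where "c D z = lp_cost (\<lambda>p q. D (p, q)) P z" for D :: "'a \<times> 'a \<Rightarrow> real" and z
  \<comment> \<open>\<open>g\<close> is the l1 distance on \<open>P\<close> to the candidate
    solution. \<open>X\<close> is a box that pins the values outside \<open>P\<close> to 0, without
    which it would not be compact. \<open>K j\<close> is the part of the feasible region in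
    \<open>X\<close> at distance at least 1/(j+1) from the candidate.\<close>
  define g :: "('a \<Rightarrow> real) \<times> ('a \<Rightarrow> 'a \<Rightarrow> real) \<Rightarrow> real" where
    "g w = (\<Sum>p\<in>P. \<bar>fst w p - y0 p\<bar>) + (\<Sum>p\<in>P. \<Sum>q\<in>P. \<bar>snd w p q - z0 p q\<bar>)" for w
  define X :: "(('a \<Rightarrow> real) \<times> ('a \<Rightarrow> 'a \<Rightarrow> real)) set" where
    "X = {y. \<forall>p. y p \<in> (if p \<in> P then {0..real k} else {0})} \<times>
      {z. \<forall>p. z p \<in> {v. \<forall>q. v q \<in> (if p \<in> P \<and> q \<in> P then {0..1} else {0})}}"
  define K where "K j = {w \<in> X. lp_feasible k P (fst w) (snd w) \<and> inverse (real (Suc j)) \<le> g w}" for j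
  have coord: "continuous_on S (\<lambda>w. fst w p)" "continuous_on S (\<lambda>w. snd w p q)"
    for S :: "(('a \<Rightarrow> real) \<times> ('a \<Rightarrow> 'a \<Rightarrow> real)) set" and p q
  proof -
    show "continuous_on S (\<lambda>w. fst w p)"
      by (rule continuous_on_product_then_coordinatewise) (intro continuous_intros)
    have "continuous_on S (\<lambda>w. snd w p)"
      by (rule continuous_on_product_then_coordinatewise) (intro continuous_intros)
    then show "continuous_on S (\<lambda>w. snd w p q)"
      by (rule continuous_on_product_then_coordinatewise)
  qed
  have compX: "compact X"
    unfolding X_def by (intro compact_Times compact_PiE_UNIV) auto
  have closedK: "closed {w. lp_feasible k P (fst w) (snd w) \<and> inverse (real (Suc j)) \<le> g w}" for j
  proof -
    have cg: "continuous_on UNIV g"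
      unfolding g_def
      by (intro continuous_on_add continuous_on_sum continuous_on_rabs continuous_on_diff
          continuous_on_const coord)
    have "{w. lp_feasible k P (fst w) (snd w) \<and> inverse (real (Suc j)) \<le> g w} =
      (\<Inter>q\<in>P. {w. (\<Sum>p\<in>P. snd w p q) = 1}) \<inter> (\<Inter>p\<in>P. \<Inter>q\<in>P. {w. snd w p q \<le> fst w p}) \<inter>
      {w. (\<Sum>p\<in>P. fst w p) = real k} \<inter> (\<Inter>p\<in>P. {w. 0 \<le> fst w p}) \<inter>
      (\<Inter>p\<in>P. \<Inter>q\<in>P. {w. 0 \<le> snd w p q}) \<inter> {w. inverse (real (Suc j)) \<le> g w}"
      unfolding lp_feasible_def by auto
    moreover have "closed (\<Inter>q\<in>P. {w :: ('a \<Rightarrow> real) \<times> ('a \<Rightarrow> 'a \<Rightarrow> real). (\<Sum>p\<in>P. snd w p q) = 1})"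
      by (intro closed_INT ballI closed_Collect_eq continuous_on_sum continuous_on_const coord)
    moreover have "closed (\<Inter>p\<in>P. \<Inter>q\<in>P. {w :: ('a \<Rightarrow> real) \<times> ('a \<Rightarrow> 'a \<Rightarrow> real). snd w p q \<le> fst w p})"
      by (intro closed_INT ballI closed_Collect_le coord)
    moreover have "closed {w :: ('a \<Rightarrow> real) \<times> ('a \<Rightarrow> 'a \<Rightarrow> real). (\<Sum>p\<in>P. fst w p) = real k}"
      by (intro closed_Collect_eq continuous_on_sum continuous_on_const coord)
    moreover have "closed (\<Inter>p\<in>P. {w :: ('a \<Rightarrow> real) \<times> ('a \<Rightarrow> 'a \<Rightarrow> real). 0 \<le> fst w p})"
      by (intro closed_INT ballI closed_Collect_le continuous_on_const coord)
    moreover have "closed (\<Inter>p\<in>P. \<Inter>q\<in>P. {w :: ('a \<Rightarrow> real) \<times> ('a \<Rightarrow> 'a \<Rightarrow> real). 0 \<le> snd w p q})"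
      by (intro closed_INT ballI closed_Collect_le continuous_on_const coord)
    moreover have "closed {w. inverse (real (Suc j)) \<le> g w}"
      by (intro closed_Collect_le continuous_on_const cg)
    ultimately show ?thesis by (simp only: closed_Int)
  qed
  have compK: "compact (K j)" for j
    using compact_Int_closed[OF compX closedK[of j]] unfolding K_def by (simp add: Int_def)
  have g_nonneg: "0 \<le> g w" for w unfolding g_def by (intro add_nonneg_nonneg sum_nonneg) auto
  have g0: "g (y, z) = 0 \<longleftrightarrow> (\<forall>p\<in>P. y p = y0 p) \<and> (\<forall>p\<in>P. \<forall>q\<in>P. z p q = z0 p q)" for y z
  proof -
    have "g (y, z) = 0 \<longleftrightarrow> (\<Sum>p\<in>P. \<bar>y p - y0 p\<bar>) = 0 \<and> (\<Sum>p\<in>P. \<Sum>q\<in>P. \<bar>z p q - z0 p q\<bar>) = 0"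
      unfolding g_def by (simp add: add_nonneg_eq_0_iff sum_nonneg)
    then show ?thesis using finP by (simp add: sum_nonneg_eq_0_iff sum_nonneg)
  qed
  have "?E = (\<Inter>j. \<Union>l. {D. \<forall>w\<in>K j. c D z0 + inverse (real (Suc l)) \<le> c D (snd w)})"
  proof (rule equalityI; rule subsetI)
    fix D assume D: "D \<in> ?E"
    have "\<exists>l. \<forall>w\<in>K j. c D z0 + inverse (real (Suc l)) \<le> c D (snd w)" for j
    proof (cases "K j = {}")
      case False
      have "continuous_on (K j) (\<lambda>w. c D (snd w))"
        unfolding c_def lp_cost_def by (intro continuous_intros coord)
      then obtain w where w: "w \<in> K j" "\<And>w'. w' \<in> K j \<Longrightarrow> c D (snd w) \<le> c D (snd w')"
        using continuous_attains_inf[OF compK False] by blast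
      have "inverse (real (Suc j)) \<le> g w" "0 < inverse (real (Suc j))" using w(1) unfolding K_def by simp_all
      then have "g w \<noteq> 0" by linarith
      then have "c D z0 < c D (snd w)"
        using D w(1) g0[of "fst w" "snd w"] unfolding K_def c_def by fastforce
      then obtain l where "inverse (real (Suc l)) < c D (snd w) - c D z0"
        using reals_Archimedean[of "c D (snd w) - c D z0"] by auto
      then have "c D z0 + inverse (real (Suc l)) \<le> c D (snd w')" if "w' \<in> K j" for w'
        using w(2)[OF that] by linarith
      then have "\<forall>w\<in>K j. c D z0 + inverse (real (Suc l)) \<le> c D (snd w)" by blast
      then show ?thesis ..
    next
      case True
      then show ?thesis by simp
    qed
    then show "D \<in> (\<Inter>j. \<Union>l. {D. \<forall>w\<in>K j. c D z0 + inverse (real (Suc l)) \<le> c D (snd w)})" by auto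
  next
    fix D assume D: "D \<in> (\<Inter>j. \<Union>l. {D. \<forall>w\<in>K j. c D z0 + inverse (real (Suc l)) \<le> c D (snd w)})"
    show "D \<in> ?E"
    proof (intro CollectI allI impI)
      fix y z assume f: "lp_feasible k P y z"
      \<comment> \<open>Resetting the values outside \<open>P\<close> changes neither feasibility
        nor cost nor \<open>g\<close>, and puts the solution into \<open>X\<close>.\<close>
      define y' where "y' p = (if p \<in> P then y p else 0)" for p
      define z' where "z' p q = (if p \<in> P \<and> q \<in> P then z p q else 0)" for p q
      have f': "lp_feasible k P y' z'"
        using f lp_feasible_cong[of P y y' z z' k] unfolding y'_def z'_def by simp
      have bz: "z p q \<le> 1" if pq: "p \<in> P" "q \<in> P" for p q
      proof -
        have "z p q \<le> (\<Sum>p\<in>P. z p q)"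
          using f pq finP unfolding lp_feasible_def by (intro member_le_sum) simp_all
        then show ?thesis using f pq unfolding lp_feasible_def by simp
      qed
      have bly: "y p \<le> real k" if p: "p \<in> P" for p
      proof -
        have "y p \<le> (\<Sum>p\<in>P. y p)"
          using f p finP unfolding lp_feasible_def by (intro member_le_sum) simp_all
        then show ?thesis using f unfolding lp_feasible_def by simp
      qed
      have inX: "(y', z') \<in> X"
        using bz bly f unfolding X_def y'_def z'_def lp_feasible_def by simp
      have gg: "g (y', z') = g (y, z)" unfolding g_def y'_def z'_def by simp
      have cc: "c D z' = c D z" unfolding c_def by (rule lp_cost_cong) (simp add: z'_def)
      show "(\<forall>p\<in>P. y p = y0 p) \<and> (\<forall>p\<in>P. \<forall>q\<in>P. z p q = z0 p q) \<or>
        lp_cost (\<lambda>p q. D (p, q)) P z0 < lp_cost (\<lambda>p q. D (p, q)) P z"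
      proof (cases "g (y, z) = 0")
        case True
        then show ?thesis using g0 by blast
      next
        case False
        then have "0 < g (y', z')" using g_nonneg[of "(y, z)"] gg by simp
        then obtain j where "inverse (real (Suc j)) < g (y', z')"
          using reals_Archimedean by blast
        then have "(y', z') \<in> K j" unfolding K_def using inX f' by simp
        moreover obtain l where "\<forall>w\<in>K j. c D z0 + inverse (real (Suc l)) \<le> c D (snd w)"
          using D by blast
        ultimately have "c D z0 + inverse (real (Suc l)) \<le> c D z" using cc by fastforce
        moreover have "0 < inverse (real (Suc l))" by simp
        ultimately show ?thesis unfolding c_def by linarith
      qed
    qed
  qed
  moreover have "closed {D. \<forall>w\<in>K j. c D z0 + inverse (real (Suc l)) \<le> c D (snd w)}" for j l
  proof -
    have "{D. \<forall>w\<in>K j. c D z0 + inverse (real (Suc l)) \<le> c D (snd w)} =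
        (\<Inter>w\<in>K j. {D. c D z0 + inverse (real (Suc l)) \<le> c D (snd w)})" by auto
    also have "closed \<dots>"
      unfolding c_def lp_cost_def
      by (intro closed_INT ballI closed_Collect_le continuous_on_add continuous_on_sum
          continuous_on_mult continuous_on_const continuous_on_product_coordinates)
    finally show ?thesis .
  qed
  ultimately show ?thesis
    by (simp only:, intro sets.countable_INT'' sets.countable_UN image_subsetI borel_closed, simp_all)
qed

text \<open>The recovered solution is 0/1 valued, so there are finitely many candidates once their
  values outside \<open>P\<close> are fixed by extensionality. The event is the finite union of the
  corresponding sets from \<open>borel_unique_optimum\<close>.\<close>

lemma borel_exact_recovery:
  fixes A :: "nat \<Rightarrow> 'a set"
  assumes fin: "\<And>i. i \<in> {1..k} \<Longrightarrow> finite (A i)"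
  shows "{D :: 'a \<times> 'a \<Rightarrow> real. exact_recovery (\<lambda>p q. D (p, q)) k A} \<in> sets borel"
proof -
  define P where "P = (\<Union>i\<in>{1..k}. A i)"
  have finP: "finite P" unfolding P_def using fin by auto
  define F where "F = {w \<in> (P \<rightarrow>\<^sub>E {0, 1::real}) \<times> (P \<rightarrow>\<^sub>E (P \<rightarrow>\<^sub>E {0, 1::real})).
    ip_feasible k P (fst w) (snd w) \<and> (\<forall>i\<in>{1..k}. \<exists>!p. p \<in> A i \<and> fst w p = 1) \<and>
    (\<forall>p\<in>P. \<forall>q\<in>P. snd w p q = 1 \<longrightarrow> (\<exists>i\<in>{1..k}. p \<in> A i \<and> q \<in> A i))}"
  define E where "E w = {D :: 'a \<times> 'a \<Rightarrow> real. \<forall>y z. lp_feasible k P y z \<longrightarrow>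
      (\<forall>p\<in>P. y p = fst w p) \<and> (\<forall>p\<in>P. \<forall>q\<in>P. z p q = snd w p q) \<or>
      lp_cost (\<lambda>p q. D (p, q)) P (snd w) < lp_cost (\<lambda>p q. D (p, q)) P z}" for w
  have finF: "finite F"
  proof -
    have "finite ((P \<rightarrow>\<^sub>E {0, 1::real}) \<times> (P \<rightarrow>\<^sub>E (P \<rightarrow>\<^sub>E {0, 1::real})))"
      by (intro finite_cartesian_product finite_PiE finP finite.intros)
    then show ?thesis unfolding F_def by (rule rev_finite_subset) blast
  qed
  have "exact_recovery (\<lambda>p q. D (p, q)) k A \<longleftrightarrow> (\<exists>w\<in>F. D \<in> E w)" for D :: "'a \<times> 'a \<Rightarrow> real"
  proof
    assume "exact_recovery (\<lambda>p q. D (p, q)) k A"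
    from this[unfolded exact_recovery_def Let_def P_def[symmetric]]
    obtain y z where opt: "lp_optimal (\<lambda>p q. D (p, q)) k P y z"
      and uni: "\<forall>y' z'. lp_optimal (\<lambda>p q. D (p, q)) k P y' z' \<longrightarrow>
          (\<forall>p\<in>P. y' p = y p) \<and> (\<forall>p\<in>P. \<forall>q\<in>P. z' p q = z p q)"
      and ip: "ip_feasible k P y z"
      and one: "\<forall>i\<in>{1..k}. \<exists>!p. p \<in> A i \<and> y p = 1"
      and cl: "\<forall>p\<in>P. \<forall>q\<in>P. z p q = 1 \<longrightarrow> (\<exists>i\<in>{1..k}. p \<in> A i \<and> q \<in> A i)"
      by (elim exE conjE) (rule that)
    define y' where "y' = restrict y P"
    define z' where "z' = restrict (\<lambda>p. restrict (z p) P) P"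
    have eq: "\<And>p. p \<in> P \<Longrightarrow> y' p = y p" "\<And>p q. p \<in> P \<Longrightarrow> q \<in> P \<Longrightarrow> z' p q = z p q"
      unfolding y'_def z'_def by auto
    have AP: "A i \<subseteq> P" if "i \<in> {1..k}" for i using that unfolding P_def by blast
    have feas: "lp_feasible k P y' z' \<longleftrightarrow> lp_feasible k P y z"
      by (rule lp_feasible_cong) (simp_all add: eq)
    have "ip_feasible k P y' z'"
      using ip eq unfolding ip_feasible_def feas by simp
    moreover have "\<forall>i\<in>{1..k}. \<exists>!p. p \<in> A i \<and> y' p = 1"
    proof
      fix i assume i: "i \<in> {1..k}"
      have "p \<in> A i \<and> y' p = 1 \<longleftrightarrow> p \<in> A i \<and> y p = 1" for p
        using AP[OF i] eq(1)[of p] by (cases "p \<in> A i") auto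
      then show "\<exists>!p. p \<in> A i \<and> y' p = 1" using bspec[OF one i] by simp
    qed
    moreover have "(y', z') \<in> (P \<rightarrow>\<^sub>E {0, 1::real}) \<times> (P \<rightarrow>\<^sub>E (P \<rightarrow>\<^sub>E {0, 1::real}))"
      using ip unfolding ip_feasible_def y'_def z'_def by (auto simp: PiE_def)
    ultimately have "(y', z') \<in> F"
      using cl eq unfolding F_def mem_Collect_eq fst_conv snd_conv by metis
    moreover have "D \<in> E (y', z')"
    proof -
      have c: "lp_cost d P z' = lp_cost d P z" for d by (rule lp_cost_cong) (simp add: eq)
      have "(\<forall>p\<in>P. u p = y p) \<and> (\<forall>p\<in>P. \<forall>q\<in>P. v p q = z p q) \<or>
        lp_cost (\<lambda>p q. D (p, q)) P z < lp_cost (\<lambda>p q. D (p, q)) P v" if f: "lp_feasible k P u v" for u v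
      proof (cases "lp_cost (\<lambda>p q. D (p, q)) P z < lp_cost (\<lambda>p q. D (p, q)) P v")
        case False
        then have "lp_cost (\<lambda>p q. D (p, q)) P v = lp_cost (\<lambda>p q. D (p, q)) P z"
          using opt f unfolding lp_optimal_def by (meson linorder_neqE not_less order_antisym)
        then have "lp_optimal (\<lambda>p q. D (p, q)) k P u v"
          using opt f unfolding lp_optimal_def by simp
        then show ?thesis using uni by blast
      qed simp
      then show ?thesis unfolding E_def by (simp add: eq c)
    qed
    ultimately show "\<exists>w\<in>F. D \<in> E w" by blast
  next
    assume "\<exists>w\<in>F. D \<in> E w"
    then obtain w where "w \<in> F" "D \<in> E w" by blast
    then obtain y z where F: "(y, z) \<in> F" and E: "D \<in> E (y, z)" by (cases w) blast
    have E': "(\<forall>p\<in>P. u p = y p) \<and> (\<forall>p\<in>P. \<forall>q\<in>P. v p q = z p q) \<or>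
        lp_cost (\<lambda>p q. D (p, q)) P z < lp_cost (\<lambda>p q. D (p, q)) P v" if "lp_feasible k P u v" for u v
      using E that unfolding E_def by simp
    have ip: "ip_feasible k P y z" and one: "\<forall>i\<in>{1..k}. \<exists>!p. p \<in> A i \<and> y p = 1"
      and cl: "\<forall>p\<in>P. \<forall>q\<in>P. z p q = 1 \<longrightarrow> (\<exists>i\<in>{1..k}. p \<in> A i \<and> q \<in> A i)"
      using F unfolding F_def mem_Collect_eq fst_conv snd_conv by blast+
    have f: "lp_feasible k P y z" using ip unfolding ip_feasible_def by blast
    have opt: "lp_optimal (\<lambda>p q. D (p, q)) k P y z"
      unfolding lp_optimal_def
    proof (intro conjI allI impI f)
      fix u v assume "lp_feasible k P u v"
      from E'[OF this] show "lp_cost (\<lambda>p q. D (p, q)) P z \<le> lp_cost (\<lambda>p q. D (p, q)) P v"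
      proof
        assume "(\<forall>p\<in>P. u p = y p) \<and> (\<forall>p\<in>P. \<forall>q\<in>P. v p q = z p q)"
        then have "lp_cost (\<lambda>p q. D (p, q)) P v = lp_cost (\<lambda>p q. D (p, q)) P z"
          by (intro lp_cost_cong) blast
        then show ?thesis by simp
      qed simp
    qed
    have "(\<forall>p\<in>P. u p = y p) \<and> (\<forall>p\<in>P. \<forall>q\<in>P. v p q = z p q)"
      if o: "lp_optimal (\<lambda>p q. D (p, q)) k P u v" for u v
    proof -
      have "lp_feasible k P u v" "lp_cost (\<lambda>p q. D (p, q)) P v \<le> lp_cost (\<lambda>p q. D (p, q)) P z"
        using o f unfolding lp_optimal_def by blast+
      with E'[of u v] show ?thesis by (meson not_less)
    qed
    then show "exact_recovery (\<lambda>p q. D (p, q)) k A"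
      unfolding exact_recovery_def Let_def P_def[symmetric] using opt ip one cl by blast
  qed
  then have "{D :: 'a \<times> 'a \<Rightarrow> real. exact_recovery (\<lambda>p q. D (p, q)) k A} = (\<Union>w\<in>F. E w)" by auto
  then show ?thesis
    using finF borel_unique_optimum[OF finP] unfolding E_def by auto
qed

section \<open>Moments of rotation-invariant measures on balls\<close>

lemma Rn_dist_nonneg [simp]: "0 \<le> Rn_dist m x y"
  unfolding Rn_dist_def by simp

lemma Rn_dist_commute: "Rn_dist m x y = Rn_dist m y x"
  unfolding Rn_dist_def L2_set_def by (simp add: power2_commute)

lemma Rn_dist_self [simp]: "Rn_dist m x x = 0"
  unfolding Rn_dist_def L2_set_def by simp

lemma Rn_dist_triangle: "Rn_dist m x z \<le> Rn_dist m x y + Rn_dist m y z"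
  unfolding Rn_dist_def
  using L2_set_triangle_ineq[of "\<lambda>i. x i - y i" "\<lambda>i. y i - z i" "{..<m}"] by simp

lemma Rn_dist_power2: "(Rn_dist m x y)\<^sup>2 = (\<Sum>i<m. (x i - y i)\<^sup>2)"
  unfolding Rn_dist_def L2_set_def by (simp add: sum_nonneg)

lemma abs_coord_le_Rn_dist: "i < m \<Longrightarrow> \<bar>x i - y i\<bar> \<le> Rn_dist m x y"
  unfolding Rn_dist_def using member_le_L2_set[of "{..<m}" i "\<lambda>i. \<bar>x i - y i\<bar>"]
  by (simp add: L2_set_def)

lemma Rn_dist_diff_power2:
  "(Rn_dist m p x)\<^sup>2 = (Rn_dist m c x)\<^sup>2 + (Rn_dist m c p)\<^sup>2
    - 2 * (\<Sum>i<m. (x i - c i) * (p i - c i))"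
proof -
  have "(p i - x i)\<^sup>2 = (c i - x i)\<^sup>2 + (c i - p i)\<^sup>2 - 2 * ((x i - c i) * (p i - c i))" for i
    by (simp add: power2_eq_square algebra_simps)
  then show ?thesis unfolding Rn_dist_power2
    by (simp add: sum.distrib sum_subtractf sum_distrib_left)
qed

lemma abs_inner_le_Rn_dist:
  "\<bar>\<Sum>i<m. (x i - c i) * (p i - c i)\<bar> \<le> Rn_dist m c x * Rn_dist m c p"
proof -
  have "\<bar>\<Sum>i<m. (x i - c i) * (p i - c i)\<bar> \<le> (\<Sum>i<m. \<bar>x i - c i\<bar> * \<bar>p i - c i\<bar>)"
    by (rule order_trans[OF sum_abs]) (simp add: abs_mult)
  also have "\<dots> \<le> L2_set (\<lambda>i. x i - c i) {..<m} * L2_set (\<lambda>i. p i - c i) {..<m}"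
    by (rule L2_set_mult_ineq)
  finally show ?thesis
    unfolding Rn_dist_def by (simp add: L2_set_def power2_commute)
qed

lemma measurable_Rn_dist:
  assumes "\<And>i. i < m \<Longrightarrow> (\<lambda>w. f w i) \<in> borel_measurable M"
    and "\<And>i. i < m \<Longrightarrow> (\<lambda>w. g w i) \<in> borel_measurable M"
  shows "(\<lambda>w. Rn_dist m (f w) (g w)) \<in> borel_measurable M"
proof -
  have "(\<lambda>w. \<Sum>i<m. (f w i - g w i)\<^sup>2) \<in> borel_measurable M"
    by (intro borel_measurable_sum borel_measurable_power borel_measurable_diff assms) auto
  then show ?thesis unfolding Rn_dist_def L2_set_def by measurable
qed

lemma sets_Rn_cball: "Rn_cball m c r \<in> sets (Rn_borel m)"
proof -
  have "(\<lambda>x. Rn_dist m c x) \<in> borel_measurable (Rn_borel m)"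
    by (rule measurable_Rn_dist) auto
  then have "{x \<in> space (Rn_borel m). Rn_dist m c x \<le> r} \<in> sets (Rn_borel m)" by measurable
  also have "{x \<in> space (Rn_borel m). Rn_dist m c x \<le> r} = Rn_cball m c r"
    by (auto simp: space_PiM Rn_cball_def)
  finally show ?thesis .
qed

locale ball_prob = prob_space M
  for M :: "(nat \<Rightarrow> real) measure" +
  fixes m :: nat and c :: "nat \<Rightarrow> real" and r :: real
  assumes sets_M: "sets M = sets (restrict_space (Rn_borel m) (Rn_cball m c r))"
begin

lemma space_M: "space M = Rn_cball m c r"
proof -
  have "space M = space (restrict_space (Rn_borel m) (Rn_cball m c r))"
    by (rule sets_eq_imp_space_eq[OF sets_M])
  then show ?thesis by (auto simp: space_restrict_space space_PiM Rn_cball_def)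
qed

lemma measurable_coord: "i < m \<Longrightarrow> (\<lambda>x. x i) \<in> borel_measurable M"
  unfolding measurable_cong_sets[OF sets_M refl]
  by (rule measurable_restrict_space1) simp

lemma measurable_dist [measurable]: "(\<lambda>x. Rn_dist m p x) \<in> borel_measurable M"
  by (rule measurable_Rn_dist) (auto intro: measurable_coord)

lemma measurable_inner [measurable]: "(\<lambda>x. \<Sum>i<m. (x i - c i) * v i) \<in> borel_measurable M"
  by (intro borel_measurable_sum borel_measurable_times borel_measurable_diff measurable_coord) auto

lemma integrable_bounded:
  fixes f :: "(nat \<Rightarrow> real) \<Rightarrow> real"
  assumes "f \<in> borel_measurable M" "\<And>x. x \<in> Rn_cball m c r \<Longrightarrow> \<bar>f x\<bar> \<le> B"
  shows "integrable M f"
  by (rule integrable_const_bound[of _ B]) (use assms in \<open>auto simp: space_M\<close>)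

lemma dist_le: "x \<in> space M \<Longrightarrow> Rn_dist m c x \<le> r"
  unfolding space_M Rn_cball_def by auto

end

section \<open>Moments from quarter turns in coordinate planes\<close>

text \<open>The turn of the (i, j) plane with new coordinates -x_j and x_i. Sign changes of one
  coordinate and plain swaps have determinant -1 and are not rotations; these turns are, and they
  determine all moments of order one and two.\<close>

definition quarter_turn :: "nat \<Rightarrow> nat \<Rightarrow> nat \<Rightarrow> real mat" where
  "quarter_turn m i j = multrow i (- 1) (swaprows i j (1\<^sub>m m))"

lemma quarter_turn_index:
  assumes "i < m" "j < m" "i \<noteq> j" "a < m" "b < m"
  shows "quarter_turn m i j $$ (a, b) =
    (if a = i then (if b = j then - 1 else 0) else if a = j then (if b = i then 1 else 0)
     else if a = b then 1 else 0)"
  using assms unfolding quarter_turn_def by auto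

lemma rotation_mat_quarter_turn:
  assumes "i < m" "j < m" "i \<noteq> j"
  shows "rotation_mat m (quarter_turn m i j)"
  unfolding rotation_mat_def
proof (intro conjI)
  show carr: "quarter_turn m i j \<in> carrier_mat m m" unfolding quarter_turn_def by simp
  \<comment> \<open>The negated row compensates the sign of the swap.\<close>
  show "Determinant.det (quarter_turn m i j) = 1"
    unfolding quarter_turn_def using assms by (simp add: det_multrow[of _ m] det_swaprows[of _ m])
  show "quarter_turn m i j * transpose_mat (quarter_turn m i j) = 1\<^sub>m m"
  proof (rule eq_matI)
    fix a b assume "a < dim_row (1\<^sub>m m :: real mat)" "b < dim_col (1\<^sub>m m :: real mat)"
    then have ab: "a < m" "b < m" by auto
    \<comment> \<open>Row \<open>e\<close> has a single nonzero entry, \<open>s e\<close> in column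
      \<open>w e\<close>.\<close>
    define w where "w e = (if e = i then j else if e = j then i else e)" for e
    define s where "s e = (if e = i then - 1 else 1 :: real)" for e
    have q: "quarter_turn m i j $$ (e, l) = (if l = w e then s e else 0)" if "e < m" "l < m" for e l
      using quarter_turn_index[OF assms that] assms unfolding w_def s_def by auto
    have "(quarter_turn m i j * transpose_mat (quarter_turn m i j)) $$ (a, b) =
        (\<Sum>l<m. quarter_turn m i j $$ (a, l) * quarter_turn m i j $$ (b, l))"
      using ab carr by (simp add: scalar_prod_def lessThan_atLeast0)
    also have "\<dots> = (\<Sum>l<m. if l = w a then (if w a = w b then s a * s b else 0) else 0)"
      using ab by (intro sum.cong) (auto simp: q)
    also have "\<dots> = (if w a = w b then s a * s b else 0)"
      using ab assms unfolding w_def by auto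
    also have "\<dots> = 1\<^sub>m m $$ (a, b)"
      using ab assms unfolding w_def s_def by auto
    finally show "(quarter_turn m i j * transpose_mat (quarter_turn m i j)) $$ (a, b) = 1\<^sub>m m $$ (a, b)" .
  qed (use carr in auto)
qed

lemma rotate_about_quarter_turn:
  assumes "i < m" "j < m" "i \<noteq> j"
  shows "rotate_about m c (quarter_turn m i j) x =
    (\<lambda>l\<in>{..<m}. c l + (if l = i then - (x j - c j) else if l = j then x i - c i else x l - c l))"
  unfolding rotate_about_def
proof (rule restrict_ext)
  fix l assume "l \<in> {..<m}"
  then have l: "l < m" by simp
  have "(\<Sum>b<m. quarter_turn m i j $$ (l, b) * (x b - c b)) =
    (\<Sum>b<m. if b = (if l = i then j else if l = j then i else l)
       then (if l = i then - 1 else 1) * (x b - c b) else 0)"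
    using l assms by (intro sum.cong) (auto simp: quarter_turn_index)
  also have "\<dots> = (if l = i then - (x j - c j) else if l = j then x i - c i else x l - c l)"
    using l assms by (subst sum.delta) auto
  finally show "c l + (\<Sum>b<m. quarter_turn m i j $$ (l, b) * (x b - c b)) =
    c l + (if l = i then - (x j - c j) else if l = j then x i - c i else x l - c l)" by simp
qed

lemma Rn_dist_quarter_turn:
  assumes "i < m" "j < m" "i \<noteq> j"
  shows "Rn_dist m c (rotate_about m c (quarter_turn m i j) x) = Rn_dist m c x"
proof -
  define f where "f l = (if l = i then (x j - c j)\<^sup>2 else if l = j then (x i - c i)\<^sup>2 else (x l - c l)\<^sup>2)" for l
  have "(\<Sum>l<m. f l) = f i + (f j + (\<Sum>l\<in>{..<m} - {i} - {j}. f l))"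
    using assms by (subst sum.remove[of _ i]; simp add: sum.remove[of _ j])
  moreover have "(\<Sum>l<m. (x l - c l)\<^sup>2) = (x i - c i)\<^sup>2 + ((x j - c j)\<^sup>2 + (\<Sum>l\<in>{..<m} - {i} - {j}. (x l - c l)\<^sup>2))"
    using assms by (subst sum.remove[of _ i]; simp add: sum.remove[of _ j])
  moreover have "(\<Sum>l\<in>{..<m} - {i} - {j}. f l) = (\<Sum>l\<in>{..<m} - {i} - {j}. (x l - c l)\<^sup>2)"
    unfolding f_def by (intro sum.cong) auto
  ultimately have "(\<Sum>l<m. f l) = (\<Sum>l<m. (x l - c l)\<^sup>2)"
    using assms unfolding f_def by simp
  moreover have "(Rn_dist m c (rotate_about m c (quarter_turn m i j) x))\<^sup>2 = (\<Sum>l<m. f l)"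
    unfolding Rn_dist_power2 rotate_about_quarter_turn[OF assms] f_def
    by (intro sum.cong) (auto simp: power2_eq_square algebra_simps)
  moreover have "(Rn_dist m c x)\<^sup>2 = (\<Sum>l<m. (x l - c l)\<^sup>2)"
    unfolding Rn_dist_power2 by (simp add: power2_commute)
  ultimately show ?thesis by (metis Rn_dist_nonneg power2_eq_iff_nonneg)
qed

context ball_prob begin

lemma integral_quarter_turn:
  fixes f :: "(nat \<Rightarrow> real) \<Rightarrow> real"
  assumes rot: "rotation_invariant m c M" and ij: "i < m" "j < m" "i \<noteq> j"
    and f: "f \<in> borel_measurable M"
  shows "(\<integral>x. f (rotate_about m c (quarter_turn m i j) x) \<partial>M) = (\<integral>x. f x \<partial>M)"
proof -
  let ?T = "rotate_about m c (quarter_turn m i j)"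
  have "?T \<in> measurable M (Rn_borel m)"
    unfolding rotate_about_def
    by (rule measurable_restrict)
      (intro borel_measurable_add borel_measurable_sum borel_measurable_times borel_measurable_diff
        borel_measurable_const measurable_coord, auto)
  moreover have "?T x \<in> Rn_cball m c r" if "x \<in> space M" for x
    using dist_le[OF that] Rn_dist_quarter_turn[OF ij] unfolding Rn_cball_def rotate_about_def by auto
  ultimately have T: "?T \<in> measurable M M"
    unfolding measurable_cong_sets[OF refl sets_M] by (intro measurable_restrict_space2) auto
  have "distr M M ?T = M"
    using rot rotation_mat_quarter_turn[OF ij] unfolding rotation_invariant_def by blast
  then show ?thesis using integral_distr[OF T f] by simp
qed

text \<open>A quarter turn makes each coordinate mean equal both to the other one and to its
  negative, negates the product of the two coordinates, and exchanges their squares. A radial weight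
  \<open>h\<close> is unaffected by it; such weights later normalise vectors and restrict to
  shells.\<close>

lemma radial_moments:
  fixes h :: "real \<Rightarrow> real"
  assumes rot: "rotation_invariant m c M" and ij: "i < m" "j < m" "i \<noteq> j"
    and h [measurable]: "h \<in> borel_measurable borel"
  shows "(\<integral>x. h (Rn_dist m c x) * (x i - c i) \<partial>M) = 0"
    and "(\<integral>x. h (Rn_dist m c x) * ((x i - c i) * (x j - c j)) \<partial>M) = 0"
    and "(\<integral>x. h (Rn_dist m c x) * (x i - c i)\<^sup>2 \<partial>M) = (\<integral>x. h (Rn_dist m c x) * (x j - c j)\<^sup>2 \<partial>M)"
proof -
  let ?T = "rotate_about m c (quarter_turn m i j)"
  have Ti: "?T x i - c i = - (x j - c j)" and Tj: "?T x j - c j = x i - c i" for x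
    using ij by (auto simp: rotate_about_quarter_turn)
  note [measurable] = measurable_coord[OF ij(1)] measurable_coord[OF ij(2)]
  note I = integral_quarter_turn[OF rot ij]
  have "(\<integral>x. h (Rn_dist m c x) * (x i - c i) \<partial>M) = - (\<integral>x. h (Rn_dist m c x) * (x j - c j) \<partial>M)"
    using I[of "\<lambda>x. h (Rn_dist m c x) * (x i - c i)"] by (simp add: Rn_dist_quarter_turn[OF ij] Ti del: minus_diff_eq)
  moreover have "(\<integral>x. h (Rn_dist m c x) * (x j - c j) \<partial>M) = (\<integral>x. h (Rn_dist m c x) * (x i - c i) \<partial>M)"
    using I[of "\<lambda>x. h (Rn_dist m c x) * (x j - c j)"] by (simp add: Rn_dist_quarter_turn[OF ij] Tj)
  ultimately show "(\<integral>x. h (Rn_dist m c x) * (x i - c i) \<partial>M) = 0" by linarith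
  have "(\<integral>x. h (Rn_dist m c x) * ((x i - c i) * (x j - c j)) \<partial>M) =
      - (\<integral>x. h (Rn_dist m c x) * ((x i - c i) * (x j - c j)) \<partial>M)"
    using I[of "\<lambda>x. h (Rn_dist m c x) * ((x i - c i) * (x j - c j))"]
    by (simp add: Rn_dist_quarter_turn[OF ij] Ti Tj mult.commute[of "x j - c j" for x] del: minus_diff_eq)
  then show "(\<integral>x. h (Rn_dist m c x) * ((x i - c i) * (x j - c j)) \<partial>M) = 0" by linarith
  show "(\<integral>x. h (Rn_dist m c x) * (x i - c i)\<^sup>2 \<partial>M) = (\<integral>x. h (Rn_dist m c x) * (x j - c j)\<^sup>2 \<partial>M)"
    using I[of "\<lambda>x. h (Rn_dist m c x) * (x i - c i)\<^sup>2"]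
    by (simp add: Rn_dist_quarter_turn[OF ij] Ti del: minus_diff_eq)
qed

lemma radial_inner_moment1:
  fixes h :: "real \<Rightarrow> real"
  assumes rot: "rotation_invariant m c M" and m: "2 \<le> m"
    and h [measurable]: "h \<in> borel_measurable borel" and B: "\<And>u. 0 \<le> u \<Longrightarrow> \<bar>h u * u\<bar> \<le> B"
  shows "(\<integral>x. h (Rn_dist m c x) * (\<Sum>i<m. (x i - c i) * v i) \<partial>M) = 0"
proof -
  have int: "integrable M (\<lambda>x. h (Rn_dist m c x) * (x i - c i))" if i: "i < m" for i
  proof (rule integrable_bounded)
    show "(\<lambda>x. h (Rn_dist m c x) * (x i - c i)) \<in> borel_measurable M"
      using measurable_coord[OF i] by measurable
    fix x
    have "\<bar>h (Rn_dist m c x) * (x i - c i)\<bar> \<le> \<bar>h (Rn_dist m c x)\<bar> * Rn_dist m c x"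
      using abs_coord_le_Rn_dist[OF i, of c x] unfolding abs_mult
      by (intro mult_left_mono) (auto simp: abs_minus_commute)
    also have "\<dots> \<le> B" using B[of "Rn_dist m c x"] by (simp add: abs_mult)
    finally show "\<bar>h (Rn_dist m c x) * (x i - c i)\<bar> \<le> B" .
  qed
  have "(\<integral>x. h (Rn_dist m c x) * (\<Sum>i<m. (x i - c i) * v i) \<partial>M) =
      (\<integral>x. (\<Sum>i<m. (h (Rn_dist m c x) * (x i - c i)) * v i) \<partial>M)"
    by (simp add: sum_distrib_left mult.assoc)
  also have "\<dots> = (\<Sum>i<m. (\<integral>x. (h (Rn_dist m c x) * (x i - c i)) * v i \<partial>M))"
    by (intro Bochner_Integration.integral_sum integrable_mult_left int) simp
  also have "\<dots> = (\<Sum>i<m. 0)"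
  proof (rule sum.cong)
    fix i assume "i \<in> {..<m}"
    moreover obtain j where "j < m" "i \<noteq> j"
      using m by (metis One_nat_def Suc_1 less_le_trans less_numeral_extra(1) lessI zero_less_Suc zero_neq_one)
    ultimately show "(\<integral>x. (h (Rn_dist m c x) * (x i - c i)) * v i \<partial>M) = 0"
      using radial_moments(1)[OF rot _ _ _ h] by simp
  qed simp
  finally show ?thesis by simp
qed

text \<open>By \<open>radial_moments\<close> the weighted second moment matrix is a multiple of the
  identity, and its trace determines the multiple.\<close>

lemma radial_inner_moment2:
  fixes h :: "real \<Rightarrow> real"
  assumes rot: "rotation_invariant m c M" and m: "2 \<le> m"
    and h [measurable]: "h \<in> borel_measurable borel" and B: "\<And>u. 0 \<le> u \<Longrightarrow> \<bar>h u * u\<^sup>2\<bar> \<le> B"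
  shows "integrable M (\<lambda>x. h (Rn_dist m c x) * (\<Sum>i<m. (x i - c i) * v i)\<^sup>2)"
    and "(\<integral>x. h (Rn_dist m c x) * (\<Sum>i<m. (x i - c i) * v i)\<^sup>2 \<partial>M) =
      (\<Sum>i<m. (v i)\<^sup>2) / m * (\<integral>x. h (Rn_dist m c x) * (Rn_dist m c x)\<^sup>2 \<partial>M)"
proof -
  let ?h = "\<lambda>x. h (Rn_dist m c x)"
  define g where "g i j x = ?h x * ((x i - c i) * (x j - c j))" for i j x
  have int: "integrable M (g i j)" if ij: "i < m" "j < m" for i j
    unfolding g_def
  proof (rule integrable_bounded)
    show "(\<lambda>x. ?h x * ((x i - c i) * (x j - c j))) \<in> borel_measurable M"
      using measurable_coord[OF ij(1)] measurable_coord[OF ij(2)] by measurable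
    fix x
    have "\<bar>?h x * ((x i - c i) * (x j - c j))\<bar> \<le> \<bar>?h x\<bar> * (Rn_dist m c x * Rn_dist m c x)"
      using abs_coord_le_Rn_dist[OF ij(1), of c x] abs_coord_le_Rn_dist[OF ij(2), of c x] unfolding abs_mult
      by (intro mult_left_mono mult_mono) (auto simp: abs_minus_commute)
    also have "\<dots> \<le> B" using B[of "Rn_dist m c x"] by (simp add: abs_mult power2_eq_square)
    finally show "\<bar>?h x * ((x i - c i) * (x j - c j))\<bar> \<le> B" .
  qed
  have expand: "?h x * (\<Sum>i<m. (x i - c i) * v i)\<^sup>2 = (\<Sum>i<m. \<Sum>j<m. v i * v j * g i j x)" for x
    unfolding g_def power2_eq_square sum_product unfolding sum_distrib_left
    by (intro sum.cong refl) (simp add: mult_ac)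
  show "integrable M (\<lambda>x. ?h x * (\<Sum>i<m. (x i - c i) * v i)\<^sup>2)"
    unfolding expand by (intro Bochner_Integration.integrable_sum integrable_mult_right int) auto
  have off: "(\<integral>x. g i j x \<partial>M) = 0" if "i < m" "j < m" "i \<noteq> j" for i j
    unfolding g_def using radial_moments(2)[OF rot that h] .
  have diag: "(\<integral>x. g i i x \<partial>M) = (\<integral>x. g 0 0 x \<partial>M)" if i: "i < m" for i
  proof (cases "i = 0")
    case False
    then show ?thesis
      using radial_moments(3)[OF rot i _ False h] m unfolding g_def by (simp add: power2_eq_square)
  qed simp
  have "?h x * (Rn_dist m c x)\<^sup>2 = (\<Sum>i<m. g i i x)" for x
  proof -
    have "(Rn_dist m c x)\<^sup>2 = (\<Sum>i<m. (x i - c i) * (x i - c i))"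
      unfolding Rn_dist_power2 by (intro sum.cong refl) (simp add: power2_eq_square algebra_simps)
    then show ?thesis unfolding g_def by (simp add: sum_distrib_left)
  qed
  then have "(\<integral>x. ?h x * (Rn_dist m c x)\<^sup>2 \<partial>M) = (\<integral>x. (\<Sum>i<m. g i i x) \<partial>M)"
    by simp
  also have "\<dots> = (\<Sum>i<m. (\<integral>x. g i i x \<partial>M))"
    using int by (intro Bochner_Integration.integral_sum) auto
  also have "\<dots> = (\<Sum>i<m. (\<integral>x. g 0 0 x \<partial>M))"
    by (intro sum.cong refl diag) simp
  also have "\<dots> = m * (\<integral>x. g 0 0 x \<partial>M)" by simp
  finally have G: "(\<integral>x. g 0 0 x \<partial>M) = (\<integral>x. ?h x * (Rn_dist m c x)\<^sup>2 \<partial>M) / m"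
    using m by simp
  have "(\<integral>x. ?h x * (\<Sum>i<m. (x i - c i) * v i)\<^sup>2 \<partial>M) = (\<Sum>i<m. (\<integral>x. (\<Sum>j<m. v i * v j * g i j x) \<partial>M))"
    unfolding expand
    by (intro Bochner_Integration.integral_sum Bochner_Integration.integrable_sum integrable_mult_right int) auto
  also have "\<dots> = (\<Sum>i<m. \<Sum>j<m. (\<integral>x. v i * v j * g i j x \<partial>M))"
    by (intro sum.cong refl Bochner_Integration.integral_sum integrable_mult_right int) auto
  also have "\<dots> = (\<Sum>i<m. \<Sum>j<m. v i * v j * (\<integral>x. g i j x \<partial>M))"
    by simp
  also have "\<dots> = (\<Sum>i<m. \<Sum>j<m. if j = i then (v i)\<^sup>2 * (\<integral>x. g 0 0 x \<partial>M) else 0)"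
  proof (intro sum.cong refl)
    fix i j assume "i \<in> {..<m}" "j \<in> {..<m}"
    then have ij: "i < m" "j < m" by auto
    show "v i * v j * (\<integral>x. g i j x \<partial>M) = (if j = i then (v i)\<^sup>2 * (\<integral>x. g 0 0 x \<partial>M) else 0)"
      using off[OF ij] diag[OF ij(1)] by (cases "j = i") (simp_all add: power2_eq_square)
  qed
  also have "\<dots> = (\<Sum>i<m. (v i)\<^sup>2) * (\<integral>x. g 0 0 x \<partial>M)"
    by (simp add: sum_distrib_right)
  finally show "(\<integral>x. ?h x * (\<Sum>i<m. (x i - c i) * v i)\<^sup>2 \<partial>M) =
      (\<Sum>i<m. (v i)\<^sup>2) / m * (\<integral>x. ?h x * (Rn_dist m c x)\<^sup>2 \<partial>M)"
    unfolding G by simp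
qed

end

section \<open>Expected contributions\<close>

text \<open>Here \<open>D\<close> is the distance from p to x, \<open>\<rho>\<close> and
  \<open>s\<close> are the distances of x and p from the center, and \<open>t\<close> is the
  component of p - c along x - c. From D^2 - (\<rho> - t)^2 = s^2 - t^2 and D + \<rho> - t \<le> 4 R
  one gets the gain (s^2 - t^2)/(4 R) over \<rho> - t. The bound must also stay below
  \<open>A\<close>, although -t may be large; a multiple of t^2 is subtracted for that. This form is
  made for integration: the term linear in \<open>t\<close> has mean zero and t^2 has mean of order
  s^2/m. The coefficient 1/(2 e), large for small \<open>e\<close>, appears only for \<rho> > R/2,
  an event of small probability in that case.\<close>

lemma truncated_dist_lower_bound:
  fixes \<rho> s t D R e A :: real
  assumes \<rho>: "0 \<le> \<rho>" "\<rho> \<le> R" and s: "0 \<le> s" "s \<le> R" and t: "\<bar>t\<bar> \<le> s" and R: "0 < R"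
    and D: "0 \<le> D" "D\<^sup>2 = \<rho>\<^sup>2 + s\<^sup>2 - 2 * (\<rho> * t)" and e: "0 < e" and A: "R + e \<le> A"
  shows "\<rho> - t + (if \<rho> \<le> R / 2 then s\<^sup>2 / (4 * R) else min (s\<^sup>2 / (4 * R)) (e / 2))
    - (1 / R) * t\<^sup>2 - (if \<rho> \<le> R / 2 then 0 else 1 / (2 * e)) * t\<^sup>2 \<le> min D A"
proof -
  have t2: "t\<^sup>2 \<le> s\<^sup>2" using t s by (metis abs_le_square_iff abs_of_nonneg)
  have sq: "D\<^sup>2 - (\<rho> - t)\<^sup>2 = s\<^sup>2 - t\<^sup>2" using D(2) by (simp add: power2_eq_square algebra_simps)
  have X: "\<rho> - t \<le> D" using sq t2 D(1) by (metis abs_le_D1 abs_le_square_iff abs_of_nonneg diff_ge_0_iff_ge)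
  have "\<rho> * t \<ge> - (\<rho> * s)" using t \<rho> mult_left_mono[of "- s" t \<rho>] by auto
  then have "D\<^sup>2 \<le> (\<rho> + s)\<^sup>2" using D(2) by (simp add: power2_eq_square algebra_simps)
  then have "D \<le> \<rho> + s" using \<rho> s power2_le_imp_le[of D "\<rho> + s"] by linarith
  then have "D + (\<rho> - t) \<le> 4 * R" using X \<rho> s by linarith
  then have "(D - (\<rho> - t)) * (D + (\<rho> - t)) \<le> (D - (\<rho> - t)) * (4 * R)"
    using X by (intro mult_left_mono) auto
  moreover have "(D - (\<rho> - t)) * (D + (\<rho> - t)) = s\<^sup>2 - t\<^sup>2"
    using sq by (simp add: power2_eq_square algebra_simps)
  ultimately have "(s\<^sup>2 - t\<^sup>2) / (4 * R) \<le> D - (\<rho> - t)" using R by (simp add: divide_le_eq)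
  moreover have "t\<^sup>2 / (4 * R) \<le> (1 / R) * t\<^sup>2"
    using R by (simp add: divide_le_eq)
  ultimately have D1: "\<rho> - t + s\<^sup>2 / (4 * R) - (1 / R) * t\<^sup>2 \<le> D"
    by (simp add: diff_divide_distrib)
  have e1: "0 \<le> 1 / (2 * e) * t\<^sup>2" using e by simp
  show ?thesis
  proof (cases "\<rho> \<le> R / 2")
    case True
    \<comment> \<open>Completing the square leaves at most R/2 + R/4 + R/4, which is below
      \<open>A\<close>.\<close>
    have "0 \<le> (t + R / 2)\<^sup>2 / R" using R by simp
    also have "\<dots> = (1 / R) * t\<^sup>2 + t + R / 4" using R by (simp add: power2_eq_square field_simps)
    finally have 1: "- t - (1 / R) * t\<^sup>2 \<le> R / 4" by linarith
    have "s\<^sup>2 \<le> R * R" using s unfolding power2_eq_square by (intro mult_mono) auto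
    then have "s\<^sup>2 / (4 * R) \<le> R / 4" using R by (simp add: divide_le_eq)
    then have "\<rho> - t + s\<^sup>2 / (4 * R) - (1 / R) * t\<^sup>2 \<le> A" using 1 True A e by linarith
    then show ?thesis using D1 True by simp
  next
    case False
    \<comment> \<open>Now \<open>\<rho>\<close> may reach \<open>R\<close>, and only the room
      \<open>e\<close> above \<open>R\<close> is available: e/2 for -t - t^2/(2 e), and e/2 for the
      gain.\<close>
    have "0 \<le> (t + e)\<^sup>2 / (2 * e)" using e by simp
    also have "\<dots> = 1 / (2 * e) * t\<^sup>2 + t + e / 2" using e by (simp add: power2_eq_square field_simps)
    finally have "\<rho> - t + e / 2 - 1 / (2 * e) * t\<^sup>2 \<le> A" using A \<rho> by linarith
    moreover have "0 \<le> (1 / R) * t\<^sup>2" using R by simp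
    ultimately show ?thesis using D1 False e1 by (simp add: min_def)
  qed
qed

context ball_prob begin

text \<open>Integrates \<open>truncated_dist_lower_bound\<close>. By Markov's inequality the outer
  shell \<open>S\<close> has probability at most 2 e / R, so the coefficient 1/(2 e) cancels and
  both quadratic terms together cost 2 s^2/(m R).\<close>

lemma expected_truncated_dist:
  assumes rot: "rotation_invariant m c M" and m: "32 \<le> m" and r: "r \<le> R" and R: "0 < R"
    and p: "p \<in> Rn_cball m c r" and e: "e = (\<integral>x. Rn_dist m c x \<partial>M)" "0 < e" and A: "R + e \<le> A"
  shows "e + (Rn_dist m c p)\<^sup>2 / (16 * R) \<le> (\<integral>x. min (Rn_dist m p x) A \<partial>M)"
proof -
  define s where "s = Rn_dist m c p"
  define \<rho> where "\<rho> x = Rn_dist m c x" for x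
  define v where "v i = p i - c i" for i
  define w where "w x = (\<Sum>i<m. (x i - c i) * v i)" for x
  \<comment> \<open>At the center, division by zero gives 0, which is consistent with
    \<open>wt\<close> because \<open>w x\<close> vanishes there.\<close>
  define t where "t x = w x / \<rho> x" for x
  define S where "S = {x \<in> space M. \<rho> x > R / 2}"
  define g0 where "g0 = min (s\<^sup>2 / (4 * R)) (e / 2)"
  have s: "0 \<le> s" "s \<le> R" using p r unfolding s_def Rn_cball_def by auto
  have vs: "(\<Sum>i<m. (v i)\<^sup>2) = s\<^sup>2"
    unfolding v_def s_def Rn_dist_power2 by (simp add: power2_commute)
  have [measurable]: "\<rho> \<in> borel_measurable M" "w \<in> borel_measurable M"
    unfolding \<rho>_def w_def by measurable
  have [measurable]: "t \<in> borel_measurable M" unfolding t_def by measurable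
  have [measurable]: "S \<in> sets M" unfolding S_def by measurable
  have \<rho>: "0 \<le> \<rho> x" "\<rho> x \<le> R" if "x \<in> space M" for x
    using dist_le[OF that] r unfolding \<rho>_def by auto
  have w: "\<bar>w x\<bar> \<le> \<rho> x * s" for x
    unfolding w_def v_def \<rho>_def s_def by (rule abs_inner_le_Rn_dist)
  have t: "\<bar>t x\<bar> \<le> s" for x
  proof (cases "\<rho> x = 0")
    case False
    then have "0 < \<rho> x" unfolding \<rho>_def using Rn_dist_nonneg[of m c x] by linarith
    then show ?thesis using w[of x] unfolding t_def by (simp add: abs_divide divide_le_eq mult.commute)
  qed (use s in \<open>simp add: t_def\<close>)
  have wt: "w x = \<rho> x * t x" for x using w[of x] unfolding t_def by (cases "\<rho> x = 0") auto
  have pw: "\<rho> x - t x + (s\<^sup>2 / (4 * R) * indicator (space M - S) x + g0 * indicator S x)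
     - (1 / R) * (t x)\<^sup>2 - (1 / (2 * e)) * (indicator S x * (t x)\<^sup>2) \<le> min (Rn_dist m p x) A"
    if x: "x \<in> space M" for x
  proof -
    have "(Rn_dist m p x)\<^sup>2 = (\<rho> x)\<^sup>2 + s\<^sup>2 - 2 * (\<rho> x * t x)"
      unfolding wt[symmetric] unfolding w_def v_def \<rho>_def s_def by (rule Rn_dist_diff_power2)
    from truncated_dist_lower_bound[OF \<rho>[OF x] s t R Rn_dist_nonneg this e(2) A]
    show ?thesis using x unfolding g0_def S_def by (simp add: indicator_def split: if_splits)
  qed
  \<comment> \<open>Weight for the second moment of \<open>t\<close> on the shell:
    \<open>h2 u * u\<^sup>2\<close> is the indicator of u > R/2.\<close>
  define h2 :: "real \<Rightarrow> real" where "h2 u = (if u > R / 2 then 1 / u\<^sup>2 else 0)" for u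
  have [measurable]: "h2 \<in> borel_measurable borel" unfolding h2_def by measurable
  have m2: "2 \<le> m" using m by simp
  have t0: "(\<integral>x. t x \<partial>M) = 0"
    using radial_inner_moment1[OF rot m2, of "\<lambda>u. 1 / u" 1 v] unfolding t_def w_def \<rho>_def by simp
  have t2: "integrable M (\<lambda>x. (t x)\<^sup>2)" "(\<integral>x. (t x)\<^sup>2 \<partial>M) \<le> s\<^sup>2 / m"
  proof -
    have B: "\<bar>1 / u\<^sup>2 * u\<^sup>2\<bar> \<le> 1" for u :: real by simp
    have *: "(t x)\<^sup>2 = 1 / (\<rho> x)\<^sup>2 * (w x)\<^sup>2" for x unfolding t_def by (simp add: power_divide)
    show "integrable M (\<lambda>x. (t x)\<^sup>2)"
      using radial_inner_moment2(1)[where h = "\<lambda>u. 1 / u\<^sup>2" and v = v, OF rot m2 _ B] unfolding * w_def \<rho>_def by simp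
    have "(\<integral>x. (t x)\<^sup>2 \<partial>M) = s\<^sup>2 / m * (\<integral>x. 1 / (\<rho> x)\<^sup>2 * (\<rho> x)\<^sup>2 \<partial>M)"
      using radial_inner_moment2(2)[where h = "\<lambda>u. 1 / u\<^sup>2" and v = v, OF rot m2 _ B] unfolding * w_def \<rho>_def vs by simp
    also have "\<dots> \<le> s\<^sup>2 / m * 1"
    proof (rule mult_left_mono)
      show "(\<integral>x. 1 / (\<rho> x)\<^sup>2 * (\<rho> x)\<^sup>2 \<partial>M) \<le> 1"
        by (rule integral_le_const) (auto intro!: integrable_bounded[of _ 1])
    qed simp
    finally show "(\<integral>x. (t x)\<^sup>2 \<partial>M) \<le> s\<^sup>2 / m" by simp
  qed
  have int\<rho>: "integrable M \<rho>"
    by (rule integrable_bounded[of _ r]) (auto simp: \<rho>_def Rn_cball_def)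
  have intI: "integrable M (\<lambda>x. indicator X x :: real)" if "X \<in> sets M" for X
    by (rule integrable_bounded[of _ 1]) (use that in \<open>auto simp: indicator_def\<close>)
  have PS: "prob S \<le> 2 * e / R"
  proof -
    have "(R / 2) * prob S = (\<integral>x. (R / 2) * indicator S x \<partial>M)" by simp
    also have "\<dots> \<le> (\<integral>x. \<rho> x \<partial>M)"
    proof (rule integral_mono)
      show "integrable M (\<lambda>x. (R / 2) * indicator S x)" by (intro integrable_mult_right intI) simp
      show "(R / 2) * indicator S x \<le> \<rho> x" if "x \<in> space M" for x
        using \<rho>[OF that] by (auto simp: S_def indicator_def)
    qed (use int\<rho> in simp)
    finally show ?thesis using R e(1) unfolding \<rho>_def by (simp add: field_simps)
  qed
  have S2: "integrable M (\<lambda>x. indicator S x * (t x)\<^sup>2)" "(\<integral>x. indicator S x * (t x)\<^sup>2 \<partial>M) \<le> s\<^sup>2 / m * prob S"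
  proof -
    have B: "\<bar>h2 u * u\<^sup>2\<bar> \<le> 1" for u :: real unfolding h2_def by simp
    have *: "indicator S x * (t x)\<^sup>2 = h2 (\<rho> x) * (w x)\<^sup>2" if "x \<in> space M" for x
      using that unfolding t_def h2_def S_def by (simp add: power_divide indicator_def)
    show "integrable M (\<lambda>x. indicator S x * (t x)\<^sup>2)"
      using radial_inner_moment2(1)[OF rot m2 _ B, of v] unfolding w_def[symmetric] \<rho>_def[symmetric]
      by (subst Bochner_Integration.integrable_cong[OF refl *]) simp_all
    have "(\<integral>x. indicator S x * (t x)\<^sup>2 \<partial>M) = (\<integral>x. h2 (\<rho> x) * (w x)\<^sup>2 \<partial>M)"
      by (rule Bochner_Integration.integral_cong) (use * in auto)
    also have "\<dots> = s\<^sup>2 / m * (\<integral>x. h2 (\<rho> x) * (\<rho> x)\<^sup>2 \<partial>M)"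
      using radial_inner_moment2(2)[OF rot m2 _ B, of v] unfolding w_def \<rho>_def vs by simp
    also have "(\<integral>x. h2 (\<rho> x) * (\<rho> x)\<^sup>2 \<partial>M) = (\<integral>x. indicator S x \<partial>M)"
      using R by (intro Bochner_Integration.integral_cong) (auto simp: h2_def S_def indicator_def)
    finally show "(\<integral>x. indicator S x * (t x)\<^sup>2 \<partial>M) \<le> s\<^sup>2 / m * prob S" by simp
  qed
  have intt: "integrable M t" by (rule integrable_bounded[of _ s]) (use t in auto)
  have g0: "0 \<le> g0" using R e(2) unfolding g0_def by simp
  define F where "F x = s\<^sup>2 / (4 * R) * indicator (space M - S) x + g0 * indicator S x" for x
  define T2 where "T2 x = (1 / R) * (t x)\<^sup>2" for x
  define T3 where "T3 x = (1 / (2 * e)) * (indicator S x * (t x)\<^sup>2)" for x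
  have F: "integrable M F" "(\<integral>x. F x \<partial>M) = s\<^sup>2 / (4 * R) * prob (space M - S) + g0 * prob S"
  proof -
    have *: "integrable M (\<lambda>x. s\<^sup>2 / (4 * R) * indicator (space M - S) x)"
        "integrable M (\<lambda>x. g0 * indicator S x :: real)"
      by (intro integrable_mult_right intI; simp)+
    show "integrable M F" unfolding F_def by (intro Bochner_Integration.integrable_add *)
    show "(\<integral>x. F x \<partial>M) = s\<^sup>2 / (4 * R) * prob (space M - S) + g0 * prob S"
      unfolding F_def Bochner_Integration.integral_add[OF *] by simp
  qed
  have intT: "integrable M T2" "integrable M T3"
    unfolding T2_def T3_def using t2(1) S2(1) by (intro integrable_mult_right; simp)+
  have P1: "prob (space M - S) = 1 - prob S" by (rule prob_compl) simp
  \<comment> \<open>Either \<open>e\<close> is so large that even e/2, the capped gain on the shell,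
    is at least s^2/(8 R), or the shell has probability at most 1/2 and its complement supplies the
    gain.\<close>
  have key: "s\<^sup>2 / (8 * R) \<le> s\<^sup>2 / (4 * R) * (1 - prob S) + g0 * prob S"
  proof (cases "R / 4 \<le> e")
    case True
    have "s\<^sup>2 \<le> R * R" using s unfolding power2_eq_square by (intro mult_mono) auto
    then have "s\<^sup>2 / (8 * R) \<le> R / 8" using R by (simp add: divide_le_eq)
    moreover have "s\<^sup>2 / (8 * R) \<le> s\<^sup>2 / (4 * R)" using R by (intro divide_left_mono) auto
    ultimately have "s\<^sup>2 / (8 * R) \<le> g0" unfolding g0_def using True by simp
    then have "s\<^sup>2 / (8 * R) * (1 - prob S) + s\<^sup>2 / (8 * R) * prob S \<le> s\<^sup>2 / (4 * R) * (1 - prob S) + g0 * prob S"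
      using \<open>s\<^sup>2 / (8 * R) \<le> s\<^sup>2 / (4 * R)\<close> by (intro add_mono mult_right_mono) auto
    moreover have "a * (1 - prob S) + a * prob S = a" for a :: real
      by (simp add: algebra_simps)
    ultimately show ?thesis by metis
  next
    case False
    then have "2 * e / R \<le> 1 / 2" using R by (simp add: divide_le_eq)
    then have "1 / 2 \<le> 1 - prob S" using PS by linarith
    then have "s\<^sup>2 / (4 * R) * (1 / 2) \<le> s\<^sup>2 / (4 * R) * (1 - prob S)"
      using R by (intro mult_left_mono) auto
    moreover have "0 \<le> g0 * prob S" using g0 by simp
    ultimately show ?thesis by simp
  qed
  have "e + s\<^sup>2 / (8 * R) - (1 / R) * (s\<^sup>2 / m) - (1 / (2 * e)) * (s\<^sup>2 / m * (2 * e / R)) \<le>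
      e - 0 + (s\<^sup>2 / (4 * R) * prob (space M - S) + g0 * prob S)
       - (1 / R) * (\<integral>x. (t x)\<^sup>2 \<partial>M) - (1 / (2 * e)) * (\<integral>x. indicator S x * (t x)\<^sup>2 \<partial>M)"
  proof -
    have "(1 / R) * (\<integral>x. (t x)\<^sup>2 \<partial>M) \<le> (1 / R) * (s\<^sup>2 / m)"
      using t2(2) R by (intro mult_left_mono) auto
    moreover have "s\<^sup>2 / m * prob S \<le> s\<^sup>2 / m * (2 * e / R)"
      using PS by (intro mult_left_mono) auto
    then have "(1 / (2 * e)) * (\<integral>x. indicator S x * (t x)\<^sup>2 \<partial>M) \<le> (1 / (2 * e)) * (s\<^sup>2 / m * (2 * e / R))"
      using S2(2) e(2) by (intro mult_left_mono) auto
    ultimately show ?thesis using key unfolding P1 by linarith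
  qed
  also have "\<dots> = (\<integral>x. \<rho> x \<partial>M) - (\<integral>x. t x \<partial>M) + (\<integral>x. F x \<partial>M) - (\<integral>x. T2 x \<partial>M) - (\<integral>x. T3 x \<partial>M)"
    unfolding t0 F T2_def T3_def using e(1) unfolding \<rho>_def by simp
  also have "\<dots> = (\<integral>x. \<rho> x - t x + F x - T2 x - T3 x \<partial>M)"
    using int\<rho> intt F(1) intT by simp
  also have "\<dots> \<le> (\<integral>x. min (Rn_dist m p x) A \<partial>M)"
  proof (rule integral_mono)
    show "integrable M (\<lambda>x. min (Rn_dist m p x) A)"
      by (rule integrable_bounded[of _ A]) (use R e A in auto)
    show "\<rho> x - t x + F x - T2 x - T3 x \<le> min (Rn_dist m p x) A" if "x \<in> space M" for x
      using pw[OF that] unfolding F_def T2_def T3_def .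
    show "integrable M (\<lambda>x. \<rho> x - t x + F x - T2 x - T3 x)"
      using int\<rho> intt F(1) intT by simp
  qed
  finally have "e + s\<^sup>2 / (8 * R) - (1 / R) * (s\<^sup>2 / m) - (1 / (2 * e)) * (s\<^sup>2 / m * (2 * e / R))
    \<le> (\<integral>x. min (Rn_dist m p x) A \<partial>M)" .
  moreover have "e + s\<^sup>2 / (8 * R) - (1 / R) * (s\<^sup>2 / m) - (1 / (2 * e)) * (s\<^sup>2 / m * (2 * e / R)) =
      e + s\<^sup>2 / R * (1 / 8 - 2 / m)"
    using e(2) R m by (simp add: field_simps)
  ultimately have "e + s\<^sup>2 / R * (1 / 8 - 2 / m) \<le> (\<integral>x. min (Rn_dist m p x) A \<partial>M)" by simp
  \<comment> \<open>The dimension bound 32 is the condition 2/m \<le> 1/16.\<close>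
  moreover have "s\<^sup>2 / R * (1 / 16) \<le> s\<^sup>2 / R * (1 / 8 - 2 / m)"
    using R m by (intro mult_left_mono) (auto simp: field_simps)
  ultimately show ?thesis unfolding s_def by simp
qed

text \<open>Let u be the component of x - c in the direction of p - c, and d = L - A > 0. Then A -
  dist(p, x) \<le> u - d \<le> u^2/(4 d), the last step from (u - 2 d)^2 \<ge> 0, and u^2 has mean
  at most R^2/m.\<close>

lemma expected_foreign_contribution:
  assumes rot: "rotation_invariant m c M" and m: "2 \<le> m" and r: "r \<le> R"
    and A: "A < Rn_dist m c p" "0 \<le> A"
  shows "(\<integral>x. max 0 (A - Rn_dist m p x) \<partial>M) \<le> R\<^sup>2 / (4 * m * (Rn_dist m c p - A))"
proof -
  define L where "L = Rn_dist m c p"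
  define d where "d = L - A"
  define \<rho> where "\<rho> x = Rn_dist m c x" for x
  define v where "v i = p i - c i" for i
  define w where "w x = (\<Sum>i<m. (x i - c i) * v i)" for x
  have L: "0 < L" and d: "0 < d" using A unfolding L_def d_def by auto
  have vs: "(\<Sum>i<m. (v i)\<^sup>2) = L\<^sup>2"
    unfolding v_def L_def Rn_dist_power2 by (simp add: power2_commute)
  have w: "\<bar>w x\<bar> \<le> \<rho> x * L" for x
    unfolding w_def v_def \<rho>_def L_def by (rule abs_inner_le_Rn_dist)
  have pw: "max 0 (A - Rn_dist m p x) \<le> 1 / (4 * d) * (w x / L)\<^sup>2" for x
  proof -
    have "(w x / L)\<^sup>2 \<le> (\<rho> x)\<^sup>2"
      using w[of x] L unfolding abs_le_square_iff[symmetric] \<rho>_def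
      by (simp add: abs_divide divide_le_eq)
    then have "(L - w x / L)\<^sup>2 \<le> (\<rho> x)\<^sup>2 + L\<^sup>2 - 2 * w x"
      using L by (simp add: power2_diff)
    also have "\<dots> = (Rn_dist m p x)\<^sup>2"
      unfolding w_def v_def \<rho>_def L_def by (rule Rn_dist_diff_power2[symmetric])
    finally have "L - w x / L \<le> Rn_dist m p x" by (rule power2_le_imp_le) simp
    then have "A - Rn_dist m p x \<le> w x / L - d" unfolding d_def by linarith
    also have "\<dots> \<le> 1 / (4 * d) * (w x / L)\<^sup>2"
    proof -
      have "0 \<le> (w x / L - 2 * d)\<^sup>2 / (4 * d)" using d by simp
      also have "\<dots> = 1 / (4 * d) * (w x / L)\<^sup>2 - (w x / L - d)"
        using d L by (simp add: power2_eq_square field_simps)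
      finally show ?thesis by simp
    qed
    finally show ?thesis using d by simp
  qed
  have r2: "u\<^sup>2 \<le> R\<^sup>2" if "0 \<le> u" "u \<le> r" for u using that r by (intro power_mono) auto
  \<comment> \<open>The constant weight 1, cut off outside the range of distances because the moment
    lemmas ask for a bounded \<open>h u * u\<^sup>2\<close>.\<close>
  define h :: "real \<Rightarrow> real" where "h u = (if 0 \<le> u \<and> u \<le> r then 1 else 0)" for u
  have [measurable]: "h \<in> borel_measurable borel" unfolding h_def by measurable
  have B: "\<bar>h u * u\<^sup>2\<bar> \<le> R\<^sup>2" for u using r2[of u] unfolding h_def by auto
  have h1: "h (\<rho> x) = 1" if "x \<in> space M" for x using dist_le[OF that] unfolding h_def \<rho>_def by simp
  have int: "integrable M (\<lambda>x. (w x)\<^sup>2)"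
  proof -
    have *: "(w x)\<^sup>2 = h (\<rho> x) * (w x)\<^sup>2" if "x \<in> space M" for x using h1[OF that] by simp
    show ?thesis
      using radial_inner_moment2(1)[OF rot m _ B, of v] unfolding w_def[symmetric] \<rho>_def[symmetric]
      by (subst Bochner_Integration.integrable_cong[OF refl *]) simp_all
  qed
  have "(\<integral>x. (w x)\<^sup>2 \<partial>M) = (\<integral>x. h (\<rho> x) * (w x)\<^sup>2 \<partial>M)"
    by (rule Bochner_Integration.integral_cong) (use h1 in auto)
  also have "\<dots> = L\<^sup>2 / m * (\<integral>x. h (\<rho> x) * (\<rho> x)\<^sup>2 \<partial>M)"
    using radial_inner_moment2(2)[OF rot m _ B, of v] unfolding w_def \<rho>_def vs by simp
  also have "\<dots> \<le> L\<^sup>2 / m * R\<^sup>2"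
  proof (rule mult_left_mono)
    show "(\<integral>x. h (\<rho> x) * (\<rho> x)\<^sup>2 \<partial>M) \<le> R\<^sup>2"
      using B by (intro integral_le_const integrable_bounded[of _ "R\<^sup>2"]) (auto simp: \<rho>_def abs_le_iff)
  qed simp
  finally have E: "(\<integral>x. (w x)\<^sup>2 \<partial>M) \<le> L\<^sup>2 / m * R\<^sup>2" .
  have "(\<integral>x. max 0 (A - Rn_dist m p x) \<partial>M) \<le> (\<integral>x. 1 / (4 * d * L\<^sup>2) * (w x)\<^sup>2 \<partial>M)"
  proof (rule integral_mono)
    show "integrable M (\<lambda>x. max 0 (A - Rn_dist m p x))"
      by (rule integrable_bounded[of _ A]) (use A in auto)
    show "max 0 (A - Rn_dist m p x) \<le> 1 / (4 * d * L\<^sup>2) * (w x)\<^sup>2" for x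
      using pw[of x] by (simp add: power_divide)
  qed (use int in simp)
  also have "\<dots> = 1 / (4 * d * L\<^sup>2) * (\<integral>x. (w x)\<^sup>2 \<partial>M)" by simp
  also have "\<dots> \<le> 1 / (4 * d * L\<^sup>2) * (L\<^sup>2 / m * R\<^sup>2)"
    using E d by (intro mult_left_mono) auto
  also have "\<dots> = R\<^sup>2 / (4 * m * d)" using d L m by (simp add: field_simps)
  finally show ?thesis unfolding d_def L_def .
qed

end

section \<open>Ties have probability zero\<close>

text \<open>Fubini with the coordinate \<open>a\<close> integrated first.\<close>

lemma null_sets_PiM_section:
  assumes sf: "\<And>i. i \<in> I \<Longrightarrow> sigma_finite_measure (M i)" and I: "finite I" "a \<in> I"
    and S: "S \<in> sets (PiM I M)"
    and sec: "\<And>\<omega>. \<omega> \<in> space (PiM (I - {a}) M) \<Longrightarrow> emeasure (M a) {y \<in> space (M a). fun_upd \<omega> a y \<in> S} = 0"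
  shows "S \<in> null_sets (PiM I M)"
proof -
  \<comment> \<open>\<open>product_sigma_finite\<close> constrains the factors at every index, so
    those outside \<open>I\<close> are replaced by a trivial measure.\<close>
  define M' where "M' i = (if i \<in> I then M i else count_space {})" for i
  define J where "J = I - {a}"
  have J: "finite J" "a \<notin> J" "I = insert a J" using I unfolding J_def by auto
  have eqI: "PiM I M' = PiM I M" and eqJ: "PiM J M' = PiM J M"
    unfolding M'_def J_def by (intro PiM_cong; simp)+
  have Ma: "M' a = M a" unfolding M'_def using I by simp
  interpret product_sigma_finite M'
    by (rule product_sigma_finite.intro) (auto simp: M'_def sf sigma_finite_measure_count_space_finite)
  have S': "S \<in> sets (PiM (insert a J) M')" using S eqI J by simp
  have "emeasure (PiM I M) S = (\<integral>\<^sup>+ \<omega>. indicator S \<omega> \<partial>(PiM (insert a J) M'))"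
    using S' eqI J by simp
  also have "\<dots> = (\<integral>\<^sup>+ \<omega>. (\<integral>\<^sup>+ y. indicator S (fun_upd \<omega> a y) \<partial>(M' a)) \<partial>(PiM J M'))"
    using S' J by (intro product_nn_integral_insert) auto
  also have "\<dots> = (\<integral>\<^sup>+ \<omega>. 0 \<partial>(PiM J M'))"
  proof (rule nn_integral_cong)
    fix \<omega> assume \<omega>: "\<omega> \<in> space (PiM J M')"
    let ?N = "{y \<in> space (M a). fun_upd \<omega> a y \<in> S}"
    have "(\<lambda>y. fun_upd \<omega> a y) \<in> measurable (M' a) (PiM (insert a J) M')"
      using \<omega> by (intro measurable_fun_upd[where J = J]) auto
    from measurable_sets[OF this S'] have "?N \<in> sets (M a)"
      unfolding Ma by (simp add: vimage_def Int_def conj_commute)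
    moreover have "(\<integral>\<^sup>+ y. indicator S (fun_upd \<omega> a y) \<partial>(M' a)) = (\<integral>\<^sup>+ y. indicator ?N y \<partial>(M a))"
      unfolding Ma by (intro nn_integral_cong) (auto simp: indicator_def)
    ultimately show "(\<integral>\<^sup>+ y. indicator S (fun_upd \<omega> a y) \<partial>(M' a)) = 0"
      using sec[OF \<omega>[unfolded eqJ, unfolded J_def]] by simp
  qed
  finally show ?thesis using S by (simp add: null_setsI)
qed

text \<open>Strict convexity with denominators cleared. Squaring reduces it to the Cauchy-Schwarz
  inequality for the vectors (a - u, sqrt h) and (c - u, sqrt h), which is strict because they are
  not parallel: the defect is h (a - c)^2.\<close>

lemma hypot_strict_convex:
  fixes a b c u h :: real
  assumes "a < b" "b < c" "0 < h"
  shows "(c - a) * sqrt ((b - u)\<^sup>2 + h) < (c - b) * sqrt ((a - u)\<^sup>2 + h) + (b - a) * sqrt ((c - u)\<^sup>2 + h)"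
proof -
  define p q where "p = c - b" and "q = b - a"
  define A B where "A = sqrt ((a - u)\<^sup>2 + h)" and "B = sqrt ((c - u)\<^sup>2 + h)"
  have pq: "0 < p" "0 < q" using assms unfolding p_def q_def by auto
  have AB2: "A\<^sup>2 = (a - u)\<^sup>2 + h" "B\<^sup>2 = (c - u)\<^sup>2 + h" unfolding A_def B_def using assms by simp_all
  have AB0: "0 < A" "0 < B" unfolding A_def B_def using assms by (auto intro: add_nonneg_pos)
  have "((a - u) * (c - u) + h)\<^sup>2 < (A * B)\<^sup>2"
  proof -
    have "(A * B)\<^sup>2 - ((a - u) * (c - u) + h)\<^sup>2 = h * (a - c)\<^sup>2"
      unfolding power_mult_distrib AB2 by (simp add: power2_eq_square algebra_simps)
    moreover have "0 < h * (a - c)\<^sup>2" using assms by simp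
    ultimately show ?thesis by linarith
  qed
  then have "(a - u) * (c - u) + h < A * B"
    by (rule power_less_imp_less_base) (use AB0 in simp)
  then have "2 * p * q * ((a - u) * (c - u) + h) < 2 * p * q * (A * B)"
    using pq by simp
  moreover have "(p + q)\<^sup>2 * ((b - u)\<^sup>2 + h) = p\<^sup>2 * A\<^sup>2 + q\<^sup>2 * B\<^sup>2 + 2 * p * q * ((a - u) * (c - u) + h)"
    unfolding AB2 p_def q_def by (simp add: power2_eq_square algebra_simps)
  ultimately have "(p + q)\<^sup>2 * ((b - u)\<^sup>2 + h) < (p * A + q * B)\<^sup>2"
    by (simp add: power2_eq_square algebra_simps)
  moreover have "((p + q) * sqrt ((b - u)\<^sup>2 + h))\<^sup>2 = (p + q)\<^sup>2 * ((b - u)\<^sup>2 + h)"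
    using assms by (simp add: power_mult_distrib)
  ultimately have "((p + q) * sqrt ((b - u)\<^sup>2 + h))\<^sup>2 < (p * A + q * B)\<^sup>2" by simp
  then have "(p + q) * sqrt ((b - u)\<^sup>2 + h) < p * A + q * B"
    by (rule power_less_imp_less_base) (use pq AB0 in simp)
  then show ?thesis unfolding p_def q_def A_def B_def by simp
qed

text \<open>A strictly convex function takes no value three times.\<close>

lemma finite_level_sum_hypot:
  fixes u h :: "'a \<Rightarrow> real"
  assumes "finite Q" "Q \<noteq> {}" "\<And>q. q \<in> Q \<Longrightarrow> 0 < h q"
  shows "finite {\<tau>. (\<Sum>q\<in>Q. sqrt ((\<tau> - u q)\<^sup>2 + h q)) = \<kappa>}" (is "finite ?S")
proof -
  define F where "F \<tau> = (\<Sum>q\<in>Q. sqrt ((\<tau> - u q)\<^sup>2 + h q))" for \<tau>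
  have no3: False if abc: "a < b" "b < c" "F a = \<kappa>" "F b = \<kappa>" "F c = \<kappa>" for a b c
  proof -
    have "(\<Sum>q\<in>Q. (c - a) * sqrt ((b - u q)\<^sup>2 + h q)) <
      (\<Sum>q\<in>Q. (c - b) * sqrt ((a - u q)\<^sup>2 + h q) + (b - a) * sqrt ((c - u q)\<^sup>2 + h q))"
      using assms abc by (intro sum_strict_mono hypot_strict_convex) auto
    then have "(c - a) * F b < (c - b) * F a + (b - a) * F c"
      unfolding F_def by (simp add: sum.distrib sum_distrib_left)
    then show False using abc by (simp add: algebra_simps)
  qed
  show ?thesis
  proof (cases "\<exists>a c. a < c \<and> F a = \<kappa> \<and> F c = \<kappa>")
    case True
    then obtain a c where ac: "a < c" "F a = \<kappa>" "F c = \<kappa>" by blast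
    have "?S \<subseteq> {a, c}"
    proof
      fix x assume "x \<in> ?S"
      then have x: "F x = \<kappa>" unfolding F_def by simp
      have "\<not> x < a" "\<not> (a < x \<and> x < c)" "\<not> c < x"
        using no3[of x a c] no3[of a x c] no3[of a c x] ac x by blast+
      then show "x \<in> {a, c}" by auto
    qed
    then show ?thesis by (rule finite_subset) simp
  next
    case False
    then have *: "x = y" if "F x = \<kappa>" "F y = \<kappa>" for x y
      using that by (metis linorder_neqE)
    show ?thesis
    proof (cases "\<exists>x. F x = \<kappa>")
      case True
      then obtain x where "F x = \<kappa>" by blast
      then have "?S \<subseteq> {x}" using * unfolding F_def by blast
      then show ?thesis by (rule finite_subset) simp
    qed (simp add: F_def)
  qed
qed

text \<open>Off the null set where some \<open>w q\<close> agrees with the point in coordinate 1, the sum of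
  distances is strictly convex in coordinate 0.\<close>

lemma null_level_sum_dist:
  assumes m: "2 \<le> m" and Q: "finite Q" "Q \<noteq> {}"
  shows "{y \<in> Rn m. (\<Sum>q\<in>Q. Rn_dist m y (w q)) = \<kappa>} \<in> null_sets (Rn_lborel m)"
proof -
  let ?B = "Rn_lborel m"
  have sp: "space ?B = Rn m" by (simp add: space_PiM)
  have coord [measurable]: "(\<lambda>y. y i) \<in> borel_measurable ?B" if "i < m" for i
    using measurable_component_singleton[of i "{..<m}" "\<lambda>_. lborel"] that by simp
  have dist [measurable]: "(\<lambda>y. Rn_dist m y z) \<in> borel_measurable ?B" for z
    by (rule measurable_Rn_dist) (auto intro: coord)
  define N where "N q = {y \<in> Rn m. y 1 = w q 1}" for q
  have Nsets: "N q \<in> sets ?B" for q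
  proof -
    have "(\<lambda>y. y 1) -` {w q 1} \<inter> space ?B \<in> sets ?B"
      using m by (intro measurable_sets[OF coord]) auto
    moreover have "(\<lambda>y. y 1) -` {w q 1} \<inter> space ?B = N q" unfolding N_def sp by auto
    ultimately show ?thesis by simp
  qed
  have N: "N q \<in> null_sets ?B" for q
  proof (rule null_sets_PiM_section[where a = 1])
    fix \<omega> :: "nat \<Rightarrow> real"
    have "{y \<in> space lborel. fun_upd \<omega> 1 y \<in> N q} \<subseteq> {w q 1}" unfolding N_def by auto
    then show "emeasure lborel {y \<in> space lborel. fun_upd \<omega> 1 y \<in> N q} = 0"
      by (intro emeasure_lborel_countable countable_finite finite_subset[OF _ finite.insertI[OF finite.emptyI]])
  qed (use m Nsets in \<open>auto simp: sigma_finite_lborel\<close>)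
  define S where "S = {y \<in> Rn m. (\<Sum>q\<in>Q. Rn_dist m y (w q)) = \<kappa>} - (\<Union>q\<in>Q. N q)"
  have "{y \<in> space ?B. (\<Sum>q\<in>Q. Rn_dist m y (w q)) = \<kappa>} \<in> sets ?B" by measurable
  then have S: "S \<in> sets ?B" unfolding S_def sp using Q Nsets by (intro sets.Diff sets.finite_UN)
  have Snull: "S \<in> null_sets ?B"
  proof (rule null_sets_PiM_section[where a = 0])
    fix \<omega> :: "nat \<Rightarrow> real"
    have split: "{..<m} = insert 0 {1..<m}" using m by auto
    define h where "h q = (\<Sum>i\<in>{1..<m}. (\<omega> i - w q i)\<^sup>2)" for q
    have D: "Rn_dist m (fun_upd \<omega> 0 \<tau>) (w q) = sqrt ((\<tau> - w q 0)\<^sup>2 + h q)" for \<tau> q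
      unfolding Rn_dist_def L2_set_def h_def by (subst split) simp
    have "{\<tau> \<in> space lborel. fun_upd \<omega> 0 \<tau> \<in> S} \<subseteq>
       (if \<forall>q\<in>Q. 0 < h q then {\<tau>. (\<Sum>q\<in>Q. sqrt ((\<tau> - w q 0)\<^sup>2 + h q)) = \<kappa>} else {})"
    proof
      fix \<tau> assume "\<tau> \<in> {\<tau> \<in> space lborel. fun_upd \<omega> 0 \<tau> \<in> S}"
      then have \<tau>: "fun_upd \<omega> 0 \<tau> \<in> S" by simp
      have "0 < h q" if "q \<in> Q" for q
      proof -
        have "\<omega> 1 \<noteq> w q 1" using \<tau> that unfolding S_def N_def by auto
        then have "0 < (\<omega> 1 - w q 1)\<^sup>2" by simp
        also have "\<dots> \<le> h q" unfolding h_def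
          using m by (intro member_le_sum[of 1 "{1..<m}" "\<lambda>i. (\<omega> i - w q i)\<^sup>2"]) auto
        finally show ?thesis .
      qed
      then show "\<tau> \<in> (if \<forall>q\<in>Q. 0 < h q then {\<tau>. (\<Sum>q\<in>Q. sqrt ((\<tau> - w q 0)\<^sup>2 + h q)) = \<kappa>} else {})"
        using \<tau> unfolding S_def D[symmetric] by simp
    qed
    moreover have "finite (if \<forall>q\<in>Q. 0 < h q then {\<tau>. (\<Sum>q\<in>Q. sqrt ((\<tau> - w q 0)\<^sup>2 + h q)) = \<kappa>} else {})"
      using finite_level_sum_hypot[OF Q] by simp
    ultimately show "emeasure lborel {\<tau> \<in> space lborel. fun_upd \<omega> 0 \<tau> \<in> S} = 0"
      by (intro emeasure_lborel_countable countable_finite) (rule finite_subset)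
  qed (use m S in \<open>auto simp: sigma_finite_lborel\<close>)
  have "{y \<in> Rn m. (\<Sum>q\<in>Q. Rn_dist m y (w q)) = \<kappa>} \<subseteq> S \<union> (\<Union>q\<in>Q. N q)"
    unfolding S_def by auto
  moreover have "S \<union> (\<Union>q\<in>Q. N q) \<in> null_sets ?B"
    using Snull N Q by (intro null_sets.Un null_sets.finite_UN) auto
  moreover have "{y \<in> Rn m. (\<Sum>q\<in>Q. Rn_dist m y (w q)) = \<kappa>} \<in> sets ?B"
    using \<open>{y \<in> space ?B. (\<Sum>q\<in>Q. Rn_dist m y (w q)) = \<kappa>} \<in> sets ?B\<close> unfolding sp .
  ultimately show ?thesis by (rule null_sets_subset[rotated 2])
qed

lemma (in ball_prob) null_level_sum_dist_ball:
  assumes leb: "lebesgue_null_imp_null m c r M" and m: "2 \<le> m" and Q: "finite Q" "Q \<noteq> {}"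
  shows "emeasure M {y \<in> space M. (\<Sum>q\<in>Q. Rn_dist m y (w q)) = \<kappa>} = 0"
proof -
  let ?A = "{y \<in> space M. (\<Sum>q\<in>Q. Rn_dist m y (w q)) = \<kappa>}"
  let ?S = "{y \<in> Rn m. (\<Sum>q\<in>Q. Rn_dist m y (w q)) = \<kappa>}"
  have eq: "sets (Rn_lborel m) = sets (Rn_borel m)" by (intro sets_PiM_cong) auto
  have S: "?S \<in> null_sets (Rn_lborel m)" by (rule null_level_sum_dist[OF m Q])
  have A: "?A = ?S \<inter> Rn_cball m c r" unfolding space_M Rn_cball_def by auto
  have "?S \<inter> Rn_cball m c r \<in> null_sets (Rn_lborel m)"
    by (rule null_set_Int2[OF S]) (simp only: eq sets_Rn_cball)
  then show ?thesis
    using leb[unfolded lebesgue_null_imp_null_def, rule_format, of "?S \<inter> Rn_cball m c r"] unfolding A by simp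
qed

section \<open>The random sample\<close>

lemma indep_vars_PiM_components:
  assumes M: "\<And>i. i \<in> I \<Longrightarrow> prob_space (M i)" and I: "I \<noteq> {}"
  shows "prob_space.indep_vars (PiM I M) M (\<lambda>i \<omega>. \<omega> i) I"
proof -
  interpret P: prob_space "PiM I M" by (rule prob_space_PiM) (rule M)
  have "distr (PiM I M) (PiM I M) (\<lambda>x. \<lambda>i\<in>I. x i) = distr (PiM I M) (PiM I M) (\<lambda>x. x)"
    by (rule distr_cong) (auto simp: space_PiM PiE_def extensional_def fun_eq_iff)
  also have "\<dots> = PiM I M" by simp
  also have "\<dots> = PiM I (\<lambda>i. distr (PiM I M) (M i) (\<lambda>\<omega>. \<omega> i))"
    by (intro PiM_cong refl distr_PiM_component[symmetric] M)
  finally show ?thesis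
    by (subst P.indep_vars_iff_distr_eq_PiM'[OF I]) simp_all
qed

text \<open>Hoeffding's inequality for those coordinates of a product that share the law
  \<open>N\<close>; the remaining factors, here the other balls, may differ.\<close>

lemma PiM_average_tail:
  fixes f :: "'a \<Rightarrow> real" and \<eta> :: real
  assumes M: "\<And>i. i \<in> I \<Longrightarrow> prob_space (M i)" and J: "finite J" "J \<subseteq> I" "J \<noteq> {}"
    and N: "\<And>i. i \<in> J \<Longrightarrow> M i = N" and f: "f \<in> borel_measurable N"
    and B: "\<And>x. x \<in> space N \<Longrightarrow> f x \<in> {0..B}" "0 < B" and \<eta>: "0 \<le> \<eta>"
  shows "measure (PiM I M) {\<omega> \<in> space (PiM I M). \<bar>(\<Sum>i\<in>J. f (\<omega> i)) / card J - (\<integral>x. f x \<partial>N)\<bar> \<ge> \<eta>}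
    \<le> 2 * exp (- (2 * real (card J) * \<eta>\<^sup>2 / B\<^sup>2))"
proof -
  interpret P: prob_space "PiM I M" by (rule prob_space_PiM) (rule M)
  obtain a where a: "a \<in> J" using J by blast
  have comp: "distr (PiM I M) N (\<lambda>\<omega>. \<omega> i) = N" if "i \<in> J" for i
    using distr_PiM_component[of I M i, OF M] N[OF that] that J by auto
  have rv: "(\<lambda>\<omega>. \<omega> i) \<in> measurable (PiM I M) N" if "i \<in> J" for i
    using measurable_component_singleton[of i I M] N[OF that] that J by auto
  have fd: "distr (PiM I M) borel (\<lambda>\<omega>. f (\<omega> i)) = distr N borel f" if "i \<in> J" for i
    using distr_distr[OF f rv[OF that]] comp[OF that] by (simp add: comp_def)
  have rvf: "(\<lambda>\<omega>. f (\<omega> i)) \<in> borel_measurable (PiM I M)" if "i \<in> J" for i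
    using measurable_compose[OF rv[OF that] f] .
  have "P.indep_vars M (\<lambda>i \<omega>. \<omega> i) J"
    using P.indep_vars_subset[OF indep_vars_PiM_components[OF M] J(2)] J by auto
  then have ind: "P.indep_vars (\<lambda>_. borel) (\<lambda>i \<omega>. f (\<omega> i)) J"
    by (rule P.indep_vars_compose2) (use N f in auto)
  interpret H: Hoeffding_ineq_iid "PiM I M" J "\<lambda>i \<omega>. f (\<omega> i)" "\<lambda>\<omega>. f (\<omega> a)" 0 B "P.expectation (\<lambda>\<omega>. f (\<omega> a))"
  proof unfold_locales
    show "AE x in PiM I M. f (x a) \<in> {0..B}"
      using measurable_space[OF rv[OF a]] B by (intro AE_I2) auto
  qed (use J ind fd rvf a in auto)
  have "P.expectation (\<lambda>\<omega>. f (\<omega> a)) = (\<integral>x. f x \<partial>N)"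
    using integral_distr[OF rv[OF a] f] comp[OF a] by simp
  then show ?thesis using H.Hoeffding_ineq_abs_ge'[OF \<eta> B(2) J(3)] by simp
qed

section \<open>Probability space of the draws\<close>

locale ball_model =
  fixes m k :: nat and c :: "nat \<Rightarrow> nat \<Rightarrow> real" and \<rho> :: "nat \<Rightarrow> real"
    and \<mu> :: "nat \<Rightarrow> (nat \<Rightarrow> real) measure" and b :: "nat \<Rightarrow> real"
  assumes esbm: "esbm m k c \<rho> \<mu> b"
    and m2: "2 \<le> m"
    and rot: "\<And>i. i \<in> {1..k} \<Longrightarrow> rotation_invariant m (c i) (\<mu> i)"
    and pos: "\<And>i. i \<in> {1..k} \<Longrightarrow> positive_near_center m (c i) (\<rho> i) (\<mu> i)"
    and leb: "\<And>i. i \<in> {1..k} \<Longrightarrow> lebesgue_null_imp_null m (c i) (\<rho> i) (\<mu> i)"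
    and sep: "\<And>i j. i \<in> {1..k} \<Longrightarrow> j \<in> {1..k} \<Longrightarrow> i \<noteq> j \<Longrightarrow> \<rho> i + \<rho> j < Rn_dist m (c i) (c j)"
begin

lemma ball_probI: "i \<in> {1..k} \<Longrightarrow> ball_prob (\<mu> i) m (c i) (\<rho> i)"
  using esbm unfolding esbm_def ball_prob_def ball_prob_axioms_def by blast

lemma prob_mu: "i \<in> {1..k} \<Longrightarrow> prob_space (\<mu> i)"
  using ball_probI by (simp add: ball_prob_def)

lemma b_ge_1: "i \<in> {1..k} \<Longrightarrow> 1 \<le> b i"
  using esbm unfolding esbm_def by blast

lemma rho_pos: "i \<in> {1..k} \<Longrightarrow> 0 < \<rho> i"
  using esbm unfolding esbm_def by blast

lemma center_in_Rn: "i \<in> {1..k} \<Longrightarrow> c i \<in> Rn m"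
  using esbm unfolding esbm_def by blast

lemma center_in_ball: "i \<in> {1..k} \<Longrightarrow> c i \<in> Rn_cball m (c i) (\<rho> i)"
  using center_in_Rn rho_pos unfolding Rn_cball_def by (simp add: less_imp_le)

text \<open>Clusters consist of indices of draws instead of points: they are disjoint and of known
  size on every sample, even when draws coincide.\<close>

definition cluster :: "nat \<Rightarrow> nat \<Rightarrow> (nat \<times> nat) set" where
  "cluster n i = Pair i ` {1..sample_size b n i}"

definition idx :: "nat \<Rightarrow> (nat \<times> nat) set" where
  "idx n = (SIGMA i:{1..k}. {1..sample_size b n i})"

abbreviation "Om n \<equiv> esbm_sample k \<mu> b n"

lemma Om_eq: "Om n = PiM (idx n) (\<lambda>a. \<mu> (fst a))"
  unfolding esbm_sample_def idx_def by (simp add: case_prod_beta')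

lemma finite_idx: "finite (idx n)" unfolding idx_def by auto

lemma finite_cluster: "finite (cluster n i)" unfolding cluster_def by auto

lemma card_cluster: "card (cluster n i) = sample_size b n i"
  unfolding cluster_def by (simp add: card_image inj_on_def)

lemma idx_eq: "idx n = (\<Union>i\<in>{1..k}. cluster n i)"
  unfolding idx_def cluster_def by auto

lemma cluster_iff: "i \<in> {1..k} \<Longrightarrow> a \<in> cluster n i \<longleftrightarrow> a \<in> idx n \<and> fst a = i"
  unfolding idx_def cluster_def by auto

lemma drawn_points_eq: "drawn_points b n \<omega> i = \<omega> ` cluster n i"
  unfolding drawn_points_def cluster_def by (simp add: image_image)

lemma fst_idx: "a \<in> idx n \<Longrightarrow> fst a \<in> {1..k}"
  unfolding idx_def by auto

lemma prob_space_Om: "prob_space (Om n)"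
  unfolding Om_eq using fst_idx prob_mu by (intro prob_space_PiM) blast

lemma measurable_point: "a \<in> idx n \<Longrightarrow> (\<lambda>\<omega>. \<omega> a) \<in> measurable (Om n) (\<mu> (fst a))"
  unfolding Om_eq by (rule measurable_component_singleton)

lemma point_in_ball:
  assumes "\<omega> \<in> space (Om n)" "a \<in> idx n"
  shows "\<omega> a \<in> Rn_cball m (c (fst a)) (\<rho> (fst a))"
  using measurable_space[OF measurable_point[OF assms(2)] assms(1)]
    ball_prob.space_M[OF ball_probI[OF fst_idx[OF assms(2)]]] by simp

lemma point_in_Rn: "\<omega> \<in> space (Om n) \<Longrightarrow> a \<in> idx n \<Longrightarrow> \<omega> a \<in> Rn m"
  using point_in_ball unfolding Rn_cball_def by blast

lemma measurable_point_coord: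
  assumes "a \<in> idx n" "i < m"
  shows "(\<lambda>\<omega>. \<omega> a i) \<in> borel_measurable (Om n)"
  using measurable_compose[OF measurable_point[OF assms(1)]
      ball_prob.measurable_coord[OF ball_probI[OF fst_idx[OF assms(1)]] assms(2)]] .

lemma measurable_point_dist:
  "a \<in> idx n \<Longrightarrow> a' \<in> idx n \<Longrightarrow> (\<lambda>\<omega>. Rn_dist m (\<omega> a) (\<omega> a')) \<in> borel_measurable (Om n)"
  by (intro measurable_Rn_dist measurable_point_coord)

lemma Rn_dist_eq_0_iff: "x \<in> Rn m \<Longrightarrow> y \<in> Rn m \<Longrightarrow> Rn_dist m x y = 0 \<longleftrightarrow> x = y"
  unfolding Rn_dist_def by (auto simp: L2_set_eq_0_iff intro: PiE_ext)

lemma sets_points_eq: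
  assumes "a \<in> idx n" "a' \<in> idx n"
  shows "{\<omega> \<in> space (Om n). \<omega> a = \<omega> a'} \<in> sets (Om n)"
proof -
  have "{\<omega> \<in> space (Om n). \<omega> a = \<omega> a'} = {\<omega> \<in> space (Om n). Rn_dist m (\<omega> a) (\<omega> a') = 0}"
    using Rn_dist_eq_0_iff point_in_Rn assms by blast
  moreover have "\<dots> \<in> sets (Om n)"
    using measurable_point_dist[OF assms] by measurable
  ultimately show ?thesis by simp
qed

lemma cluster_unique:
  assumes "\<omega> \<in> space (Om n)" "a \<in> idx n" "a' \<in> idx n" "\<omega> a = \<omega> a'"
  shows "fst a = fst a'"
proof (rule ccontr)
  assume ne: "fst a \<noteq> fst a'"
  have "Rn_dist m (c (fst a)) (\<omega> a) \<le> \<rho> (fst a)" "Rn_dist m (c (fst a')) (\<omega> a) \<le> \<rho> (fst a')"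
    using point_in_ball[OF assms(1,2)] point_in_ball[OF assms(1,3)] assms(4) unfolding Rn_cball_def by auto
  moreover have "Rn_dist m (c (fst a)) (c (fst a')) \<le> Rn_dist m (c (fst a)) (\<omega> a) + Rn_dist m (\<omega> a) (c (fst a'))"
    by (rule Rn_dist_triangle)
  ultimately show False
    using sep[OF fst_idx[OF assms(2)] fst_idx[OF assms(3)] ne] by (simp add: Rn_dist_commute)
qed

text \<open>Coinciding draws are treated by splitting according to a set \<open>S\<close> of indices that
  represents every drawn point exactly once.\<close>

lemma sets_exact_recovery:
  "{\<omega> \<in> space (Om n). exact_recovery (Rn_dist m) k (drawn_points b n \<omega>)} \<in> sets (Om n)"
proof -
  define Rep where "Rep S = {\<omega> \<in> space (Om n). inj_on \<omega> S \<and> \<omega> ` S = \<omega> ` idx n}" for S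
  define Rec where "Rec S = {\<omega> \<in> space (Om n).
    exact_recovery (\<lambda>a a'. Rn_dist m (\<omega> a) (\<omega> a')) k (\<lambda>i. S \<inter> cluster n i)}" for S
  have Rep: "Rep S \<in> sets (Om n)" if S: "S \<subseteq> idx n" for S
  proof -
    have "Rep S = {\<omega> \<in> space (Om n). \<forall>a\<in>S. \<forall>a'\<in>S. \<omega> a = \<omega> a' \<longrightarrow> a = a'} \<inter>
        {\<omega> \<in> space (Om n). \<forall>a\<in>idx n. \<exists>a'\<in>S. \<omega> a = \<omega> a'}"
      unfolding Rep_def inj_on_def using S by blast
    moreover have "{\<omega> \<in> space (Om n). \<forall>a\<in>S. \<forall>a'\<in>S. \<omega> a = \<omega> a' \<longrightarrow> a = a'} \<in> sets (Om n)"
      using S finite_idx[of n]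
      by (intro sets.sets_Collect_finite_All sets.sets_Collect_imp sets.sets_Collect_const sets_points_eq)
        (auto intro: finite_subset)
    moreover have "{\<omega> \<in> space (Om n). \<forall>a\<in>idx n. \<exists>a'\<in>S. \<omega> a = \<omega> a'} \<in> sets (Om n)"
      using S finite_idx[of n]
      by (intro sets.sets_Collect_finite_All sets.sets_Collect_finite_Ex sets_points_eq)
        (auto intro: finite_subset)
    ultimately show ?thesis by simp
  qed
  have Rec: "Rec S \<in> sets (Om n)" if S: "S \<subseteq> idx n" for S
  proof -
    \<comment> \<open>Distances outside \<open>S\<close> are replaced by 0, so that every coordinate
      of \<open>\<Phi>\<close> is measurable.\<close>
    define \<Phi> where "\<Phi> \<omega> = (\<lambda>x. if fst x \<in> S \<and> snd x \<in> S then Rn_dist m (\<omega> (fst x)) (\<omega> (snd x)) else 0)"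
      for \<omega> :: "nat \<times> nat \<Rightarrow> nat \<Rightarrow> real"
    have "\<Phi> \<in> measurable (Om n) borel"
    proof (rule measurable_coordinatewise_then_product)
      fix x
      show "(\<lambda>\<omega>. \<Phi> \<omega> x) \<in> borel_measurable (Om n)"
        using measurable_point_dist[of "fst x" n "snd x"] S unfolding \<Phi>_def
        by (cases "fst x \<in> S \<and> snd x \<in> S") auto
    qed
    then have "\<Phi> -` {D. exact_recovery (\<lambda>p q. D (p, q)) k (\<lambda>i. S \<inter> cluster n i)} \<inter> space (Om n) \<in> sets (Om n)"
      using borel_exact_recovery[where k = k and A = "\<lambda>i. S \<inter> cluster n i"] finite_cluster by (intro measurable_sets) auto
    moreover have "exact_recovery (\<lambda>p q. \<Phi> \<omega> (p, q)) k (\<lambda>i. S \<inter> cluster n i) \<longleftrightarrow>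
        exact_recovery (\<lambda>a a'. Rn_dist m (\<omega> a) (\<omega> a')) k (\<lambda>i. S \<inter> cluster n i)" for \<omega>
      by (rule exact_recovery_cong) (auto simp: \<Phi>_def)
    ultimately show ?thesis unfolding Rec_def by (simp add: vimage_def Int_def conj_commute)
  qed
  have eq: "exact_recovery (Rn_dist m) k (drawn_points b n \<omega>) \<longleftrightarrow> \<omega> \<in> Rec S"
    if S: "S \<subseteq> idx n" and \<omega>: "\<omega> \<in> Rep S" for \<omega> S
  proof -
    have sp: "\<omega> \<in> space (Om n)" "inj_on \<omega> S" "\<omega> ` S = \<omega> ` idx n" using \<omega> unfolding Rep_def by auto
    have U: "(\<Union>i\<in>{1..k}. S \<inter> cluster n i) = S" using S unfolding idx_eq by blast
    have dp: "drawn_points b n \<omega> i = \<omega> ` (S \<inter> cluster n i)" if i: "i \<in> {1..k}" for i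
      unfolding drawn_points_eq
    proof (rule equalityI; rule subsetI)
      fix x assume "x \<in> \<omega> ` cluster n i"
      then obtain a where a: "a \<in> cluster n i" "x = \<omega> a" by blast
      then have ai: "a \<in> idx n" "fst a = i" using cluster_iff[OF i] by auto
      then obtain s where s: "s \<in> S" "\<omega> a = \<omega> s" using sp(3) by blast
      \<comment> \<open>Since the balls are disjoint, the representative of a draw comes from the
        same ball.\<close>
      then have "fst s = i" using cluster_unique[OF sp(1) ai(1), of s] S ai by auto
      then have "s \<in> cluster n i" using cluster_iff[OF i] s S by auto
      then show "x \<in> \<omega> ` (S \<inter> cluster n i)" using s a by blast
    qed auto
    have "exact_recovery (Rn_dist m) k (drawn_points b n \<omega>) \<longleftrightarrow>
        exact_recovery (Rn_dist m) k (\<lambda>i. \<omega> ` (S \<inter> cluster n i))"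
      by (rule exact_recovery_cong[OF dp]) simp_all
    also have "\<dots> \<longleftrightarrow> exact_recovery (\<lambda>a a'. Rn_dist m (\<omega> a) (\<omega> a')) k (\<lambda>i. S \<inter> cluster n i)"
      by (rule exact_recovery_image_iff) (simp only: U sp(2))
    finally show ?thesis unfolding Rec_def using sp(1) by simp
  qed
  have ex: "\<exists>S\<subseteq>idx n. \<omega> \<in> Rep S" if "\<omega> \<in> space (Om n)" for \<omega>
  proof -
    obtain S where "S \<subseteq> idx n" "inj_on \<omega> S" "\<omega> ` idx n = \<omega> ` S"
      using subset_image_inj[of "\<omega> ` idx n" \<omega> "idx n"] by blast
    then show ?thesis using that unfolding Rep_def by blast
  qed
  have "{\<omega> \<in> space (Om n). exact_recovery (Rn_dist m) k (drawn_points b n \<omega>)} =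
      (\<Union>S\<in>Pow (idx n). Rep S \<inter> Rec S)"
  proof (rule equalityI; rule subsetI)
    fix \<omega> assume "\<omega> \<in> {\<omega> \<in> space (Om n). exact_recovery (Rn_dist m) k (drawn_points b n \<omega>)}"
    then show "\<omega> \<in> (\<Union>S\<in>Pow (idx n). Rep S \<inter> Rec S)" using ex[of \<omega>] eq by blast
  next
    fix \<omega> assume "\<omega> \<in> (\<Union>S\<in>Pow (idx n). Rep S \<inter> Rec S)"
    then show "\<omega> \<in> {\<omega> \<in> space (Om n). exact_recovery (Rn_dist m) k (drawn_points b n \<omega>)}"
      using eq unfolding Rec_def by blast
  qed
  moreover have "(\<Union>S\<in>Pow (idx n). Rep S \<inter> Rec S) \<in> sets (Om n)"
    using finite_idx Rep Rec by (intro sets.finite_UN sets.Int) auto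
  ultimately show ?thesis by simp
qed

lemma null_sum_dist_tie:
  assumes a: "a \<in> idx n" and Q: "Q \<subseteq> idx n - {a}" "Q \<noteq> {}"
    and S: "S \<in> sets (Om n)"
    and sub: "\<And>\<omega> y. \<omega> \<in> space (PiM (idx n - {a}) (\<lambda>a. \<mu> (fst a))) \<Longrightarrow> y \<in> space (\<mu> (fst a)) \<Longrightarrow>
        fun_upd \<omega> a y \<in> S \<Longrightarrow> (\<Sum>q\<in>Q. Rn_dist m y (\<omega> q)) = \<kappa> \<omega>"
  shows "AE \<omega> in Om n. \<omega> \<notin> S"
proof -
  have ai: "fst a \<in> {1..k}" using fst_idx[OF a] .
  interpret B: ball_prob "\<mu> (fst a)" m "c (fst a)" "\<rho> (fst a)" by (rule ball_probI[OF ai])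
  have finQ: "finite Q" using Q finite_idx[of n] by (meson finite_Diff finite_subset)
  have "S \<in> null_sets (PiM (idx n) (\<lambda>a. \<mu> (fst a)))"
  proof (rule null_sets_PiM_section[where a = a])
    fix \<omega> assume \<omega>: "\<omega> \<in> space (PiM (idx n - {a}) (\<lambda>a. \<mu> (fst a)))"
    let ?N = "{y \<in> space (\<mu> (fst a)). (\<Sum>q\<in>Q. Rn_dist m y (\<omega> q)) = \<kappa> \<omega>}"
    have "emeasure (\<mu> (fst a)) {y \<in> space (\<mu> (fst a)). fun_upd \<omega> a y \<in> S} \<le> emeasure (\<mu> (fst a)) ?N"
    proof (rule emeasure_mono)
      show "{y \<in> space (\<mu> (fst a)). fun_upd \<omega> a y \<in> S} \<subseteq> ?N" using sub[OF \<omega>] by blast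
      have "(\<lambda>y. \<Sum>q\<in>Q. Rn_dist m (\<omega> q) y) \<in> borel_measurable (\<mu> (fst a))" by measurable
      then have "(\<lambda>y. \<Sum>q\<in>Q. Rn_dist m y (\<omega> q)) \<in> borel_measurable (\<mu> (fst a))"
        by (simp add: Rn_dist_commute[of m "\<omega> q" for q])
      then show "?N \<in> sets (\<mu> (fst a))" by measurable
    qed
    also have "\<dots> = 0"
      by (rule B.null_level_sum_dist_ball[OF leb[OF ai] m2 finQ Q(2)])
    finally show "emeasure (\<mu> (fst a)) {y \<in> space (\<mu> (fst a)). fun_upd \<omega> a y \<in> S} = 0" by simp
  qed (use S a finite_idx prob_mu fst_idx in \<open>auto simp: Om_eq prob_space_imp_sigma_finite\<close>)
  then show ?thesis unfolding Om_eq by (rule AE_not_in)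
qed

lemma AE_points_distinct: "AE \<omega> in Om n. inj_on \<omega> (idx n)"
proof -
  have "AE \<omega> in Om n. \<omega> a \<noteq> \<omega> a'" if "a \<in> idx n" "a' \<in> idx n" "a \<noteq> a'" for a a'
  proof -
    \<comment> \<open>A coincidence is level 0 of the distance to the single point
      \<open>\<omega> a'\<close>.\<close>
    have "AE \<omega> in Om n. \<omega> \<notin> {\<omega> \<in> space (Om n). \<omega> a = \<omega> a'}"
      using that by (intro null_sum_dist_tie[where a = a and Q = "{a'}" and \<kappa> = "\<lambda>_. 0"] sets_points_eq) auto
    then show ?thesis by (auto elim!: AE_mp)
  qed
  then have "AE \<omega> in Om n. \<forall>a\<in>idx n. \<forall>a'\<in>idx n. a \<noteq> a' \<longrightarrow> \<omega> a \<noteq> \<omega> a'"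
    using finite_idx by (intro AE_finite_allI) auto
  then show ?thesis by (rule AE_mp) (auto simp: inj_on_def)
qed

definition total_dist :: "nat \<Rightarrow> (nat \<times> nat \<Rightarrow> nat \<Rightarrow> real) \<Rightarrow> nat \<times> nat \<Rightarrow> real" where
  "total_dist n \<omega> a = (\<Sum>q\<in>cluster n (fst a). Rn_dist m (\<omega> a) (\<omega> q))"

text \<open>The mutual distance of \<open>a\<close> and \<open>a'\<close> occurs in both totals and
  cancels. A third draw is needed so that a nonempty sum of distances from the draw \<open>a\<close>
  remains; the total of \<open>a'\<close> over the same draws is a constant level.\<close>

lemma AE_medoid_unique:
  assumes n: "\<And>i. i \<in> {1..k} \<Longrightarrow> 3 \<le> sample_size b n i"
  shows "AE \<omega> in Om n. \<forall>i\<in>{1..k}. inj_on (total_dist n \<omega>) (cluster n i)"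
proof -
  have "AE \<omega> in Om n. total_dist n \<omega> a \<noteq> total_dist n \<omega> a'"
    if i: "i \<in> {1..k}" and aa: "a \<in> cluster n i" "a' \<in> cluster n i" "a \<noteq> a'" for i a a'
  proof -
    have ai: "a \<in> idx n" "a' \<in> idx n" "fst a = i" "fst a' = i" using aa cluster_iff[OF i] by auto
    define Q where "Q = cluster n i - {a, a'}"
    have "card Q = sample_size b n i - 2"
      unfolding Q_def using aa finite_cluster by (simp add: card_Diff_subset card_cluster)
    then have Qne: "Q \<noteq> {}" using n[OF i] by auto
    have Qsub: "Q \<subseteq> idx n - {a}" unfolding Q_def using cluster_iff[OF i] by auto
    have meas: "(\<lambda>\<omega>. total_dist n \<omega> e) \<in> borel_measurable (Om n)" if "e \<in> cluster n i" for e
      unfolding total_dist_def using that cluster_iff[OF i]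
      by (intro borel_measurable_sum measurable_point_dist) auto
    have spl: "(\<Sum>q\<in>cluster n i. g q) = g a + g a' + (\<Sum>q\<in>Q. g q)" for g :: "nat \<times> nat \<Rightarrow> real"
      unfolding Q_def using aa finite_cluster[of n i]
      by (subst sum.remove[of _ a], simp, simp, subst sum.remove[of _ a']) (auto simp: insert_commute Diff_insert2[symmetric])
    have "AE \<omega> in Om n. \<omega> \<notin> {\<omega> \<in> space (Om n). total_dist n \<omega> a = total_dist n \<omega> a'}"
    proof (rule null_sum_dist_tie[where a = a and Q = Q and \<kappa> = "\<lambda>\<omega>. \<Sum>q\<in>Q. Rn_dist m (\<omega> a') (\<omega> q)"])
      show "{\<omega> \<in> space (Om n). total_dist n \<omega> a = total_dist n \<omega> a'} \<in> sets (Om n)"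
        using meas[OF aa(1)] meas[OF aa(2)] by measurable
      fix \<omega> :: "nat \<times> nat \<Rightarrow> nat \<Rightarrow> real" and y
      assume S: "fun_upd \<omega> a y \<in> {\<omega> \<in> space (Om n). total_dist n \<omega> a = total_dist n \<omega> a'}"
      have Qa: "q \<noteq> a" if "q \<in> Q" for q using that unfolding Q_def by auto
      have "total_dist n (fun_upd \<omega> a y) a = Rn_dist m y (\<omega> a') + (\<Sum>q\<in>Q. Rn_dist m y (\<omega> q))"
        unfolding total_dist_def ai spl using aa Qa by simp
      moreover have "total_dist n (fun_upd \<omega> a y) a' = Rn_dist m (\<omega> a') y + (\<Sum>q\<in>Q. Rn_dist m (\<omega> a') (\<omega> q))"
        unfolding total_dist_def ai spl using aa Qa by simp
      ultimately show "(\<Sum>q\<in>Q. Rn_dist m y (\<omega> q)) = (\<Sum>q\<in>Q. Rn_dist m (\<omega> a') (\<omega> q))"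
        using S by (simp add: Rn_dist_commute[of m y "\<omega> a'"])
    qed (use ai Qsub Qne in auto)
    then show ?thesis by (auto elim!: AE_mp)
  qed
  then have "AE \<omega> in Om n. \<forall>i\<in>{1..k}. \<forall>a\<in>cluster n i. \<forall>a'\<in>cluster n i. a \<noteq> a' \<longrightarrow> total_dist n \<omega> a \<noteq> total_dist n \<omega> a'"
    using finite_cluster by (intro AE_finite_allI) auto
  then show ?thesis by (rule AE_mp) (auto simp: inj_on_def)
qed

lemma sample_size_ge: "i \<in> {1..k} \<Longrightarrow> n \<le> sample_size b n i"
  using b_ge_1[of i] mult_right_mono[of 1 "b i" "real n"] unfolding sample_size_def
  by (simp add: le_nat_floor le_nat_iff le_floor_iff)

lemma sample_average_tail:
  fixes f :: "(nat \<Rightarrow> real) \<Rightarrow> real" and \<eta> \<delta> :: real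
  assumes i: "i \<in> {1..k}" and f: "f \<in> borel_measurable (\<mu> i)"
    and B: "\<And>x. x \<in> space (\<mu> i) \<Longrightarrow> f x \<in> {0..B}" "0 < B" and \<eta>: "0 < \<eta>" and \<delta>: "0 < \<delta>"
  shows "\<exists>N. \<forall>n\<ge>N. measure (Om n) {\<omega> \<in> space (Om n).
    \<bar>(\<Sum>a\<in>cluster n i. f (\<omega> a)) / sample_size b n i - (\<integral>x. f x \<partial>\<mu> i)\<bar> \<ge> \<eta>} < \<delta>"
proof -
  define t where "t = 2 * \<eta>\<^sup>2 / B\<^sup>2"
  have t: "0 < t" unfolding t_def using \<eta> B(2) by simp
  \<comment> \<open>Every cluster has at least \<open>n\<close> draws, so the tail is at most 2 exp
    (-t n) \<le> 2 / (1 + t n), which is below \<open>\<delta>\<close> for n beyond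
    \<open>N\<close>.\<close>
  obtain N :: nat where N: "2 / (\<delta> * t) < real N" using reals_Archimedean2 by blast
  have "measure (Om n) {\<omega> \<in> space (Om n).
      \<bar>(\<Sum>a\<in>cluster n i. f (\<omega> a)) / sample_size b n i - (\<integral>x. f x \<partial>\<mu> i)\<bar> \<ge> \<eta>} < \<delta>" if n: "n \<ge> Suc N" for n
  proof -
    have sn: "n \<le> sample_size b n i" by (rule sample_size_ge[OF i])
    have "measure (Om n) {\<omega> \<in> space (Om n).
      \<bar>(\<Sum>a\<in>cluster n i. f (\<omega> a)) / sample_size b n i - (\<integral>x. f x \<partial>\<mu> i)\<bar> \<ge> \<eta>}
      \<le> 2 * exp (- (2 * real (card (cluster n i)) * \<eta>\<^sup>2 / B\<^sup>2))"
      unfolding Om_eq card_cluster[symmetric, of n i]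
    proof (rule PiM_average_tail[where N = "\<mu> i" and J = "cluster n i" and I = "idx n" and M = "\<lambda>a. \<mu> (fst a)" and f = f and B = B and \<eta> = \<eta>])
      show "cluster n i \<noteq> {}" using sn n card_cluster[of n i] by auto
    qed (use prob_mu fst_idx finite_cluster cluster_iff[OF i] f B \<eta> in auto)
    also have "\<dots> = 2 * exp (- (t * real (sample_size b n i)))"
      unfolding t_def card_cluster by (simp add: field_simps)
    also have "\<dots> \<le> 2 * exp (- (t * real n))" using sn t by simp
    also have "\<dots> \<le> 2 * (1 / (1 + t * n))"
    proof -
      have "1 / exp (t * n) \<le> 1 / (1 + t * n)"
        using exp_ge_add_one_self[of "t * n"] t by (intro divide_left_mono) (auto intro!: mult_pos_pos add_pos_nonneg)
      then show ?thesis by (simp add: exp_minus inverse_eq_divide)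
    qed
    also have "\<dots> < \<delta>"
    proof -
      have "2 < \<delta> * t * real N" using N \<delta> t by (simp add: field_simps)
      also have "\<dots> \<le> \<delta> * t * real n" using n \<delta> t by (intro mult_left_mono) auto
      finally have "2 < \<delta> * (1 + t * n)" using \<delta> by (simp add: algebra_simps)
      moreover have "0 < 1 + t * n" using t by (simp add: add_pos_nonneg)
      ultimately show ?thesis by (simp add: field_simps)
    qed
    finally show ?thesis .
  qed
  then show ?thesis by blast
qed

end

section \<open>Finite nets and simultaneous averages\<close>

lemma finite_net_Rn_cball:
  assumes h: "0 < h"
  shows "\<exists>F. finite F \<and> (\<forall>p\<in>Rn_cball m c r. \<exists>p'\<in>F. Rn_dist m p p' \<le> h)"
proof -
  \<comment> \<open>Coordinate errors of at most \<open>g\<close> sum to at most \<open>h\<close>;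
    the denominator m + 1 also covers m = 0.\<close>
  define g where "g = h / (m + 1)"
  have g: "0 < g" unfolding g_def using h by (simp add: add_nonneg_pos)
  define F where "F = (\<Pi>\<^sub>E i\<in>{..<m}. (\<lambda>z. c i + g * of_int z) ` {\<lfloor>- r / g\<rfloor>..\<lfloor>r / g\<rfloor>})"
  have "finite F" unfolding F_def by (intro finite_PiE) auto
  moreover have "\<exists>p'\<in>F. Rn_dist m p p' \<le> h" if p: "p \<in> Rn_cball m c r" for p
  proof -
    define p' where "p' = (\<lambda>i\<in>{..<m}. c i + g * of_int \<lfloor>(p i - c i) / g\<rfloor>)"
    have "p' \<in> F"
      unfolding F_def p'_def
    proof (rule restrict_PiE_iff[THEN iffD2], rule ballI)
      fix i assume "i \<in> {..<m}"
      then have "\<bar>p i - c i\<bar> \<le> r"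
        using abs_coord_le_Rn_dist[of i m c p] p unfolding Rn_cball_def by (auto simp: abs_minus_commute)
      then have "\<lfloor>(p i - c i) / g\<rfloor> \<in> {\<lfloor>- r / g\<rfloor>..\<lfloor>r / g\<rfloor>}"
        using g by (auto intro!: floor_mono divide_right_mono simp only: atLeastAtMost_iff)
      then show "c i + g * of_int \<lfloor>(p i - c i) / g\<rfloor> \<in> (\<lambda>z. c i + g * of_int z) ` {\<lfloor>- r / g\<rfloor>..\<lfloor>r / g\<rfloor>}"
        by blast
    qed
    moreover have "\<bar>p i - p' i\<bar> \<le> g" if "i < m" for i
    proof -
      define z where "z = (p i - c i) / g"
      have "p i = c i + g * z" unfolding z_def using g by simp
      then have "p i - p' i = g * (z - of_int \<lfloor>z\<rfloor>)"
        using that unfolding p'_def z_def[symmetric] by (simp add: right_diff_distrib)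
      moreover have "0 \<le> z - of_int \<lfloor>z\<rfloor>" "z - of_int \<lfloor>z\<rfloor> \<le> 1" by linarith+
      ultimately show ?thesis using g by (simp add: abs_mult mult_le_cancel_left1)
    qed
    then have "Rn_dist m p p' \<le> (\<Sum>i<m. g)"
      unfolding Rn_dist_def by (intro order_trans[OF L2_set_le_sum_abs] sum_mono) auto
    moreover have "(\<Sum>i<m. g) \<le> h" using h unfolding g_def by (simp add: field_simps)
    ultimately show ?thesis by (meson order_trans)
  qed
  ultimately show ?thesis by blast
qed

context ball_model begin

text \<open>A union bound by induction over the test functions, each step giving half of
  \<open>\<delta>\<close> to the new one. Measurability is carried along because the induction step
  measures an intersection.\<close>

lemma sample_averages_close:
  fixes f :: "'t \<Rightarrow> (nat \<Rightarrow> real) \<Rightarrow> real"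
  assumes T: "finite T"
    and f: "\<And>t. t \<in> T \<Longrightarrow> i t \<in> {1..k} \<and> f t \<in> borel_measurable (\<mu> (i t)) \<and>
      (\<forall>x\<in>space (\<mu> (i t)). f t x \<in> {0..B t}) \<and> 0 < B t \<and> 0 < \<eta> t"
    and \<delta>: "0 < (\<delta> :: real)"
  shows "\<exists>N. \<forall>n\<ge>N. {\<omega> \<in> space (Om n). \<forall>t\<in>T.
      \<bar>(\<Sum>a\<in>cluster n (i t). f t (\<omega> a)) / sample_size b n (i t) - (\<integral>x. f t x \<partial>\<mu> (i t))\<bar> < \<eta> t} \<in> sets (Om n) \<and>
    1 - \<delta> < measure (Om n) {\<omega> \<in> space (Om n). \<forall>t\<in>T.
      \<bar>(\<Sum>a\<in>cluster n (i t). f t (\<omega> a)) / sample_size b n (i t) - (\<integral>x. f t x \<partial>\<mu> (i t))\<bar> < \<eta> t}"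
  using T f \<delta>
proof (induction T arbitrary: \<delta> rule: finite_induct)
  case empty
  then show ?case using prob_space.prob_space[OF prob_space_Om] by auto
next
  case (insert t T)
  define G where "G n t = {\<omega> \<in> space (Om n).
    \<bar>(\<Sum>a\<in>cluster n (i t). f t (\<omega> a)) / sample_size b n (i t) - (\<integral>x. f t x \<partial>\<mu> (i t))\<bar> < \<eta> t}" for n t
  define H where "H n = {\<omega> \<in> space (Om n). \<forall>t\<in>T.
    \<bar>(\<Sum>a\<in>cluster n (i t). f t (\<omega> a)) / sample_size b n (i t) - (\<integral>x. f t x \<partial>\<mu> (i t))\<bar> < \<eta> t}" for n
  have t: "i t \<in> {1..k}" "f t \<in> borel_measurable (\<mu> (i t))" "\<And>x. x \<in> space (\<mu> (i t)) \<Longrightarrow> f t x \<in> {0..B t}"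
    "0 < B t" "0 < \<eta> t" using insert.prems(1)[of t] by auto
  have d2: "0 < \<delta> / 2" using insert.prems by simp
  have "\<exists>N. \<forall>n\<ge>N. H n \<in> sets (Om n) \<and> 1 - \<delta> / 2 < measure (Om n) (H n)"
    unfolding H_def by (rule insert.IH[OF _ d2]) (use insert.prems(1) in blast)
  then obtain N1 where N1: "\<And>n. n \<ge> N1 \<Longrightarrow> H n \<in> sets (Om n) \<and> 1 - \<delta> / 2 < measure (Om n) (H n)" by blast
  obtain N2 where N2: "\<And>n. n \<ge> N2 \<Longrightarrow> measure (Om n) {\<omega> \<in> space (Om n).
    \<bar>(\<Sum>a\<in>cluster n (i t). f t (\<omega> a)) / sample_size b n (i t) - (\<integral>x. f t x \<partial>\<mu> (i t))\<bar> \<ge> \<eta> t} < \<delta> / 2"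
    using sample_average_tail[OF t d2] by blast
  have "{\<omega> \<in> space (Om n). \<forall>t\<in>insert t T.
      \<bar>(\<Sum>a\<in>cluster n (i t). f t (\<omega> a)) / sample_size b n (i t) - (\<integral>x. f t x \<partial>\<mu> (i t))\<bar> < \<eta> t} = G n t \<inter> H n" for n
    unfolding G_def H_def by blast
  moreover have "G n t \<inter> H n \<in> sets (Om n) \<and> 1 - \<delta> < measure (Om n) (G n t \<inter> H n)" if n: "n \<ge> max N1 N2" for n
  proof -
    interpret P: prob_space "Om n" by (rule prob_space_Om)
    have "(\<lambda>\<omega>. f t (\<omega> a)) \<in> borel_measurable (Om n)" if "a \<in> cluster n (i t)" for a
    proof -
      have "a \<in> idx n" "fst a = i t" using that cluster_iff[OF t(1)] by auto
      then show ?thesis using measurable_compose[OF measurable_point, of a n "f t" borel] t(2) by simp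
    qed
    then have [measurable]: "(\<lambda>\<omega>. \<Sum>a\<in>cluster n (i t). f t (\<omega> a)) \<in> borel_measurable (Om n)"
      by (rule borel_measurable_sum)
    have G: "G n t \<in> sets (Om n)" unfolding G_def by measurable
    have H: "H n \<in> sets (Om n)" "1 - \<delta> / 2 < P.prob (H n)" using N1 n by auto
    have "space (Om n) - G n t = {\<omega> \<in> space (Om n).
      \<bar>(\<Sum>a\<in>cluster n (i t). f t (\<omega> a)) / sample_size b n (i t) - (\<integral>x. f t x \<partial>\<mu> (i t))\<bar> \<ge> \<eta> t}"
      unfolding G_def by auto
    then have "P.prob (space (Om n) - G n t) < \<delta> / 2" using N2[of n] n by simp
    moreover have "P.prob (H n) \<le> P.prob ((G n t \<inter> H n) \<union> (space (Om n) - G n t))"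
      using G H sets.sets_into_space[OF H(1)] by (intro P.finite_measure_mono) auto
    moreover have "\<dots> \<le> P.prob (G n t \<inter> H n) + P.prob (space (Om n) - G n t)"
      using G H by (intro measure_Un_le) auto
    ultimately have "1 - \<delta> < P.prob (G n t \<inter> H n)" using H(2) by linarith
    then show ?thesis using G H by blast
  qed
  ultimately show ?case by (intro exI[of _ "max N1 N2"]) simp
qed

text \<open>The dual value \<open>\<alpha>\<close> makes the untruncated contribution of the own
  cluster to a draw equal to \<open>W\<close> plus the minimal total distance minus its own total
  distance. Thus near draws, for which truncation has no effect on the own cluster and removes the
  others, are compared exactly and the unique minimizer alone reaches \<open>W\<close>. For the
  remaining draws a crude strict bound \<open>far\<close> suffices, and this is where a law of large
  numbers can be applied.\<close>

lemma exact_recovery_criterion: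
  fixes W :: real
  defines "\<alpha> n \<omega> i \<equiv> (W + Min (total_dist n \<omega> ` cluster n i)) / sample_size b n i"
  assumes inj: "inj_on \<omega> (idx n)" and size: "\<And>i. i \<in> {1..k} \<Longrightarrow> 0 < sample_size b n i"
    and med: "\<And>i. i \<in> {1..k} \<Longrightarrow> inj_on (total_dist n \<omega>) (cluster n i)"
    and own: "\<And>i a q. i \<in> {1..k} \<Longrightarrow> a \<in> cluster n i \<Longrightarrow> near a \<Longrightarrow> q \<in> cluster n i \<Longrightarrow>
      Rn_dist m (\<omega> a) (\<omega> q) \<le> \<alpha> n \<omega> i"
    and off: "\<And>i j a q. i \<in> {1..k} \<Longrightarrow> j \<in> {1..k} \<Longrightarrow> i \<noteq> j \<Longrightarrow> a \<in> cluster n i \<Longrightarrow> near a \<Longrightarrow>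
      q \<in> cluster n j \<Longrightarrow> \<alpha> n \<omega> j < Rn_dist m (\<omega> a) (\<omega> q)"
    and far: "\<And>i a. i \<in> {1..k} \<Longrightarrow> a \<in> cluster n i \<Longrightarrow> \<not> near a \<Longrightarrow>
      (\<Sum>j\<in>{1..k}. \<Sum>q\<in>cluster n j. max 0 (\<alpha> n \<omega> j - Rn_dist m (\<omega> a) (\<omega> q))) < W"
  shows "exact_recovery (Rn_dist m) k (drawn_points b n \<omega>)"
proof -
  define d where "d a q = Rn_dist m (\<omega> a) (\<omega> q)" for a q
  define K where "K = {1..k}"
  have finK: "finite K" unfolding K_def by simp
  define td where "td = total_dist n \<omega>"
  define al where "al i = \<alpha> n \<omega> i" for i
  have al: "al i = (W + Min (td ` cluster n i)) / sample_size b n i" for i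
    unfolding al_def td_def \<alpha>_def ..
  have "\<exists>a\<in>cluster n i. td a = Min (td ` cluster n i)" if i: "i \<in> K" for i
  proof -
    have "cluster n i \<noteq> {}" using size[of i] i card_cluster[of n i] unfolding K_def by auto
    then have "Min (td ` cluster n i) \<in> td ` cluster n i" using finite_cluster by (intro Min_in) auto
    then show ?thesis by auto
  qed
  then obtain md where md: "\<And>i. i \<in> K \<Longrightarrow> md i \<in> cluster n i" "\<And>i. i \<in> K \<Longrightarrow> td (md i) = Min (td ` cluster n i)"
    by metis
  have contr: "(\<Sum>q\<in>cluster n i. al i - d a q) = W + Min (td ` cluster n i) - td a"
    if i: "i \<in> K" and a: "a \<in> cluster n i" for i a
  proof -
    have "fst a = i" using a cluster_iff[of i] i unfolding K_def by auto
    then have "(\<Sum>q\<in>cluster n i. al i - d a q) = sample_size b n i * al i - td a"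
      unfolding td_def total_dist_def d_def by (simp add: sum_subtractf card_cluster)
    also have "sample_size b n i * al i = W + Min (td ` cluster n i)"
      unfolding al using size i unfolding K_def by simp
    finally show ?thesis .
  qed
  define tot where "tot a = (\<Sum>j\<in>K. \<Sum>q\<in>cluster n j. max 0 (al j - d a q))" for a
  have own': "d a q \<le> al i" if "i \<in> K" "a \<in> cluster n i" "near a" "q \<in> cluster n i" for i a q
    using own that unfolding d_def al_def K_def by blast
  have off': "al j < d a q" if "i \<in> K" "j \<in> K" "i \<noteq> j" "a \<in> cluster n i" "near a" "q \<in> cluster n j" for i j a q
    using off that unfolding d_def al_def K_def by blast
  have tot_near: "tot a = W + Min (td ` cluster n i) - td a"
    if i: "i \<in> K" and a: "a \<in> cluster n i" "near a" for i a
  proof -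
    have "(\<Sum>q\<in>cluster n j. max 0 (al j - d a q)) = (if j = i then W + Min (td ` cluster n i) - td a else 0)"
      if j: "j \<in> K" for j
    proof (cases "j = i")
      case True
      have "(\<Sum>q\<in>cluster n i. max 0 (al i - d a q)) = (\<Sum>q\<in>cluster n i. al i - d a q)"
        using own'[OF i a] by (intro sum.cong) auto
      then show ?thesis using contr[OF i a(1)] True by simp
    next
      case False
      have "max 0 (al j - d a q) = 0" if "q \<in> cluster n j" for q
        using off'[OF i j _ a that] False by simp
      then show ?thesis using False by simp
    qed
    then show ?thesis unfolding tot_def using i finK by simp
  qed
  have tot_far: "tot a < W" if "i \<in> K" "a \<in> cluster n i" "\<not> near a" for i a
    using far[of i a] that unfolding tot_def d_def al_def K_def by blast
  \<comment> \<open>The own cluster alone contributes at least \<open>W\<close> to the minimizer,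
    since truncation at 0 only increases the sum; this contradicts \<open>far\<close>.\<close>
  have md_near: "near (md i)" if i: "i \<in> K" for i
  proof (rule ccontr)
    assume "\<not> near (md i)"
    then have "tot (md i) < W" using tot_far[OF i md(1)[OF i]] by blast
    moreover have "W = (\<Sum>q\<in>cluster n i. al i - d (md i) q)" using contr[OF i md(1)[OF i]] md(2)[OF i] by simp
    moreover have "\<dots> \<le> (\<Sum>q\<in>cluster n i. max 0 (al i - d (md i) q))" by (intro sum_mono) simp
    moreover have "\<dots> \<le> tot (md i)"
      unfolding tot_def using i finK by (intro member_le_sum[of i K] sum_nonneg) auto
    ultimately show False by linarith
  qed
  have "exact_recovery d k (cluster n)"
  proof (rule lp_certificate[where a = "\<lambda>q. al (fst q)" and med = md and W = W], unfold K_def[symmetric])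
    show "disjoint_family_on (cluster n) K"
      unfolding disjoint_family_on_def cluster_def by auto
    have fst_cl: "fst q = i" if "q \<in> cluster n i" for i q using that unfolding cluster_def by auto
    fix i assume i: "i \<in> K"
    have mi: "md i \<in> cluster n i" using md(1)[OF i] .
    show "(\<Sum>q\<in>cluster n i. al (fst q) - d (md i) q) = W"
      using contr[OF i mi] md(2)[OF i] fst_cl by (simp cong: sum.cong)
    show "d (md i) q \<le> al (fst q)" if "q \<in> cluster n i" for q
      using own'[OF i mi md_near[OF i] that] fst_cl[OF that] by simp
    show "al (fst q) < d (md i) q" if "j \<in> K" "i \<noteq> j" "q \<in> cluster n j" for j q
      using off'[OF i that(1,2) mi md_near[OF i] that(3)] fst_cl[OF that(3)] by simp
    fix p assume p: "p \<in> cluster n i" "p \<noteq> md i"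
    have "(\<Sum>j\<in>K. \<Sum>q\<in>cluster n j. max 0 (al (fst q) - d p q)) = tot p"
      unfolding tot_def using fst_cl by (intro sum.cong refl) auto
    moreover have "tot p < W"
    proof (cases "near p")
      case True
      have "td p \<noteq> td (md i)" using med[of i] i p mi unfolding K_def td_def inj_on_def by blast
      moreover have "Min (td ` cluster n i) \<le> td p" using p finite_cluster by simp
      ultimately show ?thesis using tot_near[OF i p(1) True] md(2)[OF i] by linarith
    qed (use tot_far[OF i p(1)] in blast)
    ultimately show "(\<Sum>j\<in>K. \<Sum>q\<in>cluster n j. max 0 (al (fst q) - d p q)) < W" by simp
  qed (use md finite_cluster in auto)
  moreover have "drawn_points b n \<omega> = (\<lambda>i. \<omega> ` cluster n i)" unfolding drawn_points_eq[abs_def] ..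
  moreover have "inj_on \<omega> (\<Union>i\<in>{1..k}. cluster n i)" using inj unfolding idx_eq .
  ultimately show ?thesis using exact_recovery_image_iff[where f = \<omega> and k = k and A = "cluster n" and d = "Rn_dist m"]
    unfolding d_def by metis
qed

end

section \<open>Populations with separated centers\<close>

text \<open>For the zone eps/2 < s \<le> r/2 with \<kappa> = k/m: foreign margins there are at least
  r/2, and already the smallest gain, (eps/2)^2/(32 R), outweighs the foreign balls.\<close>

lemma far_gain_middle:
  fixes \<beta> r R \<kappa> eps s :: real
  assumes "1 \<le> \<beta>" "0 < r" "r \<le> R" "0 \<le> \<kappa>" and eps: "512 * \<beta>\<^sup>2 * R ^ 4 * \<kappa> / r\<^sup>2 \<le> eps\<^sup>2" "0 < eps"
    and s: "eps / 2 < s"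
  shows "\<kappa> * \<beta> * R\<^sup>2 / (2 * r) \<le> s\<^sup>2 / (32 * R)"
proof -
  have R: "0 < R" using assms by linarith
  have "\<kappa> * \<beta> * R\<^sup>2 / (2 * r) = (\<kappa> * R\<^sup>2 / r) * (\<beta> / 2)" by (simp add: mult_ac)
  also have "\<dots> \<le> (\<kappa> * R\<^sup>2 / r) * (\<beta>\<^sup>2 * (R / r) * 4)"
  proof (rule mult_left_mono)
    have "\<beta> * 1 \<le> \<beta> * \<beta>" "1 \<le> R / r" using assms by (auto intro: mult_left_mono)
    then have "\<beta> * 1 \<le> \<beta>\<^sup>2 * (R / r)" using assms unfolding power2_eq_square by (intro mult_mono) auto
    then show "\<beta> / 2 \<le> \<beta>\<^sup>2 * (R / r) * 4" using assms by linarith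
  qed (use assms R in simp)
  also have "\<dots> = (512 * \<beta>\<^sup>2 * R ^ 4 * \<kappa> / r\<^sup>2) / (128 * R)"
    using R assms by (simp add: field_simps power2_eq_square power4_eq_xxxx)
  also have "\<dots> \<le> eps\<^sup>2 / (128 * R)" using eps R by (intro divide_right_mono) auto
  also have "\<dots> = (eps / 2)\<^sup>2 / (32 * R)" by (simp add: power2_eq_square)
  also have "\<dots> \<le> s\<^sup>2 / (32 * R)" using s eps R by (intro divide_right_mono power_mono) auto
  finally show ?thesis .
qed

text \<open>For the zone s > r/2, where the margin may be as small as \<open>eps\<close> but the
  gain is at least r^2/(128 R). After squaring, one factor \<open>\<kappa>\<close> is absorbed by
  eps^2 and the other by r^2; this gives the constant 512 = 32^2 / 2.\<close>

lemma far_gain_outer: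
  fixes \<beta> r R \<kappa> eps s :: real
  assumes "1 \<le> \<beta>" "0 < r" "r \<le> R" "0 \<le> \<kappa>" and eps: "512 * \<beta>\<^sup>2 * R ^ 4 * \<kappa> / r\<^sup>2 \<le> eps\<^sup>2" "0 < eps"
    and \<kappa>: "2 * \<kappa> * R\<^sup>2 \<le> r\<^sup>2" and s: "r / 2 < s"
  shows "\<kappa> * \<beta> * R\<^sup>2 / (4 * eps) \<le> s\<^sup>2 / (32 * R)"
proof -
  have R: "0 < R" using assms by linarith
  have "(32 * \<kappa> * \<beta> * R ^ 3)\<^sup>2 = (512 * \<beta>\<^sup>2 * R ^ 4 * \<kappa>) * (2 * \<kappa> * R\<^sup>2)"
    by (simp add: power2_eq_square power3_eq_cube power4_eq_xxxx)
  also have "\<dots> \<le> (eps\<^sup>2 * r\<^sup>2) * r\<^sup>2"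
  proof (rule mult_mono)
    show "512 * \<beta>\<^sup>2 * R ^ 4 * \<kappa> \<le> eps\<^sup>2 * r\<^sup>2" using eps(1) assms(2) by (simp add: divide_le_eq)
  qed (use \<kappa> assms in auto)
  also have "\<dots> = (r\<^sup>2 * eps)\<^sup>2" by (simp add: power2_eq_square)
  finally have *: "32 * \<kappa> * \<beta> * R ^ 3 \<le> r\<^sup>2 * eps"
    by (rule power2_le_imp_le) (use eps in simp)
  have "\<kappa> * \<beta> * R\<^sup>2 / (4 * eps) = (32 * \<kappa> * \<beta> * R ^ 3) / (128 * R * eps)"
    using R eps by (simp add: field_simps power2_eq_square power3_eq_cube)
  also have "\<dots> \<le> (r\<^sup>2 * eps) / (128 * R * eps)"
    using * R eps by (intro divide_right_mono) auto
  also have "\<dots> = (r / 2)\<^sup>2 / (32 * R)" using eps R by (simp add: power2_eq_square field_simps)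
  also have "\<dots> \<le> s\<^sup>2 / (32 * R)" using s assms R by (intro divide_right_mono power_mono) auto
  finally show ?thesis .
qed

locale separated_model = ball_model +
  fixes \<beta> r R eps :: real
  assumes \<beta>: "1 \<le> \<beta>" and r: "0 < r" and rR: "r \<le> R" and k1: "1 \<le> k"
    and rho_ge: "\<And>i. i \<in> {1..k} \<Longrightarrow> r \<le> \<rho> i" and rho_le: "\<And>i. i \<in> {1..k} \<Longrightarrow> \<rho> i \<le> R"
    and b_le: "\<And>i. i \<in> {1..k} \<Longrightarrow> b i \<le> \<beta>"
    and eps: "0 < eps"
    and separated: "\<And>i j. i \<in> {1..k} \<Longrightarrow> j \<in> {1..k} \<Longrightarrow> i \<noteq> j \<Longrightarrow>
      (1 + \<beta>) * R + max (\<rho> i) (\<rho> j) + eps < Rn_dist m (c i) (c j)"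
begin

lemma R_pos: "0 < R" using r rR by linarith

lemma sample_size_eq:
  assumes "admissible_size k b n" "i \<in> {1..k}"
  shows "real (sample_size b n i) = b i * real n"
proof -
  have "b i * real n \<in> \<nat>" using assms unfolding admissible_size_def by blast
  then obtain l where "b i * real n = real l" by (rule Nats_cases)
  then show ?thesis unfolding sample_size_def by simp
qed

lemma center_dist_le:
  assumes "\<omega> \<in> space (Om n)" "i \<in> {1..k}" "a \<in> cluster n i"
  shows "Rn_dist m (c i) (\<omega> a) \<le> \<rho> i"
  using point_in_ball[OF assms(1), of a] assms cluster_iff[OF assms(2)] unfolding Rn_cball_def by auto

lemma cross_dist_ge:
  assumes "\<omega> \<in> space (Om n)" "i \<in> {1..k}" "j \<in> {1..k}" "i \<noteq> j" "q \<in> cluster n j"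
  shows "(1 + \<beta>) * R + eps - Rn_dist m (c i) p < Rn_dist m p (\<omega> q)"
proof -
  have "Rn_dist m (c i) (c j) \<le> Rn_dist m (c i) p + Rn_dist m p (\<omega> q) + Rn_dist m (\<omega> q) (c j)"
    using Rn_dist_triangle[of m "c i" "c j" p] Rn_dist_triangle[of m p "c j" "\<omega> q"] by linarith
  then show ?thesis
    using separated[OF assms(2-4)] center_dist_le[OF assms(1,3,5)] by (simp add: Rn_dist_commute)
qed

section \<open>Recovery when the gap is large\<close>

text \<open>With W = 2 \<beta> R n every dual value is at least the diameter bound 2 R and at most 2
  \<beta> R + 2 R. Draws from different balls are further apart than (1 + \<beta>) R + eps - R,
  which reaches that upper bound exactly when eps \<ge> (\<beta> + 2) R. Hence every draw counts as
  near.\<close>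

lemma recovery_large_gap:
  assumes large: "(\<beta> + 2) * R \<le> eps" and adm: "admissible_size k b n" and n: "0 < n"
    and \<omega>: "\<omega> \<in> space (Om n)" and inj: "inj_on \<omega> (idx n)"
    and med: "\<And>i. i \<in> {1..k} \<Longrightarrow> inj_on (total_dist n \<omega>) (cluster n i)"
  shows "exact_recovery (Rn_dist m) k (drawn_points b n \<omega>)"
proof -
  define W where "W = 2 * R * \<beta> * real n"
  define MM where "MM i = Min (total_dist n \<omega> ` cluster n i)" for i
  have size: "0 < sample_size b n i" if "i \<in> {1..k}" for i
    using sample_size_ge[OF that, of n] n by simp
  have within: "Rn_dist m (\<omega> a) (\<omega> q) \<le> 2 * R" if i: "i \<in> {1..k}" "a \<in> cluster n i" "q \<in> cluster n i" for i a q
    using Rn_dist_triangle[of m "\<omega> a" "\<omega> q" "c i"] center_dist_le[OF \<omega> i(1,2)] center_dist_le[OF \<omega> i(1,3)]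
      rho_le[OF i(1)] by (simp add: Rn_dist_commute)
  have MM: "0 \<le> MM i" "MM i \<le> sample_size b n i * (2 * R)" if i: "i \<in> {1..k}" for i
  proof -
    have ne: "cluster n i \<noteq> {}" using size[OF i] card_cluster[of n i] by auto
    have fin: "finite (total_dist n \<omega> ` cluster n i)" using finite_cluster by simp
    show "0 \<le> MM i" unfolding MM_def using ne fin by (simp add: total_dist_def sum_nonneg)
    obtain a where a: "a \<in> cluster n i" using ne by blast
    then have fa: "fst a = i" using cluster_iff[OF i] by simp
    have "total_dist n \<omega> a \<le> (\<Sum>q\<in>cluster n i. 2 * R)"
      unfolding total_dist_def fa by (intro sum_mono within[OF i a])
    moreover have "MM i \<le> total_dist n \<omega> a" unfolding MM_def using a fin by simp
    ultimately show "MM i \<le> sample_size b n i * (2 * R)" by (simp add: card_cluster)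
  qed
  have lo: "2 * R \<le> (W + MM i) / sample_size b n i" if i: "i \<in> {1..k}" for i
  proof -
    have "real (sample_size b n i) * (2 * R) \<le> W"
      unfolding sample_size_eq[OF adm i] W_def using b_le[OF i] R_pos n by (simp add: mult_right_mono)
    then show ?thesis using MM(1)[OF i] size[OF i] by (simp add: le_divide_eq mult.commute)
  qed
  have hi: "(W + MM i) / sample_size b n i \<le> 2 * R * \<beta> + 2 * R" if i: "i \<in> {1..k}" for i
  proof -
    have "W \<le> 2 * R * \<beta> * real (sample_size b n i)"
      unfolding W_def using sample_size_ge[OF i, of n] R_pos \<beta> by (intro mult_left_mono) auto
    then show ?thesis using MM(2)[OF i] size[OF i] by (simp add: divide_le_eq algebra_simps)
  qed
  show ?thesis
  proof (rule exact_recovery_criterion[where W = W and near = "\<lambda>_. True", OF inj size med],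
      unfold MM_def[symmetric])
    show "Rn_dist m (\<omega> a) (\<omega> q) \<le> (W + MM i) / sample_size b n i"
      if "i \<in> {1..k}" "a \<in> cluster n i" "q \<in> cluster n i" for i a q
      using within[OF that] lo[OF that(1)] by linarith
    show "(W + MM j) / sample_size b n j < Rn_dist m (\<omega> a) (\<omega> q)"
      if "i \<in> {1..k}" "j \<in> {1..k}" "i \<noteq> j" "a \<in> cluster n i" "q \<in> cluster n j" for i j a q
      using cross_dist_ge[OF \<omega> that(1-3,5), of "\<omega> a"] center_dist_le[OF \<omega> that(1,4)] rho_le[OF that(1)]
        hi[OF that(2)] large by (simp add: algebra_simps)
  qed auto
qed

text \<open>\<open>Ac i\<close> is the almost sure limit of the dual value of the \<open>i\<close>-th cluster for
  $W = \beta R n$, since \<open>ec i\<close> is the limit of $M_i / n_i$; accordingly \<open>Ec i p\<close> is the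
  limiting contribution to \<open>p\<close> per draw from the \<open>i\<close>-th ball.\<close>

definition ec :: "nat \<Rightarrow> real" where
  "ec i = (\<integral>x. Rn_dist m (c i) x \<partial>\<mu> i)"

definition Ac :: "nat \<Rightarrow> real" where
  "Ac i = \<beta> * R / b i + ec i"

definition Ec :: "nat \<Rightarrow> (nat \<Rightarrow> real) \<Rightarrow> real" where
  "Ec i p = (\<integral>x. max 0 (Ac i - Rn_dist m p x) \<partial>\<mu> i)"

text \<open>Positivity is essential: \<open>ec i\<close> is the room between \<open>R\<close> and
  the dual value in the truncated-distance estimate, and it limits the neighbourhood in which
  contributions are exact.\<close>

lemma ec_pos: "i \<in> {1..k} \<Longrightarrow> 0 < ec i" and ec_le: "i \<in> {1..k} \<Longrightarrow> ec i \<le> R"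
proof -
  assume i: "i \<in> {1..k}"
  interpret B: ball_prob "\<mu> i" m "c i" "\<rho> i" by (rule ball_probI[OF i])
  have int: "integrable (\<mu> i) (\<lambda>x. Rn_dist m (c i) x)"
    by (rule B.integrable_bounded[of _ "\<rho> i"]) (auto simp: Rn_cball_def)
  \<comment> \<open>The sum over one index is the distance to the center, so level 0 shows that the
    center carries no mass.\<close>
  have "emeasure (\<mu> i) {x \<in> space (\<mu> i). (\<Sum>q\<in>{()}. Rn_dist m x (c i)) = 0} = 0"
    by (rule B.null_level_sum_dist_ball[OF leb[OF i] m2]) auto
  then have N: "emeasure (\<mu> i) {x \<in> space (\<mu> i). Rn_dist m (c i) x = 0} = 0"
    by (simp add: Rn_dist_commute)
  have "ec i \<noteq> 0"
  proof
    assume "ec i = 0"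
    then have "AE x in \<mu> i. Rn_dist m (c i) x = 0"
      using integral_nonneg_eq_0_iff_AE[OF int] unfolding ec_def by simp
    then have "emeasure (\<mu> i) {x \<in> space (\<mu> i). Rn_dist m (c i) x = 0} = 1"
      by (intro B.emeasure_eq_1_AE) (auto elim: AE_mp)
    then show False using N by simp
  qed
  moreover have "0 \<le> ec i" unfolding ec_def by simp
  ultimately show "0 < ec i" by linarith
  show "ec i \<le> R" unfolding ec_def
    by (intro B.integral_le_const int AE_I2 order_trans[OF B.dist_le rho_le[OF i]])
qed

text \<open>The lower bound rests on b_i \<le> \<beta> and keeps own distances of near points
  untruncated; the upper bound rests on b_i \<ge> 1 and \<open>ec_le\<close>, and matches the
  separation threshold.\<close>

lemma Ac_bounds:
  assumes i: "i \<in> {1..k}"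
  shows "R + ec i \<le> Ac i" "Ac i \<le> (1 + \<beta>) * R"
proof -
  have "R \<le> \<beta> * R / b i" using b_le[OF i] b_ge_1[OF i] R_pos by (simp add: le_divide_eq mult.commute)
  then show "R + ec i \<le> Ac i" unfolding Ac_def by simp
  have "\<beta> * R * 1 \<le> \<beta> * R * b i" using b_ge_1[OF i] R_pos \<beta> by (intro mult_left_mono) auto
  then have "\<beta> * R / b i \<le> \<beta> * R" using b_ge_1[OF i] by (simp add: divide_le_eq)
  then show "Ac i \<le> (1 + \<beta>) * R" using ec_le[OF i] unfolding Ac_def by (simp add: algebra_simps)
qed

lemma Ac_pos: "i \<in> {1..k} \<Longrightarrow> 0 < Ac i"
  using Ac_bounds(1) ec_pos R_pos by fastforce

lemma own_contribution:
  assumes i: "i \<in> {1..k}" and p: "p \<in> Rn_cball m (c i) (\<rho> i)" and m: "32 \<le> m"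
  shows "Ec i p \<le> Ac i - ec i - (Rn_dist m (c i) p)\<^sup>2 / (16 * R)"
proof -
  interpret B: ball_prob "\<mu> i" m "c i" "\<rho> i" by (rule ball_probI[OF i])
  have int: "integrable (\<mu> i) (\<lambda>x. min (Rn_dist m p x) (Ac i))"
    using Ac_pos[OF i] by (intro B.integrable_bounded[of _ "Ac i"]) auto
  have "Ec i p = (\<integral>x. Ac i - min (Rn_dist m p x) (Ac i) \<partial>\<mu> i)"
    unfolding Ec_def by (intro Bochner_Integration.integral_cong refl) (auto simp: max_def min_def)
  also have "\<dots> = Ac i - (\<integral>x. min (Rn_dist m p x) (Ac i) \<partial>\<mu> i)"
    using int by (simp add: Bochner_Integration.integral_diff B.prob_space)
  finally show ?thesis
    using B.expected_truncated_dist[OF rot[OF i] m rho_le[OF i] R_pos p ec_def ec_pos[OF i] Ac_bounds(1)[OF i]]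
    by simp
qed

text \<open>The weights \<open>b j\<close> turn contributions per draw into contributions per unit
  of \<open>n\<close>, to be compared with W / n = \<beta> R. The own ball loses s^2/(16 R) and half
  of this pays for the others. Up to s = eps/2 the foreign balls are out of reach altogether; up to
  s = r/2 their margin is at least r/2, and beyond that at least \<open>eps\<close>.\<close>

lemma total_contribution:
  assumes i: "i \<in> {1..k}" and p: "p \<in> Rn_cball m (c i) (\<rho> i)" and m: "32 \<le> m"
    and e1: "512 * \<beta>\<^sup>2 * R ^ 4 * (k / m) / r\<^sup>2 \<le> eps\<^sup>2" and e2: "2 * (k / m) * R\<^sup>2 \<le> r\<^sup>2"
  shows "(\<Sum>j\<in>{1..k}. b j * Ec j p) \<le> \<beta> * R - (Rn_dist m (c i) p)\<^sup>2 / (32 * R)"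
proof -
  define s where "s = Rn_dist m (c i) p"
  have s: "0 \<le> s" "s \<le> \<rho> i" using p unfolding s_def Rn_cball_def by auto
  have gap: "max (\<rho> i) (\<rho> j) + eps - s < Rn_dist m (c j) p - Ac j"
    if j: "j \<in> {1..k}" "j \<noteq> i" for j
    using separated[OF i j(1)] j(2) Rn_dist_triangle[of m "c i" "c j" p] Ac_bounds(2)[OF j(1)]
    unfolding s_def by (simp add: Rn_dist_commute)
  have foreign: "b j * Ec j p \<le> \<beta> * (R\<^sup>2 / (4 * m * g))"
    if j: "j \<in> {1..k}" "j \<noteq> i" and g: "0 < g" "g \<le> Rn_dist m (c j) p - Ac j" for j and g :: real
  proof -
    interpret B: ball_prob "\<mu> j" m "c j" "\<rho> j" by (rule ball_probI[OF j(1)])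
    have "Ec j p \<le> R\<^sup>2 / (4 * m * (Rn_dist m (c j) p - Ac j))"
      unfolding Ec_def
      by (rule B.expected_foreign_contribution[OF rot[OF j(1)] m2 rho_le[OF j(1)]])
        (use g Ac_pos[OF j(1)] in auto)
    also have "\<dots> \<le> R\<^sup>2 / (4 * m * g)"
      using g m by (intro divide_left_mono mult_left_mono mult_pos_pos) auto
    finally have "Ec j p \<le> R\<^sup>2 / (4 * m * g)" .
    moreover have "0 \<le> Ec j p" unfolding Ec_def by simp
    ultimately show ?thesis using b_le[OF j(1)] b_ge_1[OF j(1)] by (intro mult_mono) auto
  qed
  have others_le: "(\<Sum>j\<in>{1..k} - {i}. b j * Ec j p) \<le> (k / m) * \<beta> * R\<^sup>2 / (4 * g)"
    if g: "0 < g" "\<And>j. j \<in> {1..k} \<Longrightarrow> j \<noteq> i \<Longrightarrow> g \<le> Rn_dist m (c j) p - Ac j" for g :: real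
  proof -
    have "(\<Sum>j\<in>{1..k} - {i}. b j * Ec j p) \<le> (\<Sum>j\<in>{1..k} - {i}. \<beta> * (R\<^sup>2 / (4 * m * g)))"
      using foreign g by (intro sum_mono) auto
    also have "\<dots> \<le> (\<Sum>j\<in>{1..k}. \<beta> * (R\<^sup>2 / (4 * m * g)))"
      using g \<beta> by (intro sum_mono2) auto
    also have "\<dots> = (k / m) * \<beta> * R\<^sup>2 / (4 * g)" by simp
    finally show ?thesis .
  qed
  have others: "(\<Sum>j\<in>{1..k} - {i}. b j * Ec j p) \<le> s\<^sup>2 / (32 * R)"
  proof -
    consider "s \<le> eps / 2" | "eps / 2 < s" "s \<le> r / 2" | "r / 2 < s" by linarith
    then show ?thesis
    proof cases
      case 1
      have "Ec j p = 0" if j: "j \<in> {1..k}" "j \<noteq> i" for j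
      proof -
        interpret B: ball_prob "\<mu> j" m "c j" "\<rho> j" by (rule ball_probI[OF j(1)])
        have "max 0 (Ac j - Rn_dist m p x) = 0" if x: "x \<in> space (\<mu> j)" for x
          using gap[OF j] B.dist_le[OF x] 1 eps Rn_dist_triangle[of m "c j" p x] by (simp add: Rn_dist_commute)
        then show ?thesis unfolding Ec_def by (simp cong: Bochner_Integration.integral_cong)
      qed
      then show ?thesis using R_pos by (simp add: sum.neutral)
    next
      case 2
      have "(\<Sum>j\<in>{1..k} - {i}. b j * Ec j p) \<le> (k / m) * \<beta> * R\<^sup>2 / (4 * (r / 2))"
        by (rule others_le) (use r 2 gap rho_ge[OF i] eps in \<open>force\<close>)+
      also have "\<dots> = (k / m) * \<beta> * R\<^sup>2 / (2 * r)" by simp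
      also have "\<dots> \<le> s\<^sup>2 / (32 * R)"
        by (rule far_gain_middle[OF \<beta> r rR _ e1 eps 2(1)]) simp
      finally show ?thesis .
    next
      case 3
      have "(\<Sum>j\<in>{1..k} - {i}. b j * Ec j p) \<le> (k / m) * \<beta> * R\<^sup>2 / (4 * eps)"
        by (rule others_le) (use gap s eps in \<open>force\<close>)+
      also have "\<dots> \<le> s\<^sup>2 / (32 * R)"
        by (rule far_gain_outer[OF \<beta> r rR _ e1 eps e2 3]) simp
      finally show ?thesis .
    qed
  qed
  have "b i * Ec i p \<le> b i * (Ac i - ec i - s\<^sup>2 / (16 * R))"
    using own_contribution[OF i p m] b_ge_1[OF i] unfolding s_def by (intro mult_left_mono) auto
  also have "\<dots> = \<beta> * R - b i * (s\<^sup>2 / (16 * R))"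
    using b_ge_1[OF i] unfolding Ac_def by (simp add: right_diff_distrib)
  also have "\<dots> \<le> \<beta> * R - 1 * (s\<^sup>2 / (16 * R))"
    using b_ge_1[OF i] R_pos by (intro diff_left_mono mult_right_mono) auto
  finally have "b i * Ec i p \<le> \<beta> * R - s\<^sup>2 / (16 * R)" by simp
  moreover have "(\<Sum>j\<in>{1..k}. b j * Ec j p) = b i * Ec i p + (\<Sum>j\<in>{1..k} - {i}. b j * Ec j p)"
    using i by (simp add: sum.remove)
  moreover have "s\<^sup>2 / (16 * R) = s\<^sup>2 / (32 * R) + s\<^sup>2 / (32 * R)" by simp
  ultimately show ?thesis using others unfolding s_def by linarith
qed

section \<open>Recovery when the gap is small, on samples close to the limit\<close>

text \<open>The empirical version of \<open>Ec\<close>. It keeps the limiting dual value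
  \<open>Ac\<close> instead of the random one, so that it is an average of a fixed bounded
  function.\<close>

definition avg :: "nat \<Rightarrow> (nat \<times> nat \<Rightarrow> nat \<Rightarrow> real) \<Rightarrow> nat \<Rightarrow> (nat \<Rightarrow> real) \<Rightarrow> real" where
  "avg n \<omega> i p = (\<Sum>q\<in>cluster n i. max 0 (Ac i - Rn_dist m p (\<omega> q))) / sample_size b n i"

text \<open>The deterministic core: \<open>\<tau>\<close> is the radius within which contributions
  are exact, \<open>\<zeta>\<close> the sampling error. Outside that radius the k balls err together
  by at most 3 k \<beta> \<zeta> per unit of \<open>n\<close>, which the bound on 96 k \<beta>
  \<zeta> R keeps below the gain \<tau>^2/(32 R).\<close>

lemma recovery_small_gap:
  assumes m: "32 \<le> m"
    and e1: "512 * \<beta>\<^sup>2 * R ^ 4 * (k / m) / r\<^sup>2 \<le> eps\<^sup>2" and e2: "2 * (k / m) * R\<^sup>2 \<le> r\<^sup>2"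
    and \<tau>: "0 < \<tau>" "\<tau> \<le> eps / 4" "\<And>i. i \<in> {1..k} \<Longrightarrow> 2 * \<tau> \<le> ec i"
    and \<zeta>: "0 < \<zeta>" "\<zeta> \<le> \<tau> / 4" "96 * k * \<beta> * \<zeta> * R < \<tau>\<^sup>2"
    and adm: "admissible_size k b n" and n: "0 < n"
    and \<omega>: "\<omega> \<in> space (Om n)" and inj: "inj_on \<omega> (idx n)"
    and med: "\<And>i. i \<in> {1..k} \<Longrightarrow> inj_on (total_dist n \<omega>) (cluster n i)"
    and close: "\<And>i j p. i \<in> {1..k} \<Longrightarrow> j \<in> {1..k} \<Longrightarrow> p \<in> Rn_cball m (c i) (\<rho> i) \<Longrightarrow> \<bar>avg n \<omega> j p - Ec j p\<bar> \<le> \<zeta>"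
    and hit: "\<And>i. i \<in> {1..k} \<Longrightarrow> \<exists>q\<in>cluster n i. Rn_dist m (c i) (\<omega> q) < \<zeta>"
  shows "exact_recovery (Rn_dist m) k (drawn_points b n \<omega>)"
proof -
  define W where "W = \<beta> * R * real n"
  define N where "N i = real (sample_size b n i)" for i
  define MM where "MM i = Min (total_dist n \<omega> ` cluster n i)" for i
  have size: "0 < sample_size b n i" if "i \<in> {1..k}" for i
    using sample_size_ge[OF that, of n] n by simp
  have N: "0 < N i" "N i = b i * n" if "i \<in> {1..k}" for i
    using size[OF that] sample_size_eq[OF adm that] unfolding N_def by auto
  have in_ball: "\<omega> a \<in> Rn_cball m (c i) (\<rho> i)" if "i \<in> {1..k}" "a \<in> cluster n i" for i a
    using point_in_ball[OF \<omega>, of a] cluster_iff[OF that(1)] that by auto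
  have avg_N: "(\<Sum>q\<in>cluster n i. max 0 (Ac i - Rn_dist m p (\<omega> q))) = N i * avg n \<omega> i p" if "i \<in> {1..k}" for i p
    using N(1)[OF that] unfolding avg_def N_def by simp
  have WN: "W / N i = \<beta> * R / b i" if i: "i \<in> {1..k}" for i
    using N[OF i] b_ge_1[OF i] n unfolding W_def by simp
  \<comment> \<open>Distances dominate truncated distances, and by \<open>own_contribution\<close>
    the mean truncated distance from any point of the ball is at least \<open>ec i\<close>.\<close>
  have MM_lo: "N i * (ec i - \<zeta>) \<le> MM i" if i: "i \<in> {1..k}" for i
  proof -
    have ne: "cluster n i \<noteq> {}" using size[OF i] card_cluster[of n i] by auto
    have "N i * (ec i - \<zeta>) \<le> total_dist n \<omega> a" if a: "a \<in> cluster n i" for a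
    proof -
      have "avg n \<omega> i (\<omega> a) \<le> Ec i (\<omega> a) + \<zeta>" using close[OF i i in_ball[OF i a]] by linarith
      also have "\<dots> \<le> Ac i - ec i + \<zeta>"
      proof -
        have "0 \<le> (Rn_dist m (c i) (\<omega> a))\<^sup>2 / (16 * R)" using R_pos by simp
        then show ?thesis using own_contribution[OF i in_ball[OF i a] m] by linarith
      qed
      finally have "N i * (ec i - \<zeta>) \<le> N i * (Ac i - avg n \<omega> i (\<omega> a))"
        using N(1)[OF i] by (intro mult_left_mono) auto
      also have "\<dots> = (\<Sum>q\<in>cluster n i. Ac i - max 0 (Ac i - Rn_dist m (\<omega> a) (\<omega> q)))"
        unfolding right_diff_distrib avg_N[OF i, symmetric] by (simp add: sum_subtractf card_cluster N_def)
      also have "\<dots> \<le> (\<Sum>q\<in>cluster n i. Rn_dist m (\<omega> a) (\<omega> q))"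
        by (intro sum_mono) auto
      also have "\<dots> = total_dist n \<omega> a"
        using a cluster_iff[OF i] unfolding total_dist_def by simp
      finally show ?thesis .
    qed
    then show ?thesis unfolding MM_def using ne finite_cluster by simp
  qed
  \<comment> \<open>A draw within \<open>\<zeta>\<close> of the center is compared with the center,
    where nothing is truncated since \<rho> i \<le> Ac i. One \<open>\<zeta>\<close> is the sampling
    error and the other the displacement.\<close>
  have MM_hi: "MM i \<le> N i * (ec i + 2 * \<zeta>)" if i: "i \<in> {1..k}" for i
  proof -
    interpret B: ball_prob "\<mu> i" m "c i" "\<rho> i" by (rule ball_probI[OF i])
    obtain q0 where q0: "q0 \<in> cluster n i" "Rn_dist m (c i) (\<omega> q0) < \<zeta>" using hit[OF i] by blast
    have RA: "\<rho> i \<le> Ac i" using rho_le[OF i] Ac_bounds(1)[OF i] ec_pos[OF i] by linarith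
    have Ece: "Ec i (c i) = Ac i - ec i"
    proof -
      have "Ec i (c i) = (\<integral>x. Ac i - Rn_dist m (c i) x \<partial>\<mu> i)"
        unfolding Ec_def using B.dist_le RA by (intro Bochner_Integration.integral_cong refl) (force simp: max_def)
      also have "\<dots> = Ac i - ec i"
        unfolding ec_def
        by (subst Bochner_Integration.integral_diff)
          (auto simp: B.prob_space Rn_cball_def intro!: B.integrable_bounded[of _ "\<rho> i"])
      finally show ?thesis .
    qed
    have "(\<Sum>q\<in>cluster n i. Rn_dist m (c i) (\<omega> q)) = (\<Sum>q\<in>cluster n i. Ac i - max 0 (Ac i - Rn_dist m (c i) (\<omega> q)))"
      using center_dist_le[OF \<omega> i] RA by (intro sum.cong refl) (force simp: max_def)
    also have "\<dots> = N i * (Ac i - avg n \<omega> i (c i))"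
      unfolding right_diff_distrib avg_N[OF i, symmetric] by (simp add: sum_subtractf card_cluster N_def)
    also have "\<dots> \<le> N i * (ec i + \<zeta>)"
      using close[OF i i center_in_ball[OF i]] Ece N(1)[OF i] by (intro mult_left_mono) auto
    finally have 1: "(\<Sum>q\<in>cluster n i. Rn_dist m (c i) (\<omega> q)) \<le> N i * (ec i + \<zeta>)" .
    have "MM i \<le> total_dist n \<omega> q0" unfolding MM_def using q0 finite_cluster by simp
    also have "\<dots> = (\<Sum>q\<in>cluster n i. Rn_dist m (\<omega> q0) (\<omega> q))"
      using q0 cluster_iff[OF i] unfolding total_dist_def by simp
    also have "\<dots> \<le> (\<Sum>q\<in>cluster n i. \<zeta> + Rn_dist m (c i) (\<omega> q))"
    proof (rule sum_mono)
      fix q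
      show "Rn_dist m (\<omega> q0) (\<omega> q) \<le> \<zeta> + Rn_dist m (c i) (\<omega> q)"
        using Rn_dist_triangle[of m "\<omega> q0" "\<omega> q" "c i"] q0(2) Rn_dist_commute[of m "\<omega> q0" "c i"] by linarith
    qed
    also have "\<dots> = N i * \<zeta> + (\<Sum>q\<in>cluster n i. Rn_dist m (c i) (\<omega> q))"
      by (simp add: sum.distrib card_cluster N_def)
    finally show ?thesis using 1 by (simp add: algebra_simps)
  qed
  define al where "al i = (W + MM i) / N i" for i
  \<comment> \<open>The lower bound covers all own distances of a draw within \<open>\<tau>\<close>
    of its center. The upper bound stays below foreign distances because 2 \<zeta> + \<tau> <
    eps.\<close>
  have al: "R + \<tau> \<le> al i" "al i \<le> Ac i + 2 * \<zeta>" if i: "i \<in> {1..k}" for i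
  proof -
    have eq: "al i = \<beta> * R / b i + MM i / N i" unfolding al_def add_divide_distrib WN[OF i] ..
    have "ec i - \<zeta> \<le> MM i / N i" "MM i / N i \<le> ec i + 2 * \<zeta>"
      using MM_lo[OF i] MM_hi[OF i] N(1)[OF i] by (simp_all add: le_divide_eq divide_le_eq mult.commute)
    then show "R + \<tau> \<le> al i" "al i \<le> Ac i + 2 * \<zeta>"
      using Ac_bounds(1)[OF i] \<tau>(3)[OF i] \<zeta>(2) \<tau>(1) unfolding eq Ac_def by linarith+
  qed
  show ?thesis
  proof (rule exact_recovery_criterion[where W = W and near = "\<lambda>a. Rn_dist m (c (fst a)) (\<omega> a) \<le> \<tau>",
        OF inj size med], unfold MM_def[symmetric] N_def[symmetric] al_def[symmetric])
    fix i a assume i: "i \<in> {1..k}" and a: "a \<in> cluster n i"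
    then have fa: "fst a = i" using cluster_iff[OF i] by simp
    {
      assume near: "Rn_dist m (c (fst a)) (\<omega> a) \<le> \<tau>"
      show "Rn_dist m (\<omega> a) (\<omega> q) \<le> al i" if q: "q \<in> cluster n i" for q
        using Rn_dist_triangle[of m "\<omega> a" "\<omega> q" "c i"] near[unfolded fa] center_dist_le[OF \<omega> i q]
          rho_le[OF i] al(1)[OF i] Rn_dist_commute[of m "\<omega> a" "c i"] by linarith
      show "al j < Rn_dist m (\<omega> a) (\<omega> q)" if j: "j \<in> {1..k}" "i \<noteq> j" "q \<in> cluster n j" for j q
        using cross_dist_ge[OF \<omega> i j, of "\<omega> a"] near[unfolded fa] al(2)[OF j(1)] Ac_bounds(2)[OF j(1)]
          \<zeta>(2) \<tau>(1,2) eps by linarith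
    }
    assume "\<not> Rn_dist m (c (fst a)) (\<omega> a) \<le> \<tau>"
    then have far: "\<tau> < Rn_dist m (c i) (\<omega> a)" unfolding fa by simp
    \<comment> \<open>Of the error 3 \<zeta>, two parts come from replacing the random dual value by
      \<open>Ac j\<close>, and one from replacing the average by its limit.\<close>
    have "(\<Sum>q\<in>cluster n j. max 0 (al j - Rn_dist m (\<omega> a) (\<omega> q))) \<le> n * (b j * Ec j (\<omega> a) + 3 * \<beta> * \<zeta>)"
      if j: "j \<in> {1..k}" for j
    proof -
      have "(\<Sum>q\<in>cluster n j. max 0 (al j - Rn_dist m (\<omega> a) (\<omega> q))) \<le>
          (\<Sum>q\<in>cluster n j. max 0 (Ac j - Rn_dist m (\<omega> a) (\<omega> q)) + 2 * \<zeta>)"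
        using al(2)[OF j] \<zeta>(1) by (intro sum_mono) (auto simp: max_def)
      also have "\<dots> = N j * (avg n \<omega> j (\<omega> a) + 2 * \<zeta>)"
        unfolding sum.distrib avg_N[OF j] by (simp add: card_cluster N_def distrib_left)
      also have "\<dots> \<le> N j * (Ec j (\<omega> a) + 3 * \<zeta>)"
        using close[OF i j in_ball[OF i a]] N(1)[OF j] by (intro mult_left_mono) auto
      also have "\<dots> = n * (b j * Ec j (\<omega> a) + 3 * b j * \<zeta>)"
        unfolding N(2)[OF j] by (simp add: algebra_simps)
      also have "\<dots> \<le> n * (b j * Ec j (\<omega> a) + 3 * \<beta> * \<zeta>)"
        using b_le[OF j] \<zeta>(1) by (intro mult_left_mono add_left_mono mult_right_mono) auto
      finally show ?thesis .
    qed
    then have "(\<Sum>j\<in>{1..k}. \<Sum>q\<in>cluster n j. max 0 (al j - Rn_dist m (\<omega> a) (\<omega> q))) \<le>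
        (\<Sum>j\<in>{1..k}. n * (b j * Ec j (\<omega> a) + 3 * \<beta> * \<zeta>))"
      by (rule sum_mono)
    also have "\<dots> = n * ((\<Sum>j\<in>{1..k}. b j * Ec j (\<omega> a)) + k * (3 * \<beta> * \<zeta>))"
      by (simp add: sum.distrib flip: sum_distrib_left)
    also have "\<dots> < n * (\<beta> * R)"
    proof (rule mult_strict_left_mono)
      have "\<tau>\<^sup>2 / (32 * R) \<le> (Rn_dist m (c i) (\<omega> a))\<^sup>2 / (32 * R)"
        using far \<tau>(1) R_pos by (intro divide_right_mono power_mono) auto
      moreover have "k * (3 * \<beta> * \<zeta>) < \<tau>\<^sup>2 / (32 * R)"
        using \<zeta>(3) R_pos by (simp add: less_divide_eq algebra_simps)
      ultimately show "(\<Sum>j\<in>{1..k}. b j * Ec j (\<omega> a)) + k * (3 * \<beta> * \<zeta>) < \<beta> * R"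
        using total_contribution[OF i in_ball[OF i a] m e1 e2] by linarith
    qed (use n in simp)
    finally show "(\<Sum>j\<in>{1..k}. \<Sum>q\<in>cluster n j. max 0 (al j - Rn_dist m (\<omega> a) (\<omega> q))) < W"
      unfolding W_def by (simp add: mult_ac)
  qed
qed

end

section \<open>From good samples to high probability\<close>

context separated_model begin

text \<open>Turns (a2) into a statement about averages: if no draw fell within
  \<open>\<zeta>\<close> of the center, the sample average of this bump function would be 0, far
  from its positive mean.\<close>

lemma expected_near_center_pos:
  assumes i: "i \<in> {1..k}" and \<zeta>: "0 < \<zeta>"
  shows "0 < (\<integral>x. max 0 (\<zeta> - Rn_dist m (c i) x) \<partial>\<mu> i)"
proof -
  interpret B: ball_prob "\<mu> i" m "c i" "\<rho> i" by (rule ball_probI[OF i])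
  \<comment> \<open>Half-width of a box around the center whose points have l1 distance, hence
    Euclidean distance, at most \<zeta>/2.\<close>
  define h where "h = \<zeta> / (2 * m)"
  have h: "0 < h" unfolding h_def using \<zeta> m2 by simp
  define U where "U = (\<Pi>\<^sub>E l\<in>{..<m}. ball (c i l) h)"
  define A where "A = Rn_cball m (c i) (\<rho> i) \<inter> U"
  have "openin (Rn_topology m) U" unfolding U_def by (subst openin_PiE) auto
  then have op: "openin (subtopology (Rn_topology m) (Rn_cball m (c i) (\<rho> i))) A"
    unfolding A_def by (auto simp: openin_subtopology Int_commute)
  have "c i \<in> A" unfolding A_def U_def using center_in_ball[OF i] center_in_Rn[OF i] h by (auto simp: PiE_iff)
  then have A: "0 < emeasure (\<mu> i) A" using pos[OF i] op unfolding positive_near_center_def by blast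
  \<comment> \<open>Non-measurable sets have \<open>emeasure\<close> 0, so positivity already gives
    measurability.\<close>
  then have As: "A \<in> sets (\<mu> i)" using emeasure_notin_sets by fastforce
  have near: "Rn_dist m (c i) x \<le> \<zeta> / 2" if "x \<in> A" for x
  proof -
    have "Rn_dist m (c i) x \<le> (\<Sum>l<m. \<bar>c i l - x l\<bar>)" unfolding Rn_dist_def by (rule L2_set_le_sum_abs)
    also have "\<dots> \<le> (\<Sum>l<m. h)"
      using that unfolding A_def U_def by (intro sum_mono) (auto simp: PiE_iff dist_real_def less_imp_le)
    also have "\<dots> = \<zeta> / 2" unfolding h_def using m2 by simp
    finally show ?thesis .
  qed
  have "0 < \<zeta> / 2 * B.prob A" using A \<zeta> by (simp add: B.emeasure_eq_measure)
  also have "\<dots> = (\<integral>x. \<zeta> / 2 * indicator A x \<partial>\<mu> i)" using As by simp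
  also have "\<dots> \<le> (\<integral>x. max 0 (\<zeta> - Rn_dist m (c i) x) \<partial>\<mu> i)"
  proof (rule integral_mono)
    show "integrable (\<mu> i) (\<lambda>x. \<zeta> / 2 * indicator A x)"
      using As \<zeta> by (intro B.integrable_bounded[of _ "\<zeta> / 2"]) (auto simp: indicator_def)
    show "integrable (\<mu> i) (\<lambda>x. max 0 (\<zeta> - Rn_dist m (c i) x))"
      using \<zeta> by (intro B.integrable_bounded[of _ \<zeta>]) auto
    show "\<zeta> / 2 * indicator A x \<le> max 0 (\<zeta> - Rn_dist m (c i) x)" for x
      using near[of x] by (cases "x \<in> A") (simp_all add: indicator_def le_max_iff_disj)
  qed
  finally show ?thesis .
qed

text \<open>Truncation preserves the Lipschitz constant 1 of the distance. Both \<open>Ec\<close>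
  and \<open>avg\<close> inherit it, so closeness on a finite net extends to all points of the
  balls.\<close>

lemma abs_truncation_diff:
  "\<bar>max 0 (A - Rn_dist m p x) - max 0 (A - Rn_dist m p' x)\<bar> \<le> Rn_dist m p p'"
proof -
  have "Rn_dist m p x \<le> Rn_dist m p p' + Rn_dist m p' x" "Rn_dist m p' x \<le> Rn_dist m p p' + Rn_dist m p x"
    using Rn_dist_triangle[of m p x p'] Rn_dist_triangle[of m p' x p] by (simp_all add: Rn_dist_commute)
  then show ?thesis by linarith
qed

lemma Ec_lipschitz: "i \<in> {1..k} \<Longrightarrow> \<bar>Ec i p - Ec i p'\<bar> \<le> Rn_dist m p p'"
proof -
  assume i: "i \<in> {1..k}"
  interpret B: ball_prob "\<mu> i" m "c i" "\<rho> i" by (rule ball_probI[OF i])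
  have int: "integrable (\<mu> i) (\<lambda>x. max 0 (Ac i - Rn_dist m q x))" for q
    using Ac_pos[OF i] by (intro B.integrable_bounded[of _ "Ac i"]) auto
  have "\<bar>Ec i p - Ec i p'\<bar> = \<bar>\<integral>x. max 0 (Ac i - Rn_dist m p x) - max 0 (Ac i - Rn_dist m p' x) \<partial>\<mu> i\<bar>"
    unfolding Ec_def using int by simp
  also have "\<dots> \<le> (\<integral>x. \<bar>max 0 (Ac i - Rn_dist m p x) - max 0 (Ac i - Rn_dist m p' x)\<bar> \<partial>\<mu> i)"
    by (rule integral_abs_bound)
  also have "\<dots> \<le> Rn_dist m p p'"
    using int abs_truncation_diff by (intro B.integral_le_const) auto
  finally show ?thesis .
qed

lemma avg_lipschitz:
  assumes "0 < sample_size b n i"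
  shows "\<bar>avg n \<omega> i p - avg n \<omega> i p'\<bar> \<le> Rn_dist m p p'"
proof -
  let ?f = "\<lambda>p q. max 0 (Ac i - Rn_dist m p (\<omega> q))"
  have "\<bar>(\<Sum>q\<in>cluster n i. ?f p q - ?f p' q)\<bar> \<le> (\<Sum>q\<in>cluster n i. Rn_dist m p p')"
    by (rule order_trans[OF sum_abs]) (intro sum_mono abs_truncation_diff)
  then have "\<bar>(\<Sum>q\<in>cluster n i. ?f p q) - (\<Sum>q\<in>cluster n i. ?f p' q)\<bar> \<le> sample_size b n i * Rn_dist m p p'"
    by (simp add: sum_subtractf card_cluster)
  then show ?thesis
    unfolding avg_def diff_divide_distrib[symmetric] abs_divide using assms by (simp add: divide_le_eq mult.commute)
qed

lemma AE_generic:
  assumes "3 \<le> n"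
  shows "AE \<omega> in Om n. inj_on \<omega> (idx n) \<and> (\<forall>i\<in>{1..k}. inj_on (total_dist n \<omega>) (cluster n i))"
proof -
  have "3 \<le> sample_size b n i" if "i \<in> {1..k}" for i
    using sample_size_ge[OF that, of n] assms by linarith
  then show ?thesis by (intro AE_conjI AE_points_distinct AE_medoid_unique)
qed

lemma recovery_whp_large_gap:
  assumes large: "(\<beta> + 2) * R \<le> eps"
  shows "with_high_probability (admissible_size k b) Om
    (\<lambda>n \<omega>. exact_recovery (Rn_dist m) k (drawn_points b n \<omega>))"
  unfolding with_high_probability_def
\<comment> \<open>Recovery holds almost surely once each ball has the three draws needed for unique
  medians, so the threshold is the same for every \<open>\<delta>\<close>.\<close>
proof (intro allI impI exI[of _ "3 :: nat"] conjI)
  fix \<delta> :: real and n :: nat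
  assume \<delta>: "0 < \<delta> \<and> \<delta> < 1" and n: "3 < n" and adm: "admissible_size k b n"
  interpret P: prob_space "Om n" by (rule prob_space_Om)
  have "AE \<omega> in Om n. exact_recovery (Rn_dist m) k (drawn_points b n \<omega>)"
    using AE_generic[OF less_imp_le[OF n]] AE_space
    by eventually_elim (use n recovery_large_gap[OF large adm] in auto)
  then have "P.prob {\<omega> \<in> space (Om n). exact_recovery (Rn_dist m) k (drawn_points b n \<omega>)} = 1"
    using sets_exact_recovery by (subst P.prob_Collect_eq_1) auto
  then show "1 - \<delta> < P.prob {\<omega> \<in> space (Om n). exact_recovery (Rn_dist m) k (drawn_points b n \<omega>)}"
    using \<delta> by simp
qed simp

lemma recovery_whp_small_gap:
  assumes m: "32 \<le> m"
    and e1: "512 * \<beta>\<^sup>2 * R ^ 4 * (k / m) / r\<^sup>2 \<le> eps\<^sup>2" and e2: "2 * (k / m) * R\<^sup>2 \<le> r\<^sup>2"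
  shows "with_high_probability (admissible_size k b) Om
    (\<lambda>n \<omega>. exact_recovery (Rn_dist m) k (drawn_points b n \<omega>))"
  unfolding with_high_probability_def
proof (intro allI impI)
  fix \<delta> :: real
  assume \<delta>: "0 < \<delta> \<and> \<delta> < 1"
  define \<tau> where "\<tau> = Min (insert (eps / 4) ((\<lambda>i. ec i / 2) ` {1..k}))"
  have \<tau>: "0 < \<tau>" "\<tau> \<le> eps / 4" "2 * \<tau> \<le> ec i" if "i \<in> {1..k}" for i
  proof -
    show "0 < \<tau>" unfolding \<tau>_def using eps ec_pos by (subst Min_gr_iff) auto
    show "\<tau> \<le> eps / 4" unfolding \<tau>_def by (rule Min_le) auto
    have "\<tau> \<le> ec i / 2" unfolding \<tau>_def using that by (intro Min_le) auto
    then show "2 * \<tau> \<le> ec i" by simp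
  qed
  have one: "1 \<in> {1..k}" using k1 by simp
  \<comment> \<open>With 128 in place of 96 the required inequality becomes strict.\<close>
  define \<zeta> where "\<zeta> = min (\<tau> / 4) (\<tau>\<^sup>2 / (128 * k * \<beta> * R))"
  have kbR: "0 < real k * \<beta> * R" using k1 \<beta> R_pos by simp
  have \<zeta>: "0 < \<zeta>" "\<zeta> \<le> \<tau> / 4" "96 * k * \<beta> * \<zeta> * R < \<tau>\<^sup>2"
  proof -
    show "0 < \<zeta>" "\<zeta> \<le> \<tau> / 4" unfolding \<zeta>_def using \<tau>(1)[OF one] kbR by (simp_all add: mult.assoc)
    have "\<zeta> \<le> \<tau>\<^sup>2 / (128 * k * \<beta> * R)" unfolding \<zeta>_def by simp
    then have "\<zeta> * (128 * (real k * \<beta> * R)) \<le> \<tau>\<^sup>2" using kbR by (simp add: le_divide_eq mult.assoc)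
    moreover have "0 < \<zeta> * (real k * \<beta> * R)" using \<open>0 < \<zeta>\<close> kbR by simp
    ultimately show "96 * k * \<beta> * \<zeta> * R < \<tau>\<^sup>2" by (simp add: mult_ac)
  qed
  have "\<forall>i. \<exists>F. finite F \<and> (\<forall>p\<in>Rn_cball m (c i) (\<rho> i). \<exists>p'\<in>F. Rn_dist m p p' \<le> \<zeta> / 3)"
    by (intro allI finite_net_Rn_cball) (use \<zeta>(1) in simp)
  then obtain net where net: "\<And>i. finite (net i)"
    "\<And>i p. p \<in> Rn_cball m (c i) (\<rho> i) \<Longrightarrow> \<exists>p'\<in>net i. Rn_dist m p p' \<le> \<zeta> / 3" by metis
  \<comment> \<open>The nets are united because the average over one ball is evaluated at points of
    every other ball.\<close>
  define F where "F = (\<Union>i\<in>{1..k}. net i)"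
  \<comment> \<open>The tests: \<open>Inl (j, p)\<close> compares \<open>avg\<close> with
    \<open>Ec\<close> for ball \<open>j\<close> at the net point \<open>p\<close>, and
    \<open>Inr i\<close> asks for a draw near the center of ball \<open>i\<close>.\<close>
  define T :: "(nat \<times> (nat \<Rightarrow> real) + nat) set" where "T = Inl ` ({1..k} \<times> F) \<union> Inr ` {1..k}"
  define ix :: "nat \<times> (nat \<Rightarrow> real) + nat \<Rightarrow> nat" where "ix = case_sum fst id"
  define f :: "nat \<times> (nat \<Rightarrow> real) + nat \<Rightarrow> (nat \<Rightarrow> real) \<Rightarrow> real" where
    "f = case_sum (\<lambda>(j, p) x. max 0 (Ac j - Rn_dist m p x)) (\<lambda>i x. max 0 (\<zeta> - Rn_dist m (c i) x))"
  define B where "B = case_sum (\<lambda>(j, p :: nat \<Rightarrow> real). Ac j) (\<lambda>i :: nat. \<zeta>)"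
  \<comment> \<open>One third of \<open>\<zeta>\<close> goes to the net points, the other two to the
    Lipschitz bounds of \<open>avg\<close> and \<open>Ec\<close>. For \<open>Inr\<close> the
    tolerance is the mean itself, so passing the test means that the sample average is not
    0.\<close>
  define \<eta> where "\<eta> = case_sum (\<lambda>_ :: nat \<times> (nat \<Rightarrow> real). \<zeta> / 3) (\<lambda>i. \<integral>x. max 0 (\<zeta> - Rn_dist m (c i) x) \<partial>\<mu> i)"
  define G where "G n = {\<omega> \<in> space (Om n). \<forall>t\<in>T.
    \<bar>(\<Sum>a\<in>cluster n (ix t). f t (\<omega> a)) / sample_size b n (ix t) - (\<integral>x. f t x \<partial>\<mu> (ix t))\<bar> < \<eta> t}" for n
  have "\<exists>N. \<forall>n\<ge>N. G n \<in> sets (Om n) \<and> 1 - \<delta> < measure (Om n) (G n)"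
    unfolding G_def
  proof (rule sample_averages_close[where B = B])
    show "finite T" unfolding T_def F_def using net(1) by auto
    show "0 < \<delta>" using \<delta> by simp
    have meas: "(\<lambda>x. max 0 (A - Rn_dist m p x)) \<in> borel_measurable (\<mu> j)" if "j \<in> {1..k}" for A p j
    proof -
      interpret B: ball_prob "\<mu> j" m "c j" "\<rho> j" by (rule ball_probI[OF that])
      show ?thesis by measurable
    qed
    fix t assume "t \<in> T"
    then consider j p where "t = Inl (j, p)" "j \<in> {1..k}" | i where "t = Inr i" "i \<in> {1..k}"
      unfolding T_def by blast
    then show "ix t \<in> {1..k} \<and> f t \<in> borel_measurable (\<mu> (ix t)) \<and>
      (\<forall>x\<in>space (\<mu> (ix t)). f t x \<in> {0..B t}) \<and> 0 < B t \<and> 0 < \<eta> t"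
    proof cases
      case 1
      then show ?thesis using meas[OF 1(2)] Ac_pos[OF 1(2)] \<zeta>(1) unfolding ix_def f_def B_def \<eta>_def by auto
    next
      case 2
      then show ?thesis using meas[OF 2(2)] expected_near_center_pos[OF 2(2) \<zeta>(1)] \<zeta>(1)
        unfolding ix_def f_def B_def \<eta>_def by auto
    qed
  qed
  then obtain N where N: "\<And>n. n \<ge> N \<Longrightarrow> G n \<in> sets (Om n) \<and> 1 - \<delta> < measure (Om n) (G n)" by blast
  have rec: "exact_recovery (Rn_dist m) k (drawn_points b n \<omega>)"
    if n: "3 < n" and adm: "admissible_size k b n" and \<omega>G: "\<omega> \<in> G n" and inj: "inj_on \<omega> (idx n)"
      and med: "\<forall>i\<in>{1..k}. inj_on (total_dist n \<omega>) (cluster n i)" for n \<omega>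
  proof (rule recovery_small_gap[OF m e1 e2 \<tau>(1,2)[OF one] \<tau>(3) \<zeta> adm])
    show "0 < n" using n by simp
    show "\<omega> \<in> space (Om n)" using \<omega>G unfolding G_def by simp
    show "inj_on \<omega> (idx n)" by fact
    show "inj_on (total_dist n \<omega>) (cluster n i)" if "i \<in> {1..k}" for i using med that by blast
    have size: "0 < sample_size b n i" if "i \<in> {1..k}" for i
      using sample_size_ge[OF that, of n] n by simp
    have Gt: "\<bar>(\<Sum>a\<in>cluster n (ix t). f t (\<omega> a)) / sample_size b n (ix t) - (\<integral>x. f t x \<partial>\<mu> (ix t))\<bar> < \<eta> t"
      if "t \<in> T" for t using \<omega>G that unfolding G_def by blast
    show "\<bar>avg n \<omega> j p - Ec j p\<bar> \<le> \<zeta>" if i: "i \<in> {1..k}" and j: "j \<in> {1..k}" and p: "p \<in> Rn_cball m (c i) (\<rho> i)" for i j p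
    proof -
      obtain p' where p': "p' \<in> net i" "Rn_dist m p p' \<le> \<zeta> / 3" using net(2)[OF p] by blast
      then have "Inl (j, p') \<in> T" using i j unfolding T_def F_def by blast
      from Gt[OF this] have "\<bar>avg n \<omega> j p' - Ec j p'\<bar> < \<zeta> / 3"
        unfolding ix_def f_def \<eta>_def avg_def Ec_def by simp
      then show ?thesis
        using avg_lipschitz[OF size[OF j], of \<omega> p p'] Ec_lipschitz[OF j, of p p'] p'(2) by linarith
    qed
    show "\<exists>q\<in>cluster n i. Rn_dist m (c i) (\<omega> q) < \<zeta>" if i: "i \<in> {1..k}" for i
    proof (rule ccontr)
      assume "\<not> (\<exists>q\<in>cluster n i. Rn_dist m (c i) (\<omega> q) < \<zeta>)"
      then have "(\<Sum>q\<in>cluster n i. max 0 (\<zeta> - Rn_dist m (c i) (\<omega> q))) = 0"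
        by (intro sum.neutral) (auto simp: max_def not_less)
      moreover have "Inr i \<in> T" using i unfolding T_def by blast
      from Gt[OF this] have "\<bar>(\<Sum>q\<in>cluster n i. max 0 (\<zeta> - Rn_dist m (c i) (\<omega> q))) / sample_size b n i
        - (\<integral>x. max 0 (\<zeta> - Rn_dist m (c i) x) \<partial>\<mu> i)\<bar> < (\<integral>x. max 0 (\<zeta> - Rn_dist m (c i) x) \<partial>\<mu> i)"
        unfolding ix_def f_def \<eta>_def by simp
      ultimately show False by simp
    qed
  qed
  have "1 - \<delta> < measure (Om n) {\<omega> \<in> space (Om n). exact_recovery (Rn_dist m) k (drawn_points b n \<omega>)}"
    if n: "n > max 3 N" and adm: "admissible_size k b n" for n
  proof -
    interpret P: prob_space "Om n" by (rule prob_space_Om)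
    have "AE \<omega> in Om n. \<omega> \<in> G n \<longrightarrow> \<omega> \<in> {\<omega> \<in> space (Om n). exact_recovery (Rn_dist m) k (drawn_points b n \<omega>)}"
    proof -
      have "3 \<le> n" using n by simp
      from AE_generic[OF this] AE_space show ?thesis
        by eventually_elim (use rec[OF _ adm] n in simp)
    qed
    then have "P.prob (G n) \<le> P.prob {\<omega> \<in> space (Om n). exact_recovery (Rn_dist m) k (drawn_points b n \<omega>)}"
      using sets_exact_recovery by (rule P.finite_measure_mono_AE)
    then show ?thesis using N[of n] n by linarith
  qed
  then show "\<exists>N>0. \<forall>n>N. admissible_size k b n \<longrightarrow>
    1 - \<delta> < measure (Om n) {\<omega> \<in> space (Om n). exact_recovery (Rn_dist m) k (drawn_points b n \<omega>)}"
    by (intro exI[of _ "max 3 N"]) auto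
qed

end

theorem theorem5:
  fixes \<beta> r R :: real
  assumes "1 \<le> \<beta>" and "0 < r" and "r \<le> R"
  shows "\<exists>C>0. \<forall>m\<ge>2. \<forall>k\<ge>1. \<forall>c \<rho> \<mu> b.
    esbm m k c \<rho> \<mu> b \<and>
    (\<forall>i\<in>{1..k}. rotation_invariant m (c i) (\<mu> i) \<and>
                positive_near_center m (c i) (\<rho> i) (\<mu> i) \<and>
                lebesgue_null_imp_null m (c i) (\<rho> i) (\<mu> i) \<and>
                r \<le> \<rho> i \<and> \<rho> i \<le> R \<and> b i \<le> \<beta>) \<and>
    (\<forall>i\<in>{1..k}. \<forall>j\<in>{1..k}. i \<noteq> j \<longrightarrow>
       Rn_dist m (c i) (c j) >
         (1 + \<beta>) * R + max (\<rho> i) (\<rho> j) + C * sqrt (real k * ln (real m) / real m))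
    \<longrightarrow> with_high_probability (admissible_size k b) (esbm_sample k \<mu> b)
          (\<lambda>n \<omega>. exact_recovery (Rn_dist m) k (drawn_points b n \<omega>))"
proof -
  \<comment> \<open>Chosen so that C^2 / 2 = 512 \<beta>^2 R^4 / r^2, the constant of
    \<open>far_gain_outer\<close>; the factor 1/2 is the lower bound for
    \<open>ln m\<close>.\<close>
  define C where "C = 32 * \<beta> * R\<^sup>2 / r"
  have R: "0 < R" using assms by linarith
  have C: "0 < C" unfolding C_def using assms R by simp
  show ?thesis
  proof (intro exI[of _ C] conjI C allI impI)
    fix m k :: nat and c \<rho> \<mu> b
    assume m: "2 \<le> m" and k: "1 \<le> k"
    assume hyp: "esbm m k c \<rho> \<mu> b \<and>
      (\<forall>i\<in>{1..k}. rotation_invariant m (c i) (\<mu> i) \<and>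
                positive_near_center m (c i) (\<rho> i) (\<mu> i) \<and>
                lebesgue_null_imp_null m (c i) (\<rho> i) (\<mu> i) \<and>
                r \<le> \<rho> i \<and> \<rho> i \<le> R \<and> b i \<le> \<beta>) \<and>
      (\<forall>i\<in>{1..k}. \<forall>j\<in>{1..k}. i \<noteq> j \<longrightarrow>
       Rn_dist m (c i) (c j) >
         (1 + \<beta>) * R + max (\<rho> i) (\<rho> j) + C * sqrt (real k * ln (real m) / real m))"
    define eps where "eps = C * sqrt (real k * ln (real m) / real m)"
    have ln_m: "1 / 2 \<le> ln (real m)"
    proof -
      have "ln 2 \<le> ln (real m)" using m by simp
      then show ?thesis using ln2_ge_two_thirds by linarith
    qed
    have eps: "0 < eps" unfolding eps_def using C k m ln_m by simp
    have eps2: "512 * \<beta>\<^sup>2 * R ^ 4 * (real k / real m) / r\<^sup>2 \<le> eps\<^sup>2"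
    proof -
      have "512 * \<beta>\<^sup>2 * R ^ 4 * (real k / real m) / r\<^sup>2 = C\<^sup>2 * (real k / real m * (1 / 2))"
        unfolding C_def by (simp add: power2_eq_square power4_eq_xxxx mult_ac)
      also have "\<dots> \<le> C\<^sup>2 * (real k / real m * ln (real m))"
        using ln_m by (intro mult_left_mono) auto
      also have "\<dots> = eps\<^sup>2"
        unfolding eps_def power_mult_distrib using ln_m by simp
      finally show ?thesis .
    qed
    have separated: "(1 + \<beta>) * R + max (\<rho> i) (\<rho> j) + eps < Rn_dist m (c i) (c j)"
      if "i \<in> {1..k}" "j \<in> {1..k}" "i \<noteq> j" for i j
      using hyp that unfolding eps_def by blast
    have facts: "rotation_invariant m (c i) (\<mu> i)" "positive_near_center m (c i) (\<rho> i) (\<mu> i)"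
      "lebesgue_null_imp_null m (c i) (\<rho> i) (\<mu> i)" "r \<le> \<rho> i" "\<rho> i \<le> R" "b i \<le> \<beta>"
      if "i \<in> {1..k}" for i using hyp that by blast+
    have sep: "\<rho> i + \<rho> j < Rn_dist m (c i) (c j)" if ij: "i \<in> {1..k}" "j \<in> {1..k}" "i \<noteq> j" for i j
    proof -
      have "1 * R \<le> \<beta> * R" using assms R by (intro mult_right_mono) auto
      then show ?thesis
        using separated[OF ij] facts(4,5)[OF ij(1)] facts(4,5)[OF ij(2)] assms(2) eps
          distrib_right[of 1 \<beta> R] by linarith
    qed
    interpret separated_model m k c \<rho> \<mu> b \<beta> r R eps
      by unfold_locales (use hyp m k assms eps facts sep separated in auto)
    show "with_high_probability (admissible_size k b) (esbm_sample k \<mu> b)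
          (\<lambda>n \<omega>. exact_recovery (Rn_dist m) k (drawn_points b n \<omega>))"
    proof (cases "(\<beta> + 2) * R \<le> eps")
      case True
      then show ?thesis by (rule recovery_whp_large_gap)
    next
      case False
      \<comment> \<open>A small gap forces a small k/m: from eps \<le> 3 \<beta> R and
        \<open>eps2\<close> one gets k/m \<le> 9 r^2/(512 R^2). Together with k \<ge> 1 and r \<le>
        R this yields m \<ge> 512/9, more than the 32 required, and it also gives the second
        smallness condition.\<close>
      have "(\<beta> + 2) * R \<le> (3 * \<beta>) * R" using assms R by (intro mult_right_mono) auto
      then have "eps\<^sup>2 \<le> (3 * \<beta> * R)\<^sup>2" using False eps by (intro power_mono) auto
      then have "512 * \<beta>\<^sup>2 * R ^ 4 * (real k / real m) / r\<^sup>2 \<le> (3 * \<beta> * R)\<^sup>2"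
        by (rule order_trans[OF eps2])
      then have "512 * \<beta>\<^sup>2 * R ^ 4 * (real k / real m) \<le> (3 * \<beta> * R)\<^sup>2 * r\<^sup>2"
        by (subst (asm) pos_divide_le_eq) (use assms in simp_all)
      then have "(\<beta>\<^sup>2 * R\<^sup>2) * (512 * (R\<^sup>2 * (real k / real m))) \<le> (\<beta>\<^sup>2 * R\<^sup>2) * (9 * r\<^sup>2)"
        by (simp add: power2_eq_square power4_eq_xxxx mult_ac)
      then have small: "512 * (R\<^sup>2 * (real k / real m)) \<le> 9 * r\<^sup>2"
        by (rule mult_left_le_imp_le) (use assms R in simp)
      have "r\<^sup>2 \<le> R\<^sup>2" using assms by (intro power_mono) auto
      moreover have "R\<^sup>2 * (1 / real m) \<le> R\<^sup>2 * (real k / real m)"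
        using k by (intro mult_left_mono divide_right_mono) auto
      ultimately have "512 * (R\<^sup>2 * (1 / real m)) \<le> 9 * R\<^sup>2" using small by linarith
      then have "R\<^sup>2 * (512 * (1 / real m)) \<le> R\<^sup>2 * 9" by (simp only: mult_ac)
      then have "512 * (1 / real m) \<le> 9" by (rule mult_left_le_imp_le) (use R in simp)
      then have "32 \<le> m" using m by (simp add: divide_le_eq)
      moreover have "2 * (real k / real m) * R\<^sup>2 \<le> r\<^sup>2"
      proof -
        have "0 \<le> R\<^sup>2 * (real k / real m)" by simp
        moreover have "2 * (real k / real m) * R\<^sup>2 = 2 * (R\<^sup>2 * (real k / real m))" by (simp only: mult_ac)
        ultimately show ?thesis using small by linarith
      qed
      ultimately show ?thesis using eps2 by (intro recovery_whp_small_gap)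
    qed
  qed
qed

end
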